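(* Let $G$ be a discrete group with the approximation property (AP). Then every $C^*$-dynamical system $(A,G,\alpha)$ has the Fejér property.
   Context: $A(G)$ is the Fourier algebra of $G$ (coefficient functions $s\mapsto\langle\lambda(s)\xi,\eta\rangle$ of the left regular representation $\lambda$), with the operator space structure as predual of $VN(G)=\lambda(G)''$. AP: $M_{cb}A(G)$ is the space of $\varphi\in \ell^\infty(G)$ such that $v\mapsto \varphi v$ is a completely bounded map $A(G)\to A(G)$, with the cb-norm. It is a dual space with predual $Q_{cb}(G)$, the completion of $\ell^1(G)$ in the norm $\|f\|=\sup\{|\sum_s f(s)\varphi(s)| : \|\varphi\|_{M_{cb}A(G)}\le 1\}$. $G$ has the AP if there is a net $(v_i)$ in $A(G)$ with $v_i\to 1$ in $\sigma(M_{cb}A(G),Q_{cb}(G))$. For discrete $G$, a $C^*$-dynamical system $(A,G,\alpha)$ is a $C^*$-algebra $A$ with a homomorphism $\alpha:G\to\mathrm{Aut}(A)$. $G\rtimes A$ is the reduced crossed product, $A$ is identified with its canonical copy in (the multiplier algebra of) it, and $u(x)$, $x\in G$, are the canonical unitaries; finite sums $\sum_{x\in G}a_xu(x)$, $a_x\in A$, are dense in $G\rtimes A$. A function $F:G\times A\to A$, linear in the second variable, is a bounded multiplier of $(A,G,\alpha)$ if the map $\sum_{x}a_xu(x)\mapsto\sum_x F(x,a_x)u(x)$ (finite sums) extends to a bounded map $M_F:G\rtimes A\to G\rtimes A$. $F$ has finite $G$-support if $F(x,\cdot)=0$ for all but finitely many $x\in G$. $(A,G,\alpha)$ has the Fejér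 property if there is a net $(F_i)$ of bounded multipliers, each with finite $G$-support, such that $M_{F_i}(T)\to T$ in norm for all $T\in G\rtimes A$. *)

theory Defs
  imports "HOL-Analysis.Analysis"
begin

section \<open>Complex vector spaces, Hilbert spaces and C*-algebras\<close>

class complex_vector = real_vector +
  fixes scaleC :: "complex \<Rightarrow> 'a \<Rightarrow> 'a"  (infixr \<open>*\<^sub>C\<close> 75)
  assumes scaleC_add_right: "c *\<^sub>C (x + y) = c *\<^sub>C x + c *\<^sub>C y"
    and scaleC_add_left: "(c + d) *\<^sub>C x = c *\<^sub>C x + d *\<^sub>C x"
    and scaleC_scaleC: "c *\<^sub>C (d *\<^sub>C x) = (c * d) *\<^sub>C x"
    and scaleC_of_real: "complex_of_real r *\<^sub>C x = r *\<^sub>R x"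

text \<open>The complex inner product is linear in its first argument; the inherited real inner
  product, which determines norm and topology, is its real part.\<close>

class complex_inner = complex_vector + real_inner +
  fixes cinner :: "'a \<Rightarrow> 'a \<Rightarrow> complex"
  assumes cinner_commute: "cinner x y = cnj (cinner y x)"
    and cinner_add_left: "cinner (x + y) z = cinner x z + cinner y z"
    and cinner_scaleC_left: "cinner (c *\<^sub>C x) y = c * cinner x y"
    and inner_eq_Re_cinner: "inner x y = Re (cinner x y)"

class chilbert_space = complex_inner + complete_space

text \<open>C*-algebras are not assumed to be unital.\<close>

class cstar_algebra = complex_vector + real_normed_algebra + banach +
  fixes star :: "'a \<Rightarrow> 'a"
  assumes norm_scaleC: "norm (c *\<^sub>C x) = cmod c * norm x"
    and scaleC_mult_left: "(c *\<^sub>C x) * y = c *\<^sub>C (x * y)"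
    and scaleC_mult_right: "x * (c *\<^sub>C y) = c *\<^sub>C (x * y)"
    and star_add: "star (x + y) = star x + star y"
    and star_scaleC: "star (c *\<^sub>C x) = cnj c *\<^sub>C star x"
    and star_mult: "star (x * y) = star y * star x"
    and star_star: "star (star x) = x"
    and cstar_identity: "norm (star x * x) = (norm x)\<^sup>2"

definition clinear_map :: "('a::complex_vector \<Rightarrow> 'b::complex_vector) \<Rightarrow> bool" where
  "clinear_map f \<longleftrightarrow> (\<forall>x y. f (x + y) = f x + f y) \<and> (\<forall>c x. f (c *\<^sub>C x) = c *\<^sub>C f x)"

instantiation complex :: chilbert_space
begin

definition scaleC_complex :: "complex \<Rightarrow> complex \<Rightarrow> complex" where
  "scaleC_complex c x = c * x"

definition cinner_complex :: "complex \<Rightarrow> complex \<Rightarrow> complex" where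
  "cinner_complex x y = x * cnj y"

instance
  by standard
    (auto simp: scaleC_complex_def cinner_complex_def algebra_simps scaleR_conv_of_real
      inner_complex_def)

end

context complex_inner
begin

lemma cinner_add_right: "cinner x (y + z) = cinner x y + cinner x z"
  by (metis cinner_add_left cinner_commute complex_cnj_add)

lemma cinner_self: "cinner x x = complex_of_real ((norm x)\<^sup>2)"
proof -
  have "Im (cinner x x) = 0"
    using cinner_commute[of x x] by (metis Reals_cnj_iff complex_is_Real_iff)
  moreover have "Re (cinner x x) = (norm x)\<^sup>2"
    by (simp add: norm_eq_sqrt_inner flip: inner_eq_Re_cinner)
  ultimately show ?thesis by (simp add: complex_eq_iff)
qed

lemma norm_scaleC_inner: "norm (c *\<^sub>C x) = cmod c * norm x"
proof -
  have "cinner (c *\<^sub>C x) (c *\<^sub>C x) = c * cnj (c * cinner x x)"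
    by (metis cinner_commute cinner_scaleC_left)
  also have "\<dots> = complex_of_real ((cmod c * norm x)\<^sup>2)"
    by (simp add: cinner_self power_mult_distrib complex_norm_square[symmetric] mult.assoc[symmetric])
  finally have "(norm (c *\<^sub>C x))\<^sup>2 = (cmod c * norm x)\<^sup>2"
    by (simp only: cinner_self of_real_eq_iff)
  moreover have "0 \<le> norm z" for z
    by (simp add: norm_eq_sqrt_inner)
  ultimately show ?thesis by (simp add: power2_eq_iff_nonneg)
qed

end

lemma cinner_bound:
  fixes x y :: "'a::complex_inner"
  shows "cmod (cinner x y) \<le> (norm x)\<^sup>2 + (norm y)\<^sup>2"
proof -
  have "\<bar>Re (cinner z y)\<bar> \<le> norm z * norm y" for z
    using Cauchy_Schwarz_ineq2[of z y] by (simp add: inner_eq_Re_cinner)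
  from this[of x] this[of "\<i> *\<^sub>C x"]
  have "cmod (cinner x y) \<le> 2 * (norm x * norm y)"
    using cmod_le[of "cinner x y"] by (simp add: cinner_scaleC_left norm_scaleC_inner)
  also have "\<dots> \<le> (norm x)\<^sup>2 + (norm y)\<^sup>2"
    using sum_squares_bound[of "norm x" "norm y"] by simp
  finally show ?thesis .
qed


section \<open>Square-summable families\<close>

typedef (overloaded) ('i, 'h::complex_inner) ell2 =
  "{f :: 'i \<Rightarrow> 'h. (\<lambda>i. (norm (f i))\<^sup>2) summable_on UNIV}"
  by (rule exI[of _ "\<lambda>_. 0"]) simp

lemma ell2_add:
  fixes f g :: "'i \<Rightarrow> 'h::complex_inner"
  assumes "(\<lambda>i. (norm (f i))\<^sup>2) summable_on UNIV" "(\<lambda>i. (norm (g i))\<^sup>2) summable_on UNIV"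
  shows "(\<lambda>i. (norm (f i + g i))\<^sup>2) summable_on UNIV"
proof (rule summable_on_comparison_test)
  show "(\<lambda>i. 2 * (norm (f i))\<^sup>2 + 2 * (norm (g i))\<^sup>2) summable_on UNIV"
    using assms by (intro summable_on_add summable_on_cmult_right)
  show "(norm (f i + g i))\<^sup>2 \<le> 2 * (norm (f i))\<^sup>2 + 2 * (norm (g i))\<^sup>2" for i
  proof -
    have "(norm (f i + g i))\<^sup>2 \<le> (norm (f i) + norm (g i))\<^sup>2"
      by (simp add: norm_triangle_ineq power_mono)
    also have "\<dots> \<le> 2 * (norm (f i))\<^sup>2 + 2 * (norm (g i))\<^sup>2"
      using sum_squares_bound[of "norm (f i)" "norm (g i)"] by (simp add: power2_sum)
    finally show ?thesis .
  qed
qed auto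

lemma ell2_scaleC:
  fixes f :: "'i \<Rightarrow> 'h::complex_inner"
  assumes "(\<lambda>i. (norm (f i))\<^sup>2) summable_on UNIV"
  shows "(\<lambda>i. (norm (c *\<^sub>C f i))\<^sup>2) summable_on UNIV"
  using summable_on_cmult_right[OF assms, of "(cmod c)\<^sup>2"]
  by (simp add: norm_scaleC_inner power_mult_distrib)

lemma Rep_ell2_summable: "(\<lambda>i. (norm (Rep_ell2 x i))\<^sup>2) summable_on UNIV"
  using Rep_ell2[of x] by simp

lemma ell2_cinner_summable:
  "(\<lambda>i. cinner (Rep_ell2 x i) (Rep_ell2 y i)) summable_on UNIV"
proof (rule abs_summable_summable, rule summable_on_comparison_test)
  show "(\<lambda>i. (norm (Rep_ell2 x i))\<^sup>2 + (norm (Rep_ell2 y i))\<^sup>2) summable_on UNIV"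
    by (intro summable_on_add Rep_ell2_summable)
qed (auto simp: cinner_bound)

instantiation ell2 :: (type, complex_inner) complex_inner
begin

definition zero_ell2 :: "('a, 'b) ell2" where
  "zero_ell2 = Abs_ell2 (\<lambda>_. 0)"
definition plus_ell2 :: "('a, 'b) ell2 \<Rightarrow> ('a, 'b) ell2 \<Rightarrow> ('a, 'b) ell2" where
  "plus_ell2 x y = Abs_ell2 (\<lambda>i. Rep_ell2 x i + Rep_ell2 y i)"
definition scaleC_ell2 :: "complex \<Rightarrow> ('a, 'b) ell2 \<Rightarrow> ('a, 'b) ell2" where
  "scaleC_ell2 c x = Abs_ell2 (\<lambda>i. c *\<^sub>C Rep_ell2 x i)"
definition scaleR_ell2 :: "real \<Rightarrow> ('a, 'b) ell2 \<Rightarrow> ('a, 'b) ell2" where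
  "scaleR_ell2 r x = complex_of_real r *\<^sub>C x"
definition uminus_ell2 :: "('a, 'b) ell2 \<Rightarrow> ('a, 'b) ell2" where
  "uminus_ell2 x = (- 1) *\<^sub>C x"
definition minus_ell2 :: "('a, 'b) ell2 \<Rightarrow> ('a, 'b) ell2 \<Rightarrow> ('a, 'b) ell2" where
  "minus_ell2 x y = x + - y"
definition cinner_ell2 :: "('a, 'b) ell2 \<Rightarrow> ('a, 'b) ell2 \<Rightarrow> complex" where
  "cinner_ell2 x y = (\<Sum>\<^sub>\<infinity>i. cinner (Rep_ell2 x i) (Rep_ell2 y i))"
definition inner_ell2 :: "('a, 'b) ell2 \<Rightarrow> ('a, 'b) ell2 \<Rightarrow> real" where
  "inner_ell2 x y = Re (cinner x y)"
definition norm_ell2 :: "('a, 'b) ell2 \<Rightarrow> real" where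
  "norm_ell2 x = sqrt (inner x x)"
definition dist_ell2 :: "('a, 'b) ell2 \<Rightarrow> ('a, 'b) ell2 \<Rightarrow> real" where
  "dist_ell2 x y = norm (x - y)"
definition sgn_ell2 :: "('a, 'b) ell2 \<Rightarrow> ('a, 'b) ell2" where
  "sgn_ell2 x = inverse (norm x) *\<^sub>R x"
definition uniformity_ell2 :: "(('a, 'b) ell2 \<times> ('a, 'b) ell2) filter" where
  "uniformity_ell2 = (INF e\<in>{0<..}. principal {(x, y). dist x y < e})"
definition open_ell2 :: "('a, 'b) ell2 set \<Rightarrow> bool" where
  "open_ell2 U \<longleftrightarrow> (\<forall>x\<in>U. eventually (\<lambda>(x', y). x' = x \<longrightarrow> y \<in> U) uniformity)"

lemma Rep_zero_ell2: "Rep_ell2 0 i = 0"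
  unfolding zero_ell2_def by (subst Abs_ell2_inverse) auto

lemma Rep_plus_ell2: "Rep_ell2 (x + y) i = Rep_ell2 x i + Rep_ell2 y i"
  unfolding plus_ell2_def
  by (subst Abs_ell2_inverse) (auto intro: ell2_add Rep_ell2_summable)

lemma Rep_scaleC_ell2: "Rep_ell2 (c *\<^sub>C x) i = c *\<^sub>C Rep_ell2 x i"
  unfolding scaleC_ell2_def
  by (subst Abs_ell2_inverse) (auto intro: ell2_scaleC Rep_ell2_summable)

lemma Rep_scaleR_ell2: "Rep_ell2 (r *\<^sub>R x) i = r *\<^sub>R Rep_ell2 x i"
  by (simp add: scaleR_ell2_def Rep_scaleC_ell2 scaleC_of_real)

lemma Rep_uminus_ell2: "Rep_ell2 (- x) i = - Rep_ell2 x i"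
  using scaleC_of_real[of "-1" "Rep_ell2 x i"] by (simp add: uminus_ell2_def Rep_scaleC_ell2)

lemma Rep_minus_ell2: "Rep_ell2 (x - y) i = Rep_ell2 x i - Rep_ell2 y i"
  by (simp add: minus_ell2_def Rep_plus_ell2 Rep_uminus_ell2)

lemma ell2_eqI: "(\<And>i. Rep_ell2 x i = Rep_ell2 y i) \<Longrightarrow> x = y"
  by (metis Rep_ell2_inject ext)

lemmas Rep_ell2_simps =
  Rep_zero_ell2 Rep_plus_ell2 Rep_scaleC_ell2 Rep_scaleR_ell2 Rep_uminus_ell2 Rep_minus_ell2

lemma cinner_ell2_self:
  fixes x :: "('a, 'b) ell2"
  shows "cinner x x = complex_of_real (\<Sum>\<^sub>\<infinity>i. (norm (Rep_ell2 x i))\<^sup>2)"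
  unfolding cinner_ell2_def cinner_self
  by (intro infsumI has_sum_of_real has_sum_infsum Rep_ell2_summable)

instance
proof
  fix x y z :: "('a, 'b) ell2" and a b :: real and c d :: complex
  show "x + y + z = x + (y + z)" "x + y = y + x" "0 + x = x" "- x + x = 0" "x - y = x + - y"
    by (auto intro!: ell2_eqI simp: Rep_ell2_simps)
  show "a *\<^sub>R (x + y) = a *\<^sub>R x + a *\<^sub>R y" "(a + b) *\<^sub>R x = a *\<^sub>R x + b *\<^sub>R x"
    "a *\<^sub>R b *\<^sub>R x = (a * b) *\<^sub>R x" "1 *\<^sub>R x = x"
    by (auto intro!: ell2_eqI simp: Rep_ell2_simps scaleR_add_right scaleR_add_left)
  show "c *\<^sub>C (x + y) = c *\<^sub>C x + c *\<^sub>C y" "(c + d) *\<^sub>C x = c *\<^sub>C x + d *\<^sub>C x"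
    "c *\<^sub>C (d *\<^sub>C x) = (c * d) *\<^sub>C x" "complex_of_real a *\<^sub>C x = a *\<^sub>R x"
    by (auto intro!: ell2_eqI
        simp: Rep_ell2_simps scaleC_add_right scaleC_add_left scaleC_scaleC scaleC_of_real)
  have comm: "cinner x y = cnj (cinner y x)" for x y :: "('a, 'b) ell2"
    unfolding cinner_ell2_def by (subst infsum_cnj[symmetric]) (metis cinner_commute)
  show "cinner x y = cnj (cinner y x)"
    by (rule comm)
  show add: "cinner (x + y) z = cinner x z + cinner y z"
    unfolding cinner_ell2_def Rep_ell2_simps cinner_add_left
    by (rule infsum_add) (rule ell2_cinner_summable)+
  have scale: "cinner (c *\<^sub>C x) y = c * cinner x y" for c and x y :: "('a, 'b) ell2"
    unfolding cinner_ell2_def Rep_ell2_simps cinner_scaleC_left by (rule infsum_cmult_right')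
  show "cinner (c *\<^sub>C x) y = c * cinner x y"
    by (rule scale)
  show "inner x y = Re (cinner x y)"
    by (rule inner_ell2_def)
  show "inner x y = inner y x"
    unfolding inner_ell2_def by (subst comm) simp
  show "inner (x + y) z = inner x z + inner y z"
    by (simp add: inner_ell2_def add)
  show "inner (a *\<^sub>R x) y = a * inner x y"
    by (simp add: inner_ell2_def scaleR_ell2_def scale)
  show "0 \<le> inner x x"
    by (simp add: inner_ell2_def cinner_ell2_self infsum_nonneg)
  show "inner x x = 0 \<longleftrightarrow> x = 0"
  proof
    assume "inner x x = 0"
    then have "(\<Sum>\<^sub>\<infinity>i. (norm (Rep_ell2 x i))\<^sup>2) = 0"
      by (simp add: inner_ell2_def cinner_ell2_self)
    then have "(norm (Rep_ell2 x i))\<^sup>2 = 0" for i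
      using nonneg_infsum_le_0D[of "\<lambda>i. (norm (Rep_ell2 x i))\<^sup>2" UNIV i] Rep_ell2_summable[of x]
      by simp
    then show "x = 0"
      by (auto intro!: ell2_eqI simp: Rep_ell2_simps)
  qed (simp add: inner_ell2_def cinner_ell2_self Rep_ell2_simps)
qed (simp_all add: norm_ell2_def dist_ell2_def sgn_ell2_def uniformity_ell2_def open_ell2_def)

end

lemma norm_ell2_eq: "norm x = sqrt (\<Sum>\<^sub>\<infinity>i. (norm (Rep_ell2 x i))\<^sup>2)"
  by (simp add: norm_ell2_def inner_ell2_def cinner_ell2_self)


section \<open>Left regular representation, group von Neumann algebra, Fourier algebra\<close>

text \<open>A discrete group is a type of class \<open>group_add\<close>; this class does not assume commutativity,
  and \<open>s + t\<close>, \<open>- s\<close>, \<open>0\<close> stand for the product, the inverse and the neutral element.\<close>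

definition left_regular ::
    "'g::group_add \<Rightarrow> ('g, 'h::complex_inner) ell2 \<Rightarrow>\<^sub>L ('g, 'h) ell2" where
  "left_regular s = Blinfun (\<lambda>\<xi>. Abs_ell2 (\<lambda>t. Rep_ell2 \<xi> (- s + t)))"

lemma left_translation_bij: "bij_betw (\<lambda>t. - s + t) UNIV (UNIV :: 'g::group_add set)"
  by (rule bij_betwI[of _ _ _ "\<lambda>t. s + t"]) (auto simp: add.assoc[symmetric])

lemma Rep_left_translation:
  fixes \<xi> :: "('g::group_add, 'h::complex_inner) ell2"
  shows "Rep_ell2 (Abs_ell2 (\<lambda>t. Rep_ell2 \<xi> (- s + t))) t = Rep_ell2 \<xi> (- s + t)"
  using summable_on_reindex_bij_betw[OF left_translation_bij, of "\<lambda>i. (norm (Rep_ell2 \<xi> i))\<^sup>2" s]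
  by (subst Abs_ell2_inverse) (auto simp: Rep_ell2_summable)

lemma Rep_left_regular:
  fixes \<xi> :: "('g::group_add, 'h::complex_inner) ell2"
  shows "Rep_ell2 (left_regular s \<xi>) t = Rep_ell2 \<xi> (- s + t)"
proof -
  let ?L = "\<lambda>\<xi> :: ('g, 'h) ell2. Abs_ell2 (\<lambda>t. Rep_ell2 \<xi> (- s + t))"
  have "bounded_linear ?L"
  proof (rule bounded_linear_intro[where K = 1])
    show "norm (?L x) \<le> norm x * 1" for x
      using infsum_reindex_bij_betw[OF left_translation_bij, of "\<lambda>i. (norm (Rep_ell2 x i))\<^sup>2" s]
      by (simp add: norm_ell2_eq Rep_left_translation)
    show "?L (x + y) = ?L x + ?L y" for x y
      by (rule ell2_eqI, subst Rep_left_translation[of "x + y" s])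
        (simp only: Rep_plus_ell2 Rep_left_translation)
    show "?L (r *\<^sub>R x) = r *\<^sub>R ?L x" for r x
      by (rule ell2_eqI, subst Rep_left_translation[of "r *\<^sub>R x" s])
        (simp only: Rep_scaleR_ell2 Rep_left_translation)
  qed
  then show ?thesis
    by (simp add: left_regular_def bounded_linear_Blinfun_apply Rep_left_translation)
qed

text \<open>The library's bounded operators are real-linear; the bounded operators of a complex Hilbert
  space are the complex-linear ones among them, with the same operator norm.\<close>

definition cblinops :: "('h::complex_inner \<Rightarrow>\<^sub>L 'h) set" where
  "cblinops = {T. clinear_map (blinfun_apply T)}"

definition commutant :: "('h::complex_inner \<Rightarrow>\<^sub>L 'h) set \<Rightarrow> ('h \<Rightarrow>\<^sub>L 'h) set" where
  "commutant \<S> = {T \<in> cblinops. \<forall>S\<in>\<S>. T o\<^sub>L S = S o\<^sub>L T}"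

definition group_vN :: "(('g::group_add, complex) ell2 \<Rightarrow>\<^sub>L ('g, complex) ell2) set" where
  "group_vN = commutant (commutant (range left_regular))"

definition coefficient ::
    "('g::group_add, complex) ell2 \<Rightarrow> ('g, complex) ell2 \<Rightarrow> 'g \<Rightarrow> complex" where
  "coefficient \<xi> \<eta> = (\<lambda>s. cinner (left_regular s \<xi>) \<eta>)"

definition fourier_algebra :: "('g::group_add \<Rightarrow> complex) set" where
  "fourier_algebra = {coefficient \<xi> \<eta> | \<xi> \<eta>. True}"

text \<open>The duality identifying \<open>A(G)\<close> with the predual of \<open>VN(G)\<close>: the coefficient function of
  \<open>\<xi>, \<eta>\<close> is the functional mapping \<open>T\<close> to \<open>\<langle>T \<xi>, \<eta>\<rangle>\<close>. On \<open>VN(G)\<close> this value depends on the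
  coefficient function only.\<close>

definition fourier_pairing ::
    "('g::group_add \<Rightarrow> complex) \<Rightarrow> (('g, complex) ell2 \<Rightarrow>\<^sub>L ('g, complex) ell2) \<Rightarrow> complex" where
  "fourier_pairing v T = (THE c. \<exists>\<xi> \<eta>. v = coefficient \<xi> \<eta> \<and> c = cinner (T \<xi>) \<eta>)"


section \<open>Completely bounded multipliers and the approximation property\<close>

text \<open>Norm of the operator matrix \<open>(X k l)\<close>, \<open>k, l \<in> I\<close>, on the Hilbert space sum of copies of
  \<open>'h\<close> indexed by the finite set \<open>I\<close>.\<close>

definition matrix_opnorm ::
    "'i set \<Rightarrow> ('i \<Rightarrow> 'i \<Rightarrow> 'h::complex_inner \<Rightarrow> 'h) \<Rightarrow> real" where
  "matrix_opnorm I X =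
     Sup {sqrt (\<Sum>k\<in>I. (norm (\<Sum>l\<in>I. X k l (\<xi> l)))\<^sup>2) | \<xi>. (\<Sum>l\<in>I. (norm (\<xi> l))\<^sup>2) \<le> 1}"

text \<open>Norm of \<open>M\<^sub>n(A(G))\<close> for the predual operator space structure: an \<open>n \<times> n\<close> matrix over
  \<open>A(G)\<close> is a map from \<open>VN(G)\<close> to the \<open>n \<times> n\<close> scalar matrices, and it is given its cb-norm.\<close>

definition fourier_matrix_norm :: "nat \<Rightarrow> (nat \<Rightarrow> nat \<Rightarrow> 'g::group_add \<Rightarrow> complex) \<Rightarrow> real" where
  "fourier_matrix_norm n v =
     Sup {matrix_opnorm ({..<n} \<times> {..<m})
            (\<lambda>(i, k) (j, l). (*) (fourier_pairing (v i j) (X k l))) | (m::nat) X.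
          (\<forall>k<m. \<forall>l<m. X k l \<in> group_vN) \<and>
          matrix_opnorm {..<m} (\<lambda>k l. blinfun_apply (X k l)) \<le> 1}"

definition McbA :: "('g::group_add \<Rightarrow> complex) set" where
  "McbA = {\<phi>. bounded (range \<phi>) \<and>
     (\<forall>v\<in>fourier_algebra. (\<lambda>s. \<phi> s * v s) \<in> fourier_algebra) \<and>
     (\<exists>C. \<forall>n v. (\<forall>i<n. \<forall>j<n. v i j \<in> fourier_algebra) \<longrightarrow>
        fourier_matrix_norm n (\<lambda>i j s. \<phi> s * v i j s) \<le> C * fourier_matrix_norm n v)}"

definition cb_norm :: "('g::group_add \<Rightarrow> complex) \<Rightarrow> real" where
  "cb_norm \<phi> =
     Sup {fourier_matrix_norm n (\<lambda>i j s. \<phi> s * v i j s) | n v.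
          (\<forall>i<n. \<forall>j<n. v i j \<in> fourier_algebra) \<and> fourier_matrix_norm n v \<le> 1}"

definition Qcb_norm :: "('g::group_add \<Rightarrow> complex) \<Rightarrow> real" where
  "Qcb_norm f = Sup {cmod (\<Sum>\<^sub>\<infinity>s. f s * \<phi> s) | \<phi>. \<phi> \<in> McbA \<and> cb_norm \<phi> \<le> 1}"

text \<open>The elements of the completion \<open>Q\<^sub>c\<^sub>b(G)\<close> are represented by the sequences in \<open>\<ell>\<^sup>1(G)\<close> that
  are Cauchy for \<open>Qcb_norm\<close>; their pairing with \<open>\<phi>\<close> is the continuous extension of
  \<open>f \<mapsto> \<Sum>\<^sub>s f(s) \<phi>(s)\<close>.\<close>

definition Qcb :: "(nat \<Rightarrow> 'g::group_add \<Rightarrow> complex) set" where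
  "Qcb = {q. (\<forall>n. (\<lambda>s. cmod (q n s)) summable_on UNIV) \<and>
     (\<forall>e>0. \<exists>N. \<forall>m\<ge>N. \<forall>n\<ge>N. Qcb_norm (\<lambda>s. q m s - q n s) < e)}"

definition Qcb_pairing ::
    "('g::group_add \<Rightarrow> complex) \<Rightarrow> (nat \<Rightarrow> 'g \<Rightarrow> complex) \<Rightarrow> complex" where
  "Qcb_pairing \<phi> q = lim (\<lambda>n. \<Sum>\<^sub>\<infinity>s. q n s * \<phi> s)"

text \<open>Here and below nets are expressed by proper filters: the tail filter of a net is proper, and
  a proper filter is the tail filter of a net.\<close>

definition approximation_property :: "'g::group_add itself \<Rightarrow> bool" where
  "approximation_property _ \<longleftrightarrow>
     (\<exists>\<F> :: ('g \<Rightarrow> complex) filter. \<F> \<noteq> bot \<and>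
        (\<forall>\<^sub>F v in \<F>. v \<in> fourier_algebra) \<and>
        (\<forall>q\<in>Qcb. ((\<lambda>v. Qcb_pairing v q) \<longlongrightarrow> Qcb_pairing (\<lambda>_. 1) q) \<F>))"


section \<open>Reduced crossed products and the Fejer property\<close>

definition star_automorphism :: "('a::cstar_algebra \<Rightarrow> 'a) \<Rightarrow> bool" where
  "star_automorphism \<theta> \<longleftrightarrow> clinear_map \<theta> \<and> bij \<theta> \<and>
     (\<forall>a b. \<theta> (a * b) = \<theta> a * \<theta> b) \<and> (\<forall>a. \<theta> (star a) = star (\<theta> a))"

definition cstar_dynamical_system :: "('g::group_add \<Rightarrow> 'a::cstar_algebra \<Rightarrow> 'a) \<Rightarrow> bool" where
  "cstar_dynamical_system \<alpha> \<longleftrightarrow>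
     (\<forall>s. star_automorphism (\<alpha> s)) \<and> (\<forall>s t. \<alpha> (s + t) = \<alpha> s \<circ> \<alpha> t)"

definition faithful_representation ::
    "('a::cstar_algebra \<Rightarrow> 'h::chilbert_space \<Rightarrow>\<^sub>L 'h) \<Rightarrow> bool" where
  "faithful_representation \<sigma> \<longleftrightarrow>
     inj \<sigma> \<and> range \<sigma> \<subseteq> cblinops \<and>
     (\<forall>a b. \<sigma> (a + b) = \<sigma> a + \<sigma> b) \<and>
     (\<forall>c a x. \<sigma> (c *\<^sub>C a) x = c *\<^sub>C \<sigma> a x) \<and>
     (\<forall>a b. \<sigma> (a * b) = \<sigma> a o\<^sub>L \<sigma> b) \<and>
     (\<forall>a x y. cinner (\<sigma> (star a) x) y = cinner x (\<sigma> a y))"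

text \<open>The canonical copy of \<open>A\<close> on \<open>\<ell>\<^sup>2(G, H)\<close>, for a representation \<open>\<sigma>\<close> of \<open>A\<close> on \<open>H\<close>. Since
  *-homomorphisms of C*-algebras are contractive, the right-hand side is a bounded operator. The
  canonical unitary \<open>u(x)\<close> is \<open>left_regular x\<close> on the same space.\<close>

definition crossed_embed ::
    "('a::cstar_algebra \<Rightarrow> 'h::chilbert_space \<Rightarrow>\<^sub>L 'h) \<Rightarrow> ('g::group_add \<Rightarrow> 'a \<Rightarrow> 'a) \<Rightarrow>
     'a \<Rightarrow> ('g, 'h) ell2 \<Rightarrow>\<^sub>L ('g, 'h) ell2" where
  "crossed_embed \<sigma> \<alpha> a =
     Blinfun (\<lambda>\<xi>. Abs_ell2 (\<lambda>t. blinfun_apply (\<sigma> (\<alpha> (- t) a)) (Rep_ell2 \<xi> t)))"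

text \<open>The finite sum of the \<open>a\<^sub>x u(x)\<close>, for a finitely supported family \<open>a\<close>.\<close>

definition crossed_sum ::
    "('a::cstar_algebra \<Rightarrow> 'h::chilbert_space \<Rightarrow>\<^sub>L 'h) \<Rightarrow> ('g::group_add \<Rightarrow> 'a \<Rightarrow> 'a) \<Rightarrow>
     ('g \<Rightarrow> 'a) \<Rightarrow> ('g, 'h) ell2 \<Rightarrow>\<^sub>L ('g, 'h) ell2" where
  "crossed_sum \<sigma> \<alpha> a = (\<Sum>x | a x \<noteq> 0. crossed_embed \<sigma> \<alpha> (a x) o\<^sub>L left_regular x)"

definition reduced_crossed_product ::
    "('a::cstar_algebra \<Rightarrow> 'h::chilbert_space \<Rightarrow>\<^sub>L 'h) \<Rightarrow> ('g::group_add \<Rightarrow> 'a \<Rightarrow> 'a) \<Rightarrow>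
     (('g, 'h) ell2 \<Rightarrow>\<^sub>L ('g, 'h) ell2) set" where
  "reduced_crossed_product \<sigma> \<alpha> = closure {crossed_sum \<sigma> \<alpha> a | a. finite {x. a x \<noteq> 0}}"

text \<open>\<open>M\<close> is a bounded complex-linear map of the reduced crossed product into itself that extends
  the map induced by \<open>F\<close> on finite sums; complex scalars act on operators pointwise. Values of \<open>M\<close>
  outside the reduced crossed product are irrelevant.\<close>

definition extends_multiplier ::
    "('a::cstar_algebra \<Rightarrow> 'h::chilbert_space \<Rightarrow>\<^sub>L 'h) \<Rightarrow> ('g::group_add \<Rightarrow> 'a \<Rightarrow> 'a) \<Rightarrow>
     ('g \<Rightarrow> 'a \<Rightarrow> 'a) \<Rightarrow>
     ((('g, 'h) ell2 \<Rightarrow>\<^sub>L ('g, 'h) ell2) \<Rightarrow> (('g, 'h) ell2 \<Rightarrow>\<^sub>L ('g, 'h) ell2)) \<Rightarrow> bool" where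
  "extends_multiplier \<sigma> \<alpha> F M \<longleftrightarrow>
     (let P = reduced_crossed_product \<sigma> \<alpha> in
       (\<forall>T\<in>P. M T \<in> P) \<and>
       (\<forall>S\<in>P. \<forall>T\<in>P. M (S + T) = M S + M T) \<and>
       (\<forall>c. \<forall>S\<in>P. \<forall>T\<in>P.
          (\<forall>\<xi>. blinfun_apply S \<xi> = c *\<^sub>C blinfun_apply T \<xi>) \<longrightarrow>
          (\<forall>\<xi>. blinfun_apply (M S) \<xi> = c *\<^sub>C blinfun_apply (M T) \<xi>)) \<and>
       (\<exists>K. \<forall>T\<in>P. norm (M T) \<le> K * norm T) \<and>
       (\<forall>a. finite {x. a x \<noteq> 0} \<longrightarrow>
          M (crossed_sum \<sigma> \<alpha> a) = crossed_sum \<sigma> \<alpha> (\<lambda>x. F x (a x))))"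

definition bounded_multiplier ::
    "('a::cstar_algebra \<Rightarrow> 'h::chilbert_space \<Rightarrow>\<^sub>L 'h) \<Rightarrow> ('g::group_add \<Rightarrow> 'a \<Rightarrow> 'a) \<Rightarrow>
     ('g \<Rightarrow> 'a \<Rightarrow> 'a) \<Rightarrow> bool" where
  "bounded_multiplier \<sigma> \<alpha> F \<longleftrightarrow>
     (\<forall>x. clinear_map (F x)) \<and> (\<exists>M. extends_multiplier \<sigma> \<alpha> F M)"

definition multiplier_map ::
    "('a::cstar_algebra \<Rightarrow> 'h::chilbert_space \<Rightarrow>\<^sub>L 'h) \<Rightarrow> ('g::group_add \<Rightarrow> 'a \<Rightarrow> 'a) \<Rightarrow>
     ('g \<Rightarrow> 'a \<Rightarrow> 'a) \<Rightarrow>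
     (('g, 'h) ell2 \<Rightarrow>\<^sub>L ('g, 'h) ell2) \<Rightarrow> (('g, 'h) ell2 \<Rightarrow>\<^sub>L ('g, 'h) ell2)" where
  "multiplier_map \<sigma> \<alpha> F = (SOME M. extends_multiplier \<sigma> \<alpha> F M)"

definition finite_G_support :: "('g \<Rightarrow> 'a::cstar_algebra \<Rightarrow> 'a) \<Rightarrow> bool" where
  "finite_G_support F \<longleftrightarrow> finite {x. F x \<noteq> (\<lambda>_. 0)}"

text \<open>The reduced crossed product is realised through the faithful representation \<open>\<sigma>\<close>; up to
  canonical isomorphism it does not depend on this choice.\<close>

definition fejer_property ::
    "('a::cstar_algebra \<Rightarrow> 'h::chilbert_space \<Rightarrow>\<^sub>L 'h) \<Rightarrow> ('g::group_add \<Rightarrow> 'a \<Rightarrow> 'a) \<Rightarrow> bool" where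
  "fejer_property \<sigma> \<alpha> \<longleftrightarrow>
     (\<exists>\<F> :: ('g \<Rightarrow> 'a \<Rightarrow> 'a) filter. \<F> \<noteq> bot \<and>
        (\<forall>\<^sub>F F in \<F>. bounded_multiplier \<sigma> \<alpha> F \<and> finite_G_support F) \<and>
        (\<forall>T\<in>reduced_crossed_product \<sigma> \<alpha>. ((\<lambda>F. multiplier_map \<sigma> \<alpha> F T) \<longlongrightarrow> T) \<F>))"

end

theory Submission
  imports Defs
begin

text \<open>An operator \<open>T\<close> on \<open>\<ell>\<^sup>2(G, H)\<close> has matrix entries \<open>T(s, t)\<close> in \<open>B(H)\<close>, and the multiplier of the
  crossed product attached to a function \<open>\<phi>\<close> on \<open>G\<close> is the Schur multiplication of \<open>T(s, t)\<close> by
  \<open>\<phi>(s t\<^sup>-\<^sup>1)\<close>. It is contractive if \<open>\<phi>\<close> lies in the unit ball of \<open>M\<^sub>c\<^sub>bA(G)\<close>, and bounded by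
  \<open>\<parallel>\<xi>\<parallel> \<parallel>\<eta>\<parallel>\<close> if \<open>\<phi>\<close> is the coefficient function of \<open>\<xi>, \<eta>\<close>. Hence, for \<open>T\<^sub>1, \<dots>, T\<^sub>n\<close> in the crossed product
  and a continuous functional \<open>\<omega>\<close> on \<open>n\<close>-tuples of operators, \<open>\<phi> \<mapsto> \<omega>(\<phi> T\<^sub>1, \<dots>, \<phi> T\<^sub>n)\<close> belongs to
  \<open>Q\<^sub>c\<^sub>b(G)\<close>: approximate the \<open>T\<^sub>j\<close> by finite sums. If \<open>\<omega>\<close> vanishes on \<open>(v T\<^sub>1, \<dots>, v T\<^sub>n)\<close> for all
  finitely supported \<open>v\<close>, then it does so for all \<open>v\<close> in \<open>A(G)\<close> by density, and the AP yields
  \<open>\<omega>(T\<^sub>1, \<dots>, T\<^sub>n) = 0\<close>. By Hahn--Banach, \<open>(T\<^sub>1, \<dots>, T\<^sub>n)\<close> is a norm limit of tuples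
  \<open>(v T\<^sub>1, \<dots>, v T\<^sub>n)\<close> with \<open>v\<close> finitely supported.\<close>

section \<open>Complex inner product spaces\<close>

text \<open>The AP gives convergence only after pairing with elements of \<open>Qcb\<close>, whereas
  the Fejer property asks for norm convergence. Linearity in v bridges the gap: for a subspace,
  membership in the norm closure can be tested by functionals. Tuples enter because one v must serve
  finitely many operators at once; this is what makes the filter of multipliers proper. The two norm
  bounds have different tasks. Elements of \<open>McbA\<close> are applied to finite sums, where the
  Schur product is given by an explicit formula, and the cb-norm bound makes the approximating
  sequence Cauchy for \<open>Qcb_norm\<close>. The bound for coefficient functions extends the
  action of A(G) to the whole crossed product. The cb-norm is defined through pairings of matrices
  over A(G) with matrices over VN(G). Before it can be turned into an inequality for Schur products,
  the pairing must be shown to be well defined: vectors with the same coefficient function must give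
  the same value at every T in the bicommutant.\<close>

lemma scaleC_one [simp]: "1 *\<^sub>C x = (x::'a::complex_vector)"
  using scaleC_of_real[of 1 x] by simp

lemma scaleC_zero_left [simp]: "0 *\<^sub>C x = (0::'a::complex_vector)"
  using scaleC_of_real[of 0 x] by simp

lemma scaleC_zero_right [simp]: "c *\<^sub>C (0::'a::complex_vector) = 0"
  using scaleC_add_right[of c 0 0] by simp

lemma scaleC_minus_right: "c *\<^sub>C (- x) = - (c *\<^sub>C (x::'a::complex_vector))"
  using scaleC_add_right[of c x "- x"] by (simp add: eq_neg_iff_add_eq_0 add.commute)

lemma scaleC_diff_right: "c *\<^sub>C (x - y) = c *\<^sub>C x - c *\<^sub>C (y::'a::complex_vector)"
  using scaleC_add_right[of c x "- y"] by (simp add: scaleC_minus_right)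

lemma scaleC_scaleR: "c *\<^sub>C (r *\<^sub>R x) = r *\<^sub>R (c *\<^sub>C (x::'a::complex_vector))"
  by (metis mult.commute scaleC_of_real scaleC_scaleC)

context
  fixes x y z :: "'a::complex_inner"
begin

lemma cinner_scaleC_right: "cinner x (c *\<^sub>C y) = cnj c * cinner x y"
  by (metis cinner_commute cinner_scaleC_left complex_cnj_mult)

lemma cinner_zero_left [simp]: "cinner 0 y = 0"
  using cinner_add_left[of 0 0 y] by simp

lemma cinner_zero_right [simp]: "cinner x 0 = 0"
  using cinner_add_right[of x 0 0] by simp

lemma cinner_minus_left: "cinner (- x) y = - cinner x y"
  using cinner_add_left[of x "- x" y] by (simp add: eq_neg_iff_add_eq_0 add.commute)

lemma cinner_minus_right: "cinner x (- y) = - cinner x y"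
  using cinner_add_right[of x y "- y"] by (simp add: eq_neg_iff_add_eq_0 add.commute)

end

context
  fixes x y z :: "'a::complex_inner"
begin

lemma cinner_diff_left: "cinner (x - y) z = cinner x z - cinner y z"
  using cinner_add_left[of x "- y" z] by (simp add: cinner_minus_left)

lemma cinner_diff_right: "cinner z (x - y) = cinner z x - cinner z y"
  using cinner_add_right[of z x "- y"] by (simp add: cinner_minus_right)

lemma cinner_sum_left: "cinner (\<Sum>i\<in>I. f i) x = (\<Sum>i\<in>I. cinner (f i) x)"
  by (induction I rule: infinite_finite_induct) (auto simp: cinner_add_left)

lemma cinner_sum_right: "cinner x (\<Sum>i\<in>I. f i) = (\<Sum>i\<in>I. cinner x (f i))"
  by (induction I rule: infinite_finite_induct) (auto simp: cinner_add_right)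

lemma Im_cinner: "Im (cinner x y) = inner x (\<i> *\<^sub>C y)"
  by (simp add: inner_eq_Re_cinner cinner_scaleC_right)

lemma cinner_Cauchy_Schwarz: "cmod (cinner x y) \<le> norm x * norm y"
proof (cases "cinner x y = 0")
  case False
  define c where "c = cnj (sgn (cinner x y))"
  have "cinner (c *\<^sub>C x) y = cinner x y * cnj (cinner x y) / complex_of_real (cmod (cinner x y))"
    by (simp add: c_def cinner_scaleC_left sgn_eq)
  also have "\<dots> = complex_of_real (cmod (cinner x y))"
    unfolding complex_norm_square[symmetric] using False by (simp add: power2_eq_square)
  finally have "complex_of_real (cmod (cinner x y)) = cinner (c *\<^sub>C x) y" ..
  hence "cmod (cinner x y) = inner (c *\<^sub>C x) y"
    unfolding inner_eq_Re_cinner by (metis Re_complex_of_real)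
  also have "\<dots> \<le> norm (c *\<^sub>C x) * norm y"
    by (rule norm_cauchy_schwarz)
  finally show ?thesis
    using False by (simp add: norm_scaleC_inner c_def norm_sgn)
qed simp

end

lemma bounded_linear_scaleC: "bounded_linear (\<lambda>x::'a::complex_inner. c *\<^sub>C x)"
  by (rule bounded_linear_intro[where K = "cmod c"])
     (auto simp: scaleC_add_right scaleC_scaleR norm_scaleC_inner)

lemma norm_le_if_cinner_le:
  fixes x :: "'a::complex_inner"
  assumes "cmod (cinner x x) \<le> C * norm x" "0 \<le> C"
  shows "norm x \<le> C"
proof -
  have "norm x * norm x \<le> C * norm x"
    using assms(1) unfolding cinner_self by (simp add: power2_eq_square norm_mult)
  thus ?thesis
    using assms(2) by (cases "norm x = 0") auto
qed

text \<open>The type of bounded operators carries only real scalars; a complex multiple of an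
  operator is therefore its composition with this one.\<close>

definition scaleC_op :: "complex \<Rightarrow> 'h::complex_inner \<Rightarrow>\<^sub>L 'h" where
  "scaleC_op c = Blinfun (\<lambda>x. c *\<^sub>C x)"

lemma scaleC_op_apply [simp]: "scaleC_op c x = c *\<^sub>C x"
  by (simp add: scaleC_op_def bounded_linear_Blinfun_apply bounded_linear_scaleC)

lemma norm_scaleC_op_comp: "norm (scaleC_op c o\<^sub>L T) \<le> cmod c * norm T"
proof -
  have "norm (scaleC_op c o\<^sub>L T) \<le> norm (scaleC_op c :: 'b \<Rightarrow>\<^sub>L 'b) * norm T"
    by (rule norm_blinfun_compose)
  also have "\<dots> \<le> cmod c * norm T"
    by (intro mult_right_mono norm_blinfun_bound) (auto simp: norm_scaleC_inner)
  finally show ?thesis .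
qed

lemma cblinops_scaleC: "T \<in> cblinops \<Longrightarrow> blinfun_apply T (c *\<^sub>C x) = c *\<^sub>C T x"
  by (simp add: cblinops_def clinear_map_def)

lemma cblinopsI: "(\<And>c x. blinfun_apply T (c *\<^sub>C x) = c *\<^sub>C T x) \<Longrightarrow> T \<in> cblinops"
  by (simp add: cblinops_def clinear_map_def blinfun.add_right)

text \<open>Complex linearity is a family of equations between functions that are continuous in the
  operator norm. Hence the norm closure defining the crossed product stays among the complex-linear
  operators.\<close>

lemma closed_cblinops: "closed (cblinops :: ('h::complex_inner \<Rightarrow>\<^sub>L 'h) set)"
proof -
  have "cblinops = (\<Inter>c. \<Inter>x. {T :: 'h \<Rightarrow>\<^sub>L 'h. T (c *\<^sub>C x) = c *\<^sub>C T x})"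
    by (auto intro: cblinopsI simp: cblinops_scaleC)
  also have "closed \<dots>"
    by (intro closed_INT ballI closed_Collect_eq)
       (auto intro!: continuous_intros bounded_linear.continuous_on[OF bounded_linear_scaleC])
  finally show ?thesis .
qed

section \<open>Unit vectors and completeness of l2\<close>

definition single :: "'i \<Rightarrow> 'h::complex_inner \<Rightarrow> ('i, 'h) ell2" where
  "single i h = Abs_ell2 (\<lambda>j. if j = i then h else 0)"

lemma summable_on_finite_support:
  assumes "finite F" "\<And>i. i \<notin> F \<Longrightarrow> f i = (0::'b::{comm_monoid_add, topological_space})"
  shows "f summable_on UNIV"
  using summable_on_cong_neutral[of F UNIV f f] assms by auto

lemma infsum_finite_support:
  assumes "finite F" "\<And>i. i \<notin> F \<Longrightarrow> f i = (0::'b::{comm_monoid_add, t2_space})"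
  shows "(\<Sum>\<^sub>\<infinity>i. f i) = (\<Sum>i\<in>F. f i)"
  using infsum_cong_neutral[of F UNIV f f] assms by auto

lemma Rep_single: "Rep_ell2 (single i h) j = (if j = i then h else 0)"
  unfolding single_def
  by (subst Abs_ell2_inverse) (auto intro!: summable_on_finite_support[of "{i}"] split: if_splits)

lemma Rep_sum_ell2: "Rep_ell2 (\<Sum>k\<in>I. f k) i = (\<Sum>k\<in>I. Rep_ell2 (f k) i)"
  by (induction I rule: infinite_finite_induct) (auto simp: Rep_ell2_simps)

lemma cinner_single_right: "cinner x (single i k) = cinner (Rep_ell2 x i) k"
  unfolding cinner_ell2_def by (subst infsum_finite_support[of "{i}"]) (auto simp: Rep_single)

lemma cinner_single_left: "cinner (single i k) x = cinner k (Rep_ell2 x i)"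
  by (subst cinner_commute, subst cinner_single_right) (metis cinner_commute)

lemma single_add: "single i (h + k) = single i h + single i k"
  by (rule ell2_eqI) (auto simp: Rep_single Rep_ell2_simps)

lemma single_scaleC: "single i (c *\<^sub>C h) = c *\<^sub>C single i h"
  by (rule ell2_eqI) (auto simp: Rep_single Rep_ell2_simps)

lemma single_zero [simp]: "single i 0 = 0"
  by (rule ell2_eqI) (auto simp: Rep_single Rep_ell2_simps)

lemma single_sum: "single i (\<Sum>k\<in>I. f k) = (\<Sum>k\<in>I. single i (f k))"
  by (induction I rule: infinite_finite_induct) (auto simp: single_add)

lemma norm_ell2_sq: "(norm x)\<^sup>2 = (\<Sum>\<^sub>\<infinity>i. (norm (Rep_ell2 x i))\<^sup>2)"
  by (simp add: norm_ell2_eq infsum_nonneg)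

lemma sum_Rep_le_norm:
  assumes "finite F"
  shows "(\<Sum>i\<in>F. (norm (Rep_ell2 x i))\<^sup>2) \<le> (norm x)\<^sup>2"
  unfolding norm_ell2_sq by (rule finite_sum_le_infsum) (auto simp: Rep_ell2_summable assms)

lemma norm_Rep_le: "norm (Rep_ell2 x i) \<le> norm x"
  using sum_Rep_le_norm[of "{i}" x] by (simp add: power2_le_iff_abs_le)

lemma ell2_approx_finite:
  fixes x :: "('i, 'h::complex_inner) ell2"
  assumes "e > 0"
  shows "\<exists>F. finite F \<and> norm (x - (\<Sum>i\<in>F. single i (Rep_ell2 x i))) < e"
proof -
  let ?n = "\<lambda>i. (norm (Rep_ell2 x i))\<^sup>2"
  obtain F where F: "finite F" "dist (sum ?n F) (infsum ?n UNIV) \<le> e\<^sup>2 / 2"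
    using infsum_finite_approximation[OF Rep_ell2_summable[of x], of "e\<^sup>2 / 2"] assms by auto
  define y where "y = (\<Sum>i\<in>F. single i (Rep_ell2 x i))"
  have y: "Rep_ell2 y i = (if i \<in> F then Rep_ell2 x i else 0)" for i
    using F(1) by (simp add: y_def Rep_sum_ell2 Rep_single sum.delta')
  have "(norm (x - y))\<^sup>2 = infsum ?n (- F)"
    unfolding norm_ell2_sq by (rule infsum_cong_neutral) (auto simp: Rep_ell2_simps y)
  also have "\<dots> = infsum ?n UNIV - sum ?n F"
    using infsum_Diff[of ?n UNIV F] F(1) by (simp add: Rep_ell2_summable Compl_eq_Diff_UNIV)
  also have "\<dots> \<le> e\<^sup>2 / 2"
    using F(2) unfolding dist_real_def by linarith
  also have "\<dots> < e\<^sup>2"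
    using assms by simp
  finally have "norm (x - y) < e"
    using assms by (rule_tac power2_less_imp_less) auto
  thus ?thesis
    using F(1) unfolding y_def by blast
qed

lemma ell2_finite_support_seq:
  fixes x :: "('i, 'h::complex_inner) ell2"
  obtains X where "X \<longlonglongrightarrow> x" "\<And>n::nat. finite {i. Rep_ell2 (X n) i \<noteq> 0}"
proof -
  have "\<forall>n::nat. \<exists>F. finite F \<and> norm (x - (\<Sum>i\<in>F. single i (Rep_ell2 x i))) < inverse (Suc n)"
    by (intro allI ell2_approx_finite) simp
  then obtain F where F: "\<And>n::nat. finite (F n)"
      "\<And>n. norm (x - (\<Sum>i\<in>F n. single i (Rep_ell2 x i))) < inverse (Suc n)"
    unfolding choice_iff by blast
  let ?X = "\<lambda>n. \<Sum>i\<in>F n. single i (Rep_ell2 x i)"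
  show ?thesis
  proof
    have "(\<lambda>n. ?X n - x) \<longlonglongrightarrow> 0"
      by (rule Lim_null_comparison[OF _ LIMSEQ_inverse_real_of_nat])
         (use F(2) in \<open>auto simp: norm_minus_commute intro!: always_eventually less_imp_le\<close>)
    thus "?X \<longlonglongrightarrow> x"
      by (simp add: Lim_null[symmetric])
    show "finite {i. Rep_ell2 (?X n) i \<noteq> 0}" for n
      by (rule finite_subset[OF _ F(1)[of n]]) (auto simp: Rep_sum_ell2 Rep_single sum.delta' F(1))
  qed
qed

lemma ell2_finite_support_sum:
  assumes "finite F" "\<And>i. i \<notin> F \<Longrightarrow> Rep_ell2 x i = 0"
  shows "x = (\<Sum>i\<in>F. single i (Rep_ell2 x i))"
  by (rule ell2_eqI) (use assms in \<open>auto simp: Rep_sum_ell2 Rep_single sum.delta'\<close>)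

text \<open>The coordinates converge by completeness of \<open>'h\<close>. The tail estimate is kept
  uniform in the finite index set, so that it yields both the square-summability of the
  coordinatewise limit and convergence in norm.\<close>

lemma ell2_Cauchy_convergent:
  fixes X :: "nat \<Rightarrow> ('i, 'h::chilbert_space) ell2"
  assumes "Cauchy X"
  shows "convergent X"
proof -
  have "Cauchy (\<lambda>n. Rep_ell2 (X n) i)" for i
  proof (rule metric_CauchyI)
    fix e :: real assume "e > 0"
    then obtain M where "\<And>m n. m \<ge> M \<Longrightarrow> n \<ge> M \<Longrightarrow> dist (X m) (X n) < e"
      using metric_CauchyD[OF assms] by blast
    thus "\<exists>M. \<forall>m\<ge>M. \<forall>n\<ge>M. dist (Rep_ell2 (X m) i) (Rep_ell2 (X n) i) < e"
      unfolding dist_norm using norm_Rep_le[of "X m - X n" i for m n]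
      by (metis Rep_minus_ell2 le_less_trans)
  qed
  hence "\<forall>i. \<exists>l. (\<lambda>n. Rep_ell2 (X n) i) \<longlonglongrightarrow> l"
    by (simp add: Cauchy_convergent_iff convergent_def)
  then obtain f where f: "\<And>i. (\<lambda>n. Rep_ell2 (X n) i) \<longlonglongrightarrow> f i"
    unfolding choice_iff by blast
  have tail: "\<exists>M. \<forall>n\<ge>M. \<forall>F. finite F \<longrightarrow> (\<Sum>i\<in>F. (norm (Rep_ell2 (X n) i - f i))\<^sup>2) \<le> e\<^sup>2"
    if e: "e > 0" for e :: real
  proof -
    obtain M where M: "\<And>m n. m \<ge> M \<Longrightarrow> n \<ge> M \<Longrightarrow> norm (X n - X m) < e"
      using metric_CauchyD[OF assms e] unfolding dist_norm by blast
    have "(\<Sum>i\<in>F. (norm (Rep_ell2 (X n) i - f i))\<^sup>2) \<le> e\<^sup>2" if "n \<ge> M" "finite F" for n F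
    proof (rule LIMSEQ_le_const2)
      show "(\<lambda>m. \<Sum>i\<in>F. (norm (Rep_ell2 (X n) i - Rep_ell2 (X m) i))\<^sup>2)
          \<longlonglongrightarrow> (\<Sum>i\<in>F. (norm (Rep_ell2 (X n) i - f i))\<^sup>2)"
        by (intro tendsto_intros f)
      have "(\<Sum>i\<in>F. (norm (Rep_ell2 (X n) i - Rep_ell2 (X m) i))\<^sup>2) \<le> e\<^sup>2" if "m \<ge> M" for m
      proof -
        have "(norm (X n - X m))\<^sup>2 \<le> e\<^sup>2"
          using M[OF that \<open>n \<ge> M\<close>] by (intro power_mono) auto
        thus ?thesis
          using sum_Rep_le_norm[OF \<open>finite F\<close>, of "X n - X m"] by (simp add: Rep_ell2_simps)
      qed
      thus "\<exists>N. \<forall>m\<ge>N. (\<Sum>i\<in>F. (norm (Rep_ell2 (X n) i - Rep_ell2 (X m) i))\<^sup>2) \<le> e\<^sup>2"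
        by blast
    qed
    thus ?thesis by blast
  qed
  have summ: "(\<lambda>i. (norm (g i))\<^sup>2) summable_on UNIV"
    if "\<And>F. finite F \<Longrightarrow> (\<Sum>i\<in>F. (norm (g i))\<^sup>2) \<le> C" for g :: "'i \<Rightarrow> 'h" and C
    by (rule nonneg_bdd_above_summable_on) (auto intro!: bdd_aboveI2[where M = C] that)
  obtain M where M: "\<And>F. finite F \<Longrightarrow> (\<Sum>i\<in>F. (norm (Rep_ell2 (X M) i - f i))\<^sup>2) \<le> 1\<^sup>2"
    using tail[of 1] by auto
  \<comment> \<open>The limit is written as f = X M - (X M - f), a difference of two square-summable
    families.\<close>
  have "(\<lambda>i. (norm (Rep_ell2 (X M) i - (Rep_ell2 (X M) i - f i)))\<^sup>2) summable_on UNIV"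
    using ell2_add[OF Rep_ell2_summable[of "X M"] ell2_scaleC[OF summ[OF M], of "-1"]]
    by (simp add: scaleC_of_real[of "-1", simplified])
  hence "(\<lambda>i. (norm (f i))\<^sup>2) summable_on UNIV"
    by simp
  hence Rep: "Rep_ell2 (Abs_ell2 f) = f"
    by (simp add: Abs_ell2_inverse)
  have "X \<longlonglongrightarrow> Abs_ell2 f"
  proof (rule metric_LIMSEQ_I)
    fix e :: real assume e: "e > 0"
    obtain M where M: "\<And>n F. n \<ge> M \<Longrightarrow> finite F \<Longrightarrow>
        (\<Sum>i\<in>F. (norm (Rep_ell2 (X n) i - f i))\<^sup>2) \<le> (e/2)\<^sup>2"
      using tail[of "e/2"] e by auto
    have "dist (X n) (Abs_ell2 f) < e" if "n \<ge> M" for n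
    proof -
      have "(norm (X n - Abs_ell2 f))\<^sup>2 \<le> (e/2)\<^sup>2"
        unfolding norm_ell2_sq Rep_minus_ell2 Rep
        by (rule infsum_le_finite_sums) (auto intro: M[OF that] summ[OF M[OF that]])
      hence "norm (X n - Abs_ell2 f) \<le> e / 2"
        using e by (simp add: power2_le_iff_abs_le)
      thus ?thesis
        using e by (simp add: dist_norm)
    qed
    thus "\<exists>M. \<forall>n\<ge>M. dist (X n) (Abs_ell2 f) < e" by blast
  qed
  thus ?thesis by (auto simp: convergent_def)
qed

instance ell2 :: (type, chilbert_space) chilbert_space
  by standard (rule ell2_Cauchy_convergent)

instance ell2 :: (type, chilbert_space) banach ..

section \<open>Orthogonal projections\<close>

text \<open>By the parallelogram law a minimizing sequence in S is Cauchy: the midpoint of two of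
  its members again lies in S, so it is no closer to x than the infimum.\<close>

lemma closest_point_subspace:
  fixes S :: "'a::{real_inner, complete_space} set"
  assumes S: "closed S" "subspace S"
  shows "\<exists>y\<in>S. \<forall>z\<in>S. norm (x - y) \<le> norm (x - z)"
proof -
  define d where "d = (INF z\<in>S. (norm (x - z))\<^sup>2)"
  have ne: "S \<noteq> {}"
    using S(2) subspace_0 by auto
  have bdd: "bdd_below ((\<lambda>z. (norm (x - z))\<^sup>2) ` S)"
    by (rule bdd_belowI2[of _ 0]) auto
  have d_le: "d \<le> (norm (x - z))\<^sup>2" if "z \<in> S" for z
    unfolding d_def by (rule cINF_lower[OF bdd that])
  have "\<forall>n::nat. \<exists>z\<in>S. (norm (x - z))\<^sup>2 < d + inverse (Suc n)"
    unfolding cINF_less_iff[OF ne bdd, symmetric] d_def[symmetric]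
    by (metis less_add_same_cancel1 inverse_positive_iff_positive of_nat_0_less_iff zero_less_Suc)
  then obtain y where y: "\<And>n::nat. y n \<in> S" "\<And>n. (norm (x - y n))\<^sup>2 < d + inverse (Suc n)"
    by metis
  have dist_sq: "(norm (y m - y n))\<^sup>2 \<le> 2 * inverse (Suc m) + 2 * inverse (Suc n)" for m n
  proof -
    have "(1/2) *\<^sub>R (y m + y n) \<in> S"
      using S(2) y(1) by (simp add: subspace_add subspace_scale)
    hence "4 * d \<le> 4 * (norm (x - (1/2) *\<^sub>R (y m + y n)))\<^sup>2"
      using d_le by simp
    also have "\<dots> = (norm (2 *\<^sub>R (x - (1/2) *\<^sub>R (y m + y n))))\<^sup>2"
      by (simp add: power_mult_distrib)
    also have "2 *\<^sub>R (x - (1/2) *\<^sub>R (y m + y n)) = (x - y m) + (x - y n)"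
      by (simp add: algebra_simps scaleR_2)
    finally have "4 * d \<le> (norm ((x - y m) + (x - y n)))\<^sup>2" .
    moreover have "(norm (y m - y n))\<^sup>2 + (norm ((x - y m) + (x - y n)))\<^sup>2
        = 2 * (norm (x - y m))\<^sup>2 + 2 * (norm (x - y n))\<^sup>2"
      by (simp add: power2_norm_eq_inner inner_add inner_diff inner_commute algebra_simps)
    ultimately show ?thesis
      using y(2)[of m] y(2)[of n] by linarith
  qed
  have "Cauchy y"
  proof (rule metric_CauchyI)
    fix e :: real assume e: "e > 0"
    then obtain N where N: "inverse (Suc N) < e\<^sup>2 / 4"
      using reals_Archimedean[of "e\<^sup>2 / 4"] by auto
    have "dist (y m) (y n) < e" if "m \<ge> N" "n \<ge> N" for m n
    proof -
      have "inverse (Suc m) \<le> inverse (Suc N)" "inverse (Suc n) \<le> inverse (Suc N)"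
        using that by (simp_all add: le_imp_inverse_le)
      hence "(norm (y m - y n))\<^sup>2 < e\<^sup>2"
        using dist_sq[of m n] N by linarith
      thus ?thesis
        using e by (simp add: dist_norm power2_less_imp_less)
    qed
    thus "\<exists>M. \<forall>m\<ge>M. \<forall>n\<ge>M. dist (y m) (y n) < e" by blast
  qed
  then obtain z where z: "y \<longlonglongrightarrow> z"
    by (auto simp: Cauchy_convergent_iff convergent_def)
  have zS: "z \<in> S"
    using closed_sequentially[OF S(1) _ z] y(1) by auto
  have "(norm (x - z))\<^sup>2 \<le> d"
  proof (rule LIMSEQ_le)
    show "(\<lambda>n. (norm (x - y n))\<^sup>2) \<longlonglongrightarrow> (norm (x - z))\<^sup>2"
      by (intro tendsto_intros z)
    show "(\<lambda>n. d + inverse (Suc n)) \<longlonglongrightarrow> d"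
      using LIMSEQ_inverse_real_of_nat_add[of d] by simp
    show "\<exists>N. \<forall>n\<ge>N. (norm (x - y n))\<^sup>2 \<le> d + inverse (Suc n)"
      using y(2) less_imp_le by blast
  qed
  hence "norm (x - z) \<le> norm (x - w)" if "w \<in> S" for w
    using d_le[OF that] by (meson norm_ge_zero order_trans power2_le_imp_le)
  thus ?thesis using zS by blast
qed

lemma orthogonal_projection_exists:
  fixes S :: "'a::{real_inner, complete_space} set"
  assumes S: "closed S" "subspace S"
  shows "\<exists>y\<in>S. \<forall>z\<in>S. inner (x - y) z = 0"
proof -
  obtain y where y: "y \<in> S" "\<And>z. z \<in> S \<Longrightarrow> norm (x - y) \<le> norm (x - z)"
    using closest_point_subspace[OF S] by metis
  have "inner (x - y) z = 0" if z: "z \<in> S" for z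
  proof (rule ccontr)
    assume ne: "inner (x - y) z \<noteq> 0"
    hence z0: "inner z z > 0" by auto
    \<comment> \<open>This t minimizes \<open>norm (x - y - t *\<^sub>R z)\<close>; if x - y were
      not orthogonal to z, moving along z would beat the closest point y.\<close>
    define t where "t = inner (x - y) z / inner z z"
    have "y + t *\<^sub>R z \<in> S"
      using S(2) y(1) z by (simp add: subspace_add subspace_scale)
    hence "(norm (x - y))\<^sup>2 \<le> (norm (x - y - t *\<^sub>R z))\<^sup>2"
      using y(2) by (simp add: diff_diff_eq power_mono)
    also have "\<dots> = (norm (x - y))\<^sup>2 - 2 * t * inner (x - y) z + t\<^sup>2 * inner z z"
      unfolding power2_norm_eq_inner
      by (simp add: inner_diff_left inner_diff_right inner_commute algebra_simps power2_eq_square)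
    also have "\<dots> = (norm (x - y))\<^sup>2 - (inner (x - y) z)\<^sup>2 / inner z z"
      using z0 by (simp add: t_def power2_eq_square field_simps)
    finally have "(inner (x - y) z)\<^sup>2 / inner z z \<le> 0" by simp
    thus False using ne z0 by (simp add: divide_le_0_iff)
  qed
  thus ?thesis using y(1) by blast
qed

text \<open>On a type without completeness, or for a set that is not a closed subspace, the value is
  arbitrary.\<close>

definition orth_proj :: "'a::real_inner set \<Rightarrow> 'a \<Rightarrow> 'a" where
  "orth_proj S x = (SOME y. y \<in> S \<and> (\<forall>z\<in>S. inner (x - y) z = 0))"

context
  fixes S :: "'a::{real_inner, complete_space} set"
  assumes S: "closed S" "subspace S"
begin

lemma orth_proj_in: "orth_proj S x \<in> S"
  and orth_proj_orthogonal: "z \<in> S \<Longrightarrow> inner (x - orth_proj S x) z = 0"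
proof -
  have "orth_proj S x \<in> S \<and> (\<forall>z\<in>S. inner (x - orth_proj S x) z = 0)"
    unfolding orth_proj_def using orthogonal_projection_exists[OF S, of x] by (rule_tac someI_ex) blast
  thus "orth_proj S x \<in> S" "z \<in> S \<Longrightarrow> inner (x - orth_proj S x) z = 0" by auto
qed

lemma orth_proj_unique:
  assumes "y \<in> S" "\<And>z. z \<in> S \<Longrightarrow> inner (x - y) z = 0"
  shows "orth_proj S x = y"
proof -
  let ?w = "orth_proj S x - y"
  have w: "?w \<in> S"
    using S(2) assms(1) orth_proj_in by (simp add: subspace_diff)
  have "inner ?w ?w = inner (x - y) ?w - inner (x - orth_proj S x) ?w"
    by (simp add: inner_diff_left)
  also have "\<dots> = 0"
    using assms(2) w orth_proj_orthogonal by simp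
  finally show ?thesis by simp
qed

lemma orth_proj_bounded_linear: "bounded_linear (orth_proj S)"
proof (rule bounded_linear_intro[where K = 1])
  show "orth_proj S (x + y) = orth_proj S x + orth_proj S y" for x y
  proof (rule orth_proj_unique)
    show "orth_proj S x + orth_proj S y \<in> S"
      using S(2) orth_proj_in by (simp add: subspace_add)
    show "inner (x + y - (orth_proj S x + orth_proj S y)) z = 0" if "z \<in> S" for z
      using orth_proj_orthogonal[OF that, of x] orth_proj_orthogonal[OF that, of y]
      by (simp add: inner_diff_left inner_add_left)
  qed
  show "orth_proj S (r *\<^sub>R x) = r *\<^sub>R orth_proj S x" for r x
  proof (rule orth_proj_unique)
    show "r *\<^sub>R orth_proj S x \<in> S"
      using S(2) orth_proj_in by (simp add: subspace_scale)
    show "inner (r *\<^sub>R x - r *\<^sub>R orth_proj S x) z = 0" if "z \<in> S" for z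
      using orth_proj_orthogonal[OF that, of x] by (simp flip: scaleR_diff_right)
  qed
  show "norm (orth_proj S x) \<le> norm x * 1" for x
  proof -
    have "(norm (orth_proj S x))\<^sup>2 = inner x (orth_proj S x)"
      using orth_proj_orthogonal[OF orth_proj_in, of x]
      by (simp add: power2_norm_eq_inner inner_diff_left)
    also have "\<dots> \<le> norm x * norm (orth_proj S x)"
      by (rule norm_cauchy_schwarz)
    finally show ?thesis
      by (cases "norm (orth_proj S x) = 0") (auto simp: power2_eq_square)
  qed
qed

text \<open>S is invariant under U and under its adjoint V, hence reduces U.\<close>

lemma orth_proj_commute:
  assumes "linear U" "\<And>z. z \<in> S \<Longrightarrow> U z \<in> S" "\<And>z. z \<in> S \<Longrightarrow> V z \<in> S"
    and adj: "\<And>x y. inner (U x) y = inner x (V y)"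
  shows "orth_proj S (U x) = U (orth_proj S x)"
proof (rule orth_proj_unique)
  show "U (orth_proj S x) \<in> S"
    by (intro assms orth_proj_in)
  show "inner (U x - U (orth_proj S x)) z = 0" if "z \<in> S" for z
    using orth_proj_orthogonal[OF assms(3)[OF that], of x]
    by (simp add: linear_diff[OF assms(1), symmetric] adj)
qed

end

lemma subspace_closure:
  fixes S :: "'a::real_normed_vector set"
  assumes "subspace S"
  shows "subspace (closure S)"
proof (rule subspaceI)
  show "0 \<in> closure S"
    using assms subspace_0 closure_subset by blast
  fix x y assume "x \<in> closure S" "y \<in> closure S"
  then obtain f g where "\<And>n. f n \<in> S" "f \<longlonglongrightarrow> x" "\<And>n. g n \<in> S" "g \<longlonglongrightarrow> y"
    by (metis closure_sequential)
  thus "x + y \<in> closure S"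
    unfolding closure_sequential using assms
    by (intro exI[of _ "\<lambda>n. f n + g n"]) (auto intro: tendsto_add subspace_add)
next
  fix c x assume "x \<in> closure S"
  then obtain f where "\<And>n. f n \<in> S" "f \<longlonglongrightarrow> x"
    by (metis closure_sequential)
  thus "c *\<^sub>R x \<in> closure S"
    unfolding closure_sequential using assms
    by (intro exI[of _ "\<lambda>n. c *\<^sub>R f n"]) (auto intro: tendsto_intros subspace_scale)
qed

section \<open>The duality between A(G) and VN(G)\<close>

lemma left_regular_add: "left_regular s (left_regular t \<xi>) = left_regular (s + t) \<xi>"
  by (rule ell2_eqI) (simp add: Rep_left_regular minus_add flip: add.assoc)

lemma left_regular_0: "left_regular 0 \<xi> = \<xi>"
  by (rule ell2_eqI) (simp add: Rep_left_regular)

lemma left_regular_in_cblinops: "left_regular s \<in> cblinops"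
  by (intro cblinopsI ell2_eqI) (simp add: Rep_left_regular Rep_ell2_simps)

lemma left_regular_single: "left_regular s (single t h) = single (s + t) h"
proof (rule ell2_eqI)
  fix r
  have "- s + r = t \<longleftrightarrow> r = s + t"
    by (metis add.assoc add.left_neutral left_minus right_minus)
  thus "Rep_ell2 (left_regular s (single t h)) r = Rep_ell2 (single (s + t) h) r"
    by (simp add: Rep_left_regular Rep_single)
qed

lemma cinner_left_regular: "cinner (left_regular s x) y = cinner x (left_regular (- s) y)"
proof -
  have "cinner (left_regular s x) y = (\<Sum>\<^sub>\<infinity>t. cinner (Rep_ell2 x (- s + t)) (Rep_ell2 y (s + (- s + t))))"
    unfolding cinner_ell2_def by (simp add: Rep_left_regular add.assoc[symmetric])
  also have "\<dots> = (\<Sum>\<^sub>\<infinity>t. cinner (Rep_ell2 x t) (Rep_ell2 y (s + t)))"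
    by (rule infsum_reindex_bij_betw[OF left_translation_bij])
  finally show ?thesis
    unfolding cinner_ell2_def by (simp add: Rep_left_regular)
qed

lemma norm_left_regular: "norm (left_regular s x) = norm x"
proof -
  have "cinner (left_regular s x) (left_regular s x) = cinner x x"
    by (simp add: cinner_left_regular left_regular_add left_regular_0)
  thus ?thesis
    by (simp add: norm_eq_sqrt_inner inner_eq_Re_cinner)
qed

lemma group_vN_in_cblinops: "T \<in> group_vN \<Longrightarrow> T \<in> cblinops"
  by (simp add: group_vN_def commutant_def)

text \<open>The projection onto the closed span of the \<open>(\<lambda>(s)\<xi>, \<lambda>(s)\<xi>')\<close> has its entries in the
  commutant of \<open>\<lambda>(G)\<close>, so \<open>T \<oplus> T\<close> leaves this span invariant.\<close>

lemma group_vN_pair_in_closure: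
  fixes \<xi> \<xi>' :: "('g::group_add, complex) ell2"
  assumes T: "T \<in> group_vN"
  defines "S \<equiv> closure (span {(c *\<^sub>C left_regular s \<xi>, c *\<^sub>C left_regular s \<xi>') | c s. True})"
  shows "(T \<xi>, T \<xi>') \<in> S"
proof -
  \<comment> \<open>\<open>span\<close> is the real span. Including all complex multiples c makes
    the closed span invariant under complex scalars, as \<open>PC\<close> requires.\<close>
  define B where "B = {(c *\<^sub>C left_regular s \<xi>, c *\<^sub>C left_regular s \<xi>') | c s. True}"
  have S: "S = closure (span B)"
    by (simp add: S_def B_def)
  have cS: "closed S" and sS: "subspace S"
    by (simp_all add: S subspace_closure)
  let ?P = "orth_proj S"
  have inv: "U z \<in> S" if U: "bounded_linear U" "U ` B \<subseteq> B" and "z \<in> S" for U z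
  proof -
    have "U ` span B \<subseteq> span B"
      using U by (metis bounded_linear.linear linear_span_image span_mono)
    hence "U ` closure (span B) \<subseteq> S"
      unfolding S using U(1)
      by (intro image_closure_subset) (auto intro: linear_continuous_on closure_subset[THEN subsetD])
    thus ?thesis using \<open>z \<in> S\<close> S by blast
  qed
  let ?L = "\<lambda>s (x, y). (left_regular s x, left_regular s y) :: ('g, complex) ell2 \<times> ('g, complex) ell2"
  let ?C = "\<lambda>c (x, y). (c *\<^sub>C x, c *\<^sub>C y) :: ('g, complex) ell2 \<times> ('g, complex) ell2"
  have L: "bounded_linear (?L s)" "?L s ` B \<subseteq> B" for s
  proof -
    show "bounded_linear (?L s)"
      unfolding case_prod_unfold
      by (intro bounded_linear_Pair bounded_linear_compose[OF blinfun.bounded_linear_right]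
           bounded_linear_fst bounded_linear_snd)
    show "?L s ` B \<subseteq> B"
      unfolding B_def
      by (force simp: cblinops_scaleC[OF left_regular_in_cblinops] left_regular_add)
  qed
  have C: "bounded_linear (?C c)" "?C c ` B \<subseteq> B" for c
  proof -
    show "bounded_linear (?C c)"
      unfolding case_prod_unfold
      by (intro bounded_linear_Pair bounded_linear_compose[OF bounded_linear_scaleC]
           bounded_linear_fst bounded_linear_snd)
    show "?C c ` B \<subseteq> B"
      unfolding B_def by (force simp: scaleC_scaleC)
  qed
  have PL: "?P (?L s z) = ?L s (?P z)" for s z
  proof (rule orth_proj_commute[OF cS sS bounded_linear.linear[OF L(1)] inv[OF L] inv[OF L]])
    show "inner (?L s x) y = inner x (?L (- s) y)" for x y
      by (simp add: case_prod_unfold inner_prod_def inner_eq_Re_cinner cinner_left_regular)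
  qed
  have PC: "?P (?C c z) = ?C c (?P z)" for c z
  proof (rule orth_proj_commute[OF cS sS bounded_linear.linear[OF C(1)] inv[OF C] inv[OF C]])
    show "inner (?C c x) y = inner x (?C (cnj c) y)" for x y
      by (simp add: case_prod_unfold inner_prod_def inner_eq_Re_cinner cinner_scaleC_left
            cinner_scaleC_right)
  qed
  have P: "bounded_linear ?P"
    by (rule orth_proj_bounded_linear[OF cS sS])
  \<comment> \<open>Here p is a coordinate projection and j a coordinate inclusion, so
    \<open>p (?P (j x))\<close> is an entry of the projection. \<open>PL\<close> and
    \<open>PC\<close> supply commutation with translations and complex linearity, the two conditions
    for membership in \<open>commutant\<close>.\<close>
  have comm: "T (p (?P (j x))) = p (?P (j (T x)))"
    if p: "bounded_linear p" "bounded_linear j"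
      "\<And>s z. p (?L s z) = left_regular s (p z)" "\<And>s x. j (left_regular s x) = ?L s (j x)"
      "\<And>c z. p (?C c z) = c *\<^sub>C (p z)" "\<And>c x. j (c *\<^sub>C x) = ?C c (j x)"
    for p :: "_ \<Rightarrow> ('g, complex) ell2" and j :: "('g, complex) ell2 \<Rightarrow> _" and x
  proof -
    define R where "R = Blinfun (\<lambda>x. p (?P (j x)))"
    have R: "R x = p (?P (j x))" for x
      unfolding R_def
      by (subst bounded_linear_Blinfun_apply)
         (rule bounded_linear_compose[OF p(1) bounded_linear_compose[OF P p(2)]] refl)+
    have "R \<in> commutant (range left_regular)"
      unfolding commutant_def
      by (auto intro!: cblinopsI blinfun_eqI simp: R p PL PC)
    hence "T o\<^sub>L R = R o\<^sub>L T"
      using T by (simp add: group_vN_def commutant_def)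
    hence "T (R x) = R (T x)"
      by (metis blinfun_apply_blinfun_compose)
    thus ?thesis by (simp add: R)
  qed
  have lin: "bounded_linear (\<lambda>x. (x, 0))" "bounded_linear (\<lambda>x. (0, x))"
    by (auto intro!: bounded_linear_Pair bounded_linear_ident bounded_linear_zero)
  have split: "(x, y) = (x, 0) + (0, y)" for x y :: "('g, complex) ell2" by simp
  have PT: "?P (T x, T y) = (T (fst (?P (x, y))), T (snd (?P (x, y))))" for x y
  proof -
    have "fst (?P (T x, T y)) = fst (?P (T x, 0)) + fst (?P (0, T y))"
      by (subst split) (simp only: linear_add[OF bounded_linear.linear[OF P]] fst_add)
    also have "\<dots> = T (fst (?P (x, 0))) + T (fst (?P (0, y)))"
      by (subst (1 2) comm[where p = fst])
         (auto simp: lin bounded_linear_fst blinfun.zero_right)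
    also have "\<dots> = T (fst (?P (x, y)))"
      by (subst (3) split) (simp only: linear_add[OF bounded_linear.linear[OF P]] fst_add blinfun.add_right)
    finally have 1: "fst (?P (T x, T y)) = T (fst (?P (x, y)))" .
    have "snd (?P (T x, T y)) = snd (?P (T x, 0)) + snd (?P (0, T y))"
      by (subst split) (simp only: linear_add[OF bounded_linear.linear[OF P]] snd_add)
    also have "\<dots> = T (snd (?P (x, 0))) + T (snd (?P (0, y)))"
      by (subst (1 2) comm[where p = snd])
         (auto simp: lin bounded_linear_snd blinfun.zero_right)
    also have "\<dots> = T (snd (?P (x, y)))"
      by (subst (3) split) (simp only: linear_add[OF bounded_linear.linear[OF P]] snd_add blinfun.add_right)
    finally have 2: "snd (?P (T x, T y)) = T (snd (?P (x, y)))" .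
    show ?thesis using 1 2 by (simp add: prod_eq_iff)
  qed
  have "(1 *\<^sub>C left_regular 0 \<xi>, 1 *\<^sub>C left_regular 0 \<xi>') \<in> B"
    unfolding B_def by blast
  hence "(\<xi>, \<xi>') \<in> S"
    unfolding S by (auto simp: left_regular_0 intro: span_base closure_subset[THEN subsetD])
  hence "?P (\<xi>, \<xi>') = (\<xi>, \<xi>')"
    by (intro orth_proj_unique[OF cS sS]) auto
  hence "(T \<xi>, T \<xi>') = ?P (T \<xi>, T \<xi>')"
    by (simp add: PT)
  thus ?thesis
    using orth_proj_in[OF cS sS] by metis
qed

text \<open>The vector (\<eta>, - \<eta>') is orthogonal to every (\<lambda>(s)\<xi>,
  \<lambda>(s)\<xi>'), hence to their closed span, which contains (T \<xi>, T \<xi>'). So the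
  description in \<open>fourier_pairing\<close> determines a single value.\<close>

lemma fourier_pairing_unique:
  assumes T: "T \<in> group_vN" and eq: "coefficient \<xi> \<eta> = coefficient \<xi>' \<eta>'"
  shows "cinner (T \<xi>) \<eta> = cinner (T \<xi>') \<eta>'"
proof -
  have Re: "inner (T \<xi>) \<eta> = inner (T \<xi>') \<eta>'"
    if eq: "\<And>s. cinner (left_regular s \<xi>) \<eta> = cinner (left_regular s \<xi>') \<eta>'" for \<eta> \<eta>'
  proof -
    let ?B = "{(c *\<^sub>C left_regular s \<xi>, c *\<^sub>C left_regular s \<xi>') | c s. True}"
    have "inner z (\<eta>, - \<eta>') = 0" if "z \<in> ?B" for z
      using that eq
      by (auto simp: inner_prod_def inner_eq_Re_cinner cinner_minus_right cinner_scaleC_left)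
    hence "?B \<subseteq> {z. inner z (\<eta>, - \<eta>') = 0}" by blast
    moreover have "subspace {z. inner z (\<eta>, - \<eta>') = 0}"
      by (auto simp: subspace_def inner_add_left)
    ultimately have "span ?B \<subseteq> {z. inner z (\<eta>, - \<eta>') = 0}"
      by (rule span_minimal)
    moreover have "closed {z. inner z (\<eta>, - \<eta>') = 0}"
      by (intro closed_Collect_eq continuous_intros)
    ultimately have "closure (span ?B) \<subseteq> {z. inner z (\<eta>, - \<eta>') = 0}"
      by (rule closure_minimal)
    with group_vN_pair_in_closure[OF T, of \<xi> \<xi>'] have "inner (T \<xi>, T \<xi>') (\<eta>, - \<eta>') = 0"
      by blast
    thus ?thesis by (simp add: inner_prod_def)
  qed
  have eq': "cinner (left_regular s \<xi>) \<eta> = cinner (left_regular s \<xi>') \<eta>'" for s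
    using eq by (simp add: coefficient_def fun_eq_iff)
  show ?thesis
  proof (rule complex_eqI)
    show "Re (cinner (T \<xi>) \<eta>) = Re (cinner (T \<xi>') \<eta>')"
      using Re[of \<eta> \<eta>'] eq' by (simp add: inner_eq_Re_cinner)
    \<comment> \<open>The imaginary part is the real part for the vectors i \<eta> and i \<eta>',
      whose coefficient functions agree as well.\<close>
    show "Im (cinner (T \<xi>) \<eta>) = Im (cinner (T \<xi>') \<eta>')"
      unfolding Im_cinner using eq' by (intro Re) (simp add: cinner_scaleC_right)
  qed
qed

lemma fourier_pairing_coefficient:
  assumes "T \<in> group_vN"
  shows "fourier_pairing (coefficient \<xi> \<eta>) T = cinner (T \<xi>) \<eta>"
  unfolding fourier_pairing_def
  by (rule the_equality) (auto dest: fourier_pairing_unique[OF assms])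

section \<open>Operator matrices\<close>

text \<open>\<open>Sup\<close> of a set of reals says something about its members only when the set
  is bounded above. The entrywise operator norms give a crude but finite bound.\<close>

lemma matrix_opnorm_set_bdd:
  assumes "finite I" and X: "\<And>k l. k \<in> I \<Longrightarrow> l \<in> I \<Longrightarrow> bounded_linear (X k l)"
  shows "bdd_above {sqrt (\<Sum>k\<in>I. (norm (\<Sum>l\<in>I. X k l (\<xi> l)))\<^sup>2) | \<xi>. (\<Sum>l\<in>I. (norm (\<xi> l))\<^sup>2) \<le> 1}"
proof -
  have "\<exists>K. \<forall>k\<in>I. \<forall>l\<in>I. 0 \<le> K k l \<and> (\<forall>x. norm (X k l x) \<le> norm x * K k l)"
    using bounded_linear.nonneg_bounded[OF X] by metis
  then obtain K where K: "\<And>k l. k \<in> I \<Longrightarrow> l \<in> I \<Longrightarrow> 0 \<le> K k l"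
      "\<And>k l x. k \<in> I \<Longrightarrow> l \<in> I \<Longrightarrow> norm (X k l x) \<le> norm x * K k l" by blast
  show ?thesis
  proof (rule bdd_aboveI)
    fix r assume "r \<in> {sqrt (\<Sum>k\<in>I. (norm (\<Sum>l\<in>I. X k l (\<xi> l)))\<^sup>2) | \<xi>. (\<Sum>l\<in>I. (norm (\<xi> l))\<^sup>2) \<le> 1}"
    then obtain \<xi> where r: "r = sqrt (\<Sum>k\<in>I. (norm (\<Sum>l\<in>I. X k l (\<xi> l)))\<^sup>2)"
      and \<xi>: "(\<Sum>l\<in>I. (norm (\<xi> l))\<^sup>2) \<le> 1" by blast
    have \<xi>1: "norm (\<xi> l) \<le> 1" if "l \<in> I" for l
    proof -
      have "(norm (\<xi> l))\<^sup>2 \<le> (\<Sum>l\<in>I. (norm (\<xi> l))\<^sup>2)"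
        by (rule member_le_sum) (use that assms(1) in auto)
      hence "(norm (\<xi> l))\<^sup>2 \<le> 1\<^sup>2" using \<xi> by simp
      thus ?thesis by (rule power2_le_imp_le) simp
    qed
    have "norm (\<Sum>l\<in>I. X k l (\<xi> l)) \<le> (\<Sum>l\<in>I. K k l)" if "k \<in> I" for k
    proof (rule sum_norm_le)
      fix l assume l: "l \<in> I"
      have "norm (X k l (\<xi> l)) \<le> norm (\<xi> l) * K k l" using K(2) that l by blast
      also have "\<dots> \<le> 1 * K k l"
        by (intro mult_right_mono \<xi>1 K that l)
      finally show "norm (X k l (\<xi> l)) \<le> K k l" by simp
    qed
    thus "r \<le> sqrt (\<Sum>k\<in>I. (\<Sum>l\<in>I. K k l)\<^sup>2)"
      unfolding r by (intro real_sqrt_le_mono sum_mono power_mono) auto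
  qed
qed

lemma matrix_opnorm_ge:
  assumes "finite I" "\<And>k l. k \<in> I \<Longrightarrow> l \<in> I \<Longrightarrow> bounded_linear (X k l)"
    and "(\<Sum>l\<in>I. (norm (\<xi> l))\<^sup>2) \<le> 1"
  shows "sqrt (\<Sum>k\<in>I. (norm (\<Sum>l\<in>I. X k l (\<xi> l)))\<^sup>2) \<le> matrix_opnorm I X"
  unfolding matrix_opnorm_def
  by (rule cSup_upper[OF _ matrix_opnorm_set_bdd]) (use assms in auto)

lemma matrix_opnorm_nonneg:
  assumes "finite I" "\<And>k l. k \<in> I \<Longrightarrow> l \<in> I \<Longrightarrow> bounded_linear (X k l)"
  shows "0 \<le> matrix_opnorm I X"
proof -
  have "0 \<le> sqrt (\<Sum>k\<in>I. (norm (\<Sum>l\<in>I. X k l 0))\<^sup>2)"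
    by (simp add: sum_nonneg)
  also have "\<dots> \<le> matrix_opnorm I X"
    by (rule matrix_opnorm_ge) (use assms in auto)
  finally show ?thesis .
qed

lemma matrix_opnorm_le:
  assumes "\<And>\<xi>. (\<Sum>l\<in>I. (norm (\<xi> l))\<^sup>2) \<le> 1 \<Longrightarrow> (\<Sum>k\<in>I. (norm (\<Sum>l\<in>I. X k l (\<xi> l)))\<^sup>2) \<le> C\<^sup>2"
    and "0 \<le> C"
  shows "matrix_opnorm I X \<le> C"
  unfolding matrix_opnorm_def
proof (rule cSup_least)
  show "{sqrt (\<Sum>k\<in>I. (norm (\<Sum>l\<in>I. X k l (\<xi> l)))\<^sup>2) | \<xi>. (\<Sum>l\<in>I. (norm (\<xi> l))\<^sup>2) \<le> 1} \<noteq> {}"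
    by (auto intro!: exI[of _ "\<lambda>_. 0"])
qed (use assms in \<open>auto intro: real_le_lsqrt\<close>)

lemma matrix_opnorm_apply_le:
  assumes "finite I" and X: "\<And>k l. k \<in> I \<Longrightarrow> l \<in> I \<Longrightarrow> bounded_linear (X k l)"
    and "matrix_opnorm I X \<le> 1"
  shows "(\<Sum>k\<in>I. (norm (\<Sum>l\<in>I. X k l (\<xi> l)))\<^sup>2) \<le> (\<Sum>l\<in>I. (norm (\<xi> l))\<^sup>2)"
proof -
  define N where "N = (\<Sum>l\<in>I. (norm (\<xi> l))\<^sup>2)"
  show ?thesis
  proof (cases "N = 0")
    case True
    hence "\<xi> l = 0" if "l \<in> I" for l
      using that assms(1) unfolding N_def by (simp add: sum_nonneg_eq_0_iff)
    thus ?thesis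
      using X by (simp add: linear_0 bounded_linear.linear)
  next
    case False
    hence N: "N > 0"
      unfolding N_def by (simp add: sum_nonneg order_less_le)
    define r where "r = 1 / sqrt N"
    have r: "r\<^sup>2 = 1 / N"
      using N by (simp add: r_def power_divide)
    have "(\<Sum>l\<in>I. (norm (r *\<^sub>R \<xi> l))\<^sup>2) = r\<^sup>2 * N"
      by (simp add: N_def power_mult_distrib sum_distrib_left)
    also have "\<dots> = 1" using N by (simp add: r)
    finally have "sqrt (\<Sum>k\<in>I. (norm (\<Sum>l\<in>I. X k l (r *\<^sub>R \<xi> l)))\<^sup>2) \<le> matrix_opnorm I X"
      by (intro matrix_opnorm_ge) (use assms in auto)
    also have "\<dots> \<le> 1" by fact
    finally have "(\<Sum>k\<in>I. (norm (\<Sum>l\<in>I. X k l (r *\<^sub>R \<xi> l)))\<^sup>2) \<le> 1"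
      by simp
    also have "(\<Sum>k\<in>I. (norm (\<Sum>l\<in>I. X k l (r *\<^sub>R \<xi> l)))\<^sup>2)
        = (\<Sum>k\<in>I. (norm (r *\<^sub>R (\<Sum>l\<in>I. X k l (\<xi> l))))\<^sup>2)"
      unfolding scaleR_sum_right
      by (intro sum.cong refl arg_cong[where f = "\<lambda>x. (norm x)\<^sup>2"])
         (simp add: X bounded_linear.linear linear_scale)
    also have "\<dots> = r\<^sup>2 * (\<Sum>k\<in>I. (norm (\<Sum>l\<in>I. X k l (\<xi> l)))\<^sup>2)"
      by (simp add: power_mult_distrib sum_distrib_left)
    finally show ?thesis
      using N by (simp add: r N_def[symmetric] field_simps)
  qed
qed

definition orthonormal :: "'i set \<Rightarrow> ('i \<Rightarrow> 'h::complex_inner) \<Rightarrow> bool" where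
  "orthonormal I e \<longleftrightarrow> (\<forall>i\<in>I. \<forall>j\<in>I. cinner (e i) (e j) = (if i = j then 1 else 0))"

lemma orthonormal_norm_sq:
  assumes "finite I" "orthonormal I e"
  shows "(norm (\<Sum>i\<in>I. c i *\<^sub>C e i))\<^sup>2 = (\<Sum>i\<in>I. (cmod (c i))\<^sup>2)"
proof -
  have "complex_of_real ((norm (\<Sum>i\<in>I. c i *\<^sub>C e i))\<^sup>2)
      = (\<Sum>i\<in>I. \<Sum>j\<in>I. c i * (cnj (c j) * cinner (e i) (e j)))"
    unfolding cinner_self[symmetric] cinner_sum_left
    by (simp add: cinner_sum_right cinner_scaleC_left cinner_scaleC_right sum_distrib_left mult_ac)
  also have "\<dots> = (\<Sum>i\<in>I. \<Sum>j\<in>I. if i = j then c i * cnj (c j) else 0)"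
    by (intro sum.cong refl) (use assms(2) in \<open>auto simp: orthonormal_def\<close>)
  also have "\<dots> = complex_of_real (\<Sum>i\<in>I. (cmod (c i))\<^sup>2)"
    unfolding of_real_sum complex_norm_square using assms(1) by simp
  finally show ?thesis by (simp only: of_real_eq_iff)
qed

text \<open>If p is the projection of y onto the span of the e i, then <y, p> = ||p||^2, and
  Cauchy-Schwarz gives ||p|| <= ||y||.\<close>

lemma bessel:
  assumes I: "finite I" "orthonormal I e"
  shows "(\<Sum>i\<in>I. (cmod (cinner y (e i)))\<^sup>2) \<le> (norm y)\<^sup>2"
proof -
  define p where "p = (\<Sum>i\<in>I. cinner y (e i) *\<^sub>C e i)"
  have p: "(norm p)\<^sup>2 = (\<Sum>i\<in>I. (cmod (cinner y (e i)))\<^sup>2)"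
    unfolding p_def by (rule orthonormal_norm_sq[OF I])
  have "cinner y p = complex_of_real ((norm p)\<^sup>2)"
    unfolding p of_real_sum complex_norm_square
    by (simp add: p_def cinner_sum_right cinner_scaleC_right mult.commute)
  hence "(norm p)\<^sup>2 \<le> norm y * norm p"
    using cinner_Cauchy_Schwarz[of y p] by (simp add: norm_power)
  hence "norm p \<le> norm y"
    by (cases "norm p = 0") (auto simp: power2_eq_square)
  thus ?thesis unfolding p[symmetric] by (simp add: power_mono)
qed

section \<open>Matrix norms over the Fourier algebra\<close>

lemma coefficient_in_fourier_algebra: "coefficient \<xi> \<eta> \<in> fourier_algebra"
  by (auto simp: fourier_algebra_def)

lemma sum_cinner_matrix:
  fixes X :: "nat \<Rightarrow> nat \<Rightarrow> 'h::complex_inner \<Rightarrow>\<^sub>L 'h"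
  assumes "\<And>l. l < m \<Longrightarrow> X k l \<in> cblinops"
  shows "(\<Sum>l<m. cinner (X k l \<xi>) \<eta> * x l) = cinner (\<Sum>l<m. X k l (x l *\<^sub>C \<xi>)) \<eta>"
  unfolding cinner_sum_left
  by (intro sum.cong refl) (simp add: assms cblinops_scaleC cinner_scaleC_left)

abbreviation pairing_matrix where
  "pairing_matrix v X \<equiv> (\<lambda>(i, k) (j, l). (*) (fourier_pairing (v i j) (X k l)))"

lemma pairing_matrix_bounded_linear: "bounded_linear (pairing_matrix v X p q)"
  unfolding case_prod_unfold by (rule bounded_linear_mult_right)

abbreviation vN_contraction ::
    "nat \<Rightarrow> (nat \<Rightarrow> nat \<Rightarrow> ('g::group_add, complex) ell2 \<Rightarrow>\<^sub>L ('g, complex) ell2) \<Rightarrow> bool" where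
  "vN_contraction m X \<equiv> (\<forall>k<m. \<forall>l<m. X k l \<in> group_vN) \<and>
     matrix_opnorm {..<m} (\<lambda>k l. blinfun_apply (X k l)) \<le> 1"

lemma vN_contraction_apply_le:
  assumes "vN_contraction m X"
  shows "(\<Sum>k<m. (norm (\<Sum>l<m. X k l (\<xi> l)))\<^sup>2) \<le> (\<Sum>l<m. (norm (\<xi> l))\<^sup>2)"
  by (rule matrix_opnorm_apply_le) (use assms in \<open>auto intro: blinfun.bounded_linear_right\<close>)

text \<open>The bound does not depend on m and X, so the supremum in
  \<open>fourier_matrix_norm\<close> is taken over a bounded set. The factor n under the root comes
  from Cauchy-Schwarz for the sum over j.\<close>

lemma pairing_matrix_opnorm_bound:
  fixes n :: nat
  assumes v: "\<And>i j. i < n \<Longrightarrow> j < n \<Longrightarrow> v i j = coefficient (\<xi> i j) (\<eta> i j)"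
    and X: "vN_contraction m X"
  shows "matrix_opnorm ({..<n} \<times> {..<m}) (pairing_matrix v X)
      \<le> sqrt (n * (\<Sum>i<n. \<Sum>j<n. (norm (\<xi> i j))\<^sup>2 * (norm (\<eta> i j))\<^sup>2))"
proof (rule matrix_opnorm_le)
  fix x :: "nat \<times> nat \<Rightarrow> complex"
  assume x: "(\<Sum>q\<in>{..<n} \<times> {..<m}. (norm (x q))\<^sup>2) \<le> 1"
  have xj: "(\<Sum>l<m. (cmod (x (j, l)))\<^sup>2) \<le> 1" if "j < n" for j
  proof -
    have "(\<Sum>l<m. (cmod (x (j, l)))\<^sup>2) \<le> (\<Sum>j<n. \<Sum>l<m. (cmod (x (j, l)))\<^sup>2)"
      by (rule member_le_sum) (use that in \<open>auto intro: sum_nonneg\<close>)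
    also have "\<dots> = (\<Sum>q\<in>{..<n} \<times> {..<m}. (norm (x q))\<^sup>2)"
      by (simp add: sum.cartesian_product case_prod_unfold)
    finally show ?thesis using x by linarith
  qed
  \<comment> \<open>For fixed i and j, \<open>z i j\<close> is the operator matrix X applied to the
    column with entries \<open>x (j, l) *\<^sub>C \<xi> i j\<close>, so the contractivity of X
    applies to it.\<close>
  define z where "z i j k = (\<Sum>l<m. X k l (x (j, l) *\<^sub>C \<xi> i j))" for i j k
  have entry: "(\<Sum>q\<in>{..<n} \<times> {..<m}. pairing_matrix v X (i, k) q (x q))
      = (\<Sum>j<n. cinner (z i j k) (\<eta> i j))" if "i < n" "k < m" for i k
  proof -
    have "(\<Sum>q\<in>{..<n} \<times> {..<m}. pairing_matrix v X (i, k) q (x q))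
      = (\<Sum>j<n. \<Sum>l<m. fourier_pairing (v i j) (X k l) * x (j, l))"
      by (simp add: sum.cartesian_product case_prod_unfold)
    also have "\<dots> = (\<Sum>j<n. \<Sum>l<m. cinner (X k l (\<xi> i j)) (\<eta> i j) * x (j, l))"
      using that X by (intro sum.cong refl) (simp add: v fourier_pairing_coefficient)
    also have "\<dots> = (\<Sum>j<n. cinner (z i j k) (\<eta> i j))"
      unfolding z_def
      by (intro sum.cong refl sum_cinner_matrix) (use that X in \<open>auto intro: group_vN_in_cblinops\<close>)
    finally show ?thesis .
  qed
  have z: "(\<Sum>k<m. (norm (z i j k))\<^sup>2) \<le> (norm (\<xi> i j))\<^sup>2" if "j < n" for i j
  proof -
    have "(\<Sum>k<m. (norm (z i j k))\<^sup>2) \<le> (\<Sum>l<m. (norm (x (j, l) *\<^sub>C \<xi> i j))\<^sup>2)"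
      unfolding z_def by (rule vN_contraction_apply_le[OF X])
    also have "\<dots> = (\<Sum>l<m. (cmod (x (j, l)))\<^sup>2) * (norm (\<xi> i j))\<^sup>2"
      by (simp add: norm_scaleC_inner power_mult_distrib sum_distrib_right)
    also have "\<dots> \<le> 1 * (norm (\<xi> i j))\<^sup>2"
      by (intro mult_right_mono xj that) auto
    finally show ?thesis by simp
  qed
  have "(\<Sum>p\<in>{..<n} \<times> {..<m}. (norm (\<Sum>q\<in>{..<n} \<times> {..<m}. pairing_matrix v X p q (x q)))\<^sup>2)
      = (\<Sum>i<n. \<Sum>k<m. (norm (\<Sum>q\<in>{..<n} \<times> {..<m}. pairing_matrix v X (i, k) q (x q)))\<^sup>2)"
    by (simp only: sum.cartesian_product) (simp add: case_prod_unfold)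
  also have "\<dots> = (\<Sum>i<n. \<Sum>k<m. (cmod (\<Sum>j<n. cinner (z i j k) (\<eta> i j)))\<^sup>2)"
    by (intro sum.cong refl) (use entry in simp)
  also have "\<dots> \<le> (\<Sum>i<n. \<Sum>k<m. n * (\<Sum>j<n. (norm (z i j k))\<^sup>2 * (norm (\<eta> i j))\<^sup>2))"
  proof (intro sum_mono)
    fix i k
    have "(cmod (\<Sum>j<n. cinner (z i j k) (\<eta> i j)))\<^sup>2 \<le> (\<Sum>j<n. norm (z i j k) * norm (\<eta> i j))\<^sup>2"
      by (intro power_mono sum_norm_le cinner_Cauchy_Schwarz) auto
    also have "\<dots> \<le> (\<Sum>j<n. (norm (z i j k) * norm (\<eta> i j))\<^sup>2) * card {..<n}"
      by (rule sum_squared_le_sum_of_squares)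
    finally show "(cmod (\<Sum>j<n. cinner (z i j k) (\<eta> i j)))\<^sup>2
        \<le> n * (\<Sum>j<n. (norm (z i j k))\<^sup>2 * (norm (\<eta> i j))\<^sup>2)"
      by (simp add: power_mult_distrib mult.commute)
  qed
  also have "\<dots> = n * (\<Sum>i<n. \<Sum>k<m. \<Sum>j<n. (norm (z i j k))\<^sup>2 * (norm (\<eta> i j))\<^sup>2)"
    by (simp add: sum_distrib_left)
  also have "\<dots> = n * (\<Sum>i<n. \<Sum>j<n. (\<Sum>k<m. (norm (z i j k))\<^sup>2) * (norm (\<eta> i j))\<^sup>2)"
    by (subst sum.swap[of _ "{..<n}" "{..<m}"]) (simp add: sum_distrib_right)
  also have "\<dots> \<le> n * (\<Sum>i<n. \<Sum>j<n. (norm (\<xi> i j))\<^sup>2 * (norm (\<eta> i j))\<^sup>2)"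
    by (intro mult_left_mono sum_mono mult_right_mono z) auto
  finally show "(\<Sum>p\<in>{..<n} \<times> {..<m}. (norm (\<Sum>q\<in>{..<n} \<times> {..<m}. pairing_matrix v X p q (x q)))\<^sup>2)
      \<le> (sqrt (n * (\<Sum>i<n. \<Sum>j<n. (norm (\<xi> i j))\<^sup>2 * (norm (\<eta> i j))\<^sup>2)))\<^sup>2"
    by (simp add: sum_nonneg)
qed (simp add: sum_nonneg)

lemma fourier_matrix_norm_ge:
  assumes v: "\<And>i j. i < n \<Longrightarrow> j < n \<Longrightarrow> v i j \<in> fourier_algebra" and X: "vN_contraction m X"
  shows "matrix_opnorm ({..<n} \<times> {..<m}) (pairing_matrix v X) \<le> fourier_matrix_norm n v"
proof -
  obtain \<xi> \<eta> where eq: "\<And>i j. i < n \<Longrightarrow> j < n \<Longrightarrow> v i j = coefficient (\<xi> i j) (\<eta> i j)"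
    using v unfolding fourier_algebra_def mem_Collect_eq by metis
  show ?thesis
    unfolding fourier_matrix_norm_def
  proof (rule cSup_upper)
    show "bdd_above {matrix_opnorm ({..<n} \<times> {..<m}) (pairing_matrix v X) | (m::nat) X.
        vN_contraction m X}"
      by (rule bdd_aboveI[where M = "sqrt (n * (\<Sum>i<n. \<Sum>j<n. (norm (\<xi> i j))\<^sup>2 * (norm (\<eta> i j))\<^sup>2))"])
         (auto intro: pairing_matrix_opnorm_bound[OF eq])
  qed (use X in blast)
qed

lemma vN_contraction_empty: "vN_contraction 0 X"
  using matrix_opnorm_le[of "{}" "\<lambda>k l. blinfun_apply (X k l)" 1] by simp

lemma fourier_matrix_norm_nonneg:
  assumes v: "\<And>i j. i < n \<Longrightarrow> j < n \<Longrightarrow> v i j \<in> fourier_algebra"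
  shows "0 \<le> fourier_matrix_norm n v"
proof -
  have "0 \<le> matrix_opnorm ({..<n} \<times> {..<0::nat}) (pairing_matrix v (\<lambda>_ _. 0))"
    by (rule matrix_opnorm_nonneg) (rule finite_cartesian_product finite_lessThan pairing_matrix_bounded_linear)+
  also have "\<dots> \<le> fourier_matrix_norm n v"
    by (rule fourier_matrix_norm_ge[OF v vN_contraction_empty])
  finally show ?thesis .
qed

lemma fourier_matrix_norm_le:
  assumes "\<And>m X. vN_contraction m X \<Longrightarrow> matrix_opnorm ({..<n} \<times> {..<m}) (pairing_matrix v X) \<le> C"
  shows "fourier_matrix_norm n v \<le> C"
  unfolding fourier_matrix_norm_def
proof (rule cSup_least)
  show "{matrix_opnorm ({..<n} \<times> {..<m}) (pairing_matrix v X) | (m::nat) X. vN_contraction m X} \<noteq> {}"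
    using vN_contraction_empty by blast
qed (use assms in blast)

lemma McbA_mult_in_fourier_algebra:
  "\<phi> \<in> McbA \<Longrightarrow> v \<in> fourier_algebra \<Longrightarrow> (\<lambda>s. \<phi> s * v s) \<in> fourier_algebra"
  by (auto simp: McbA_def)

lemma fourier_matrix_norm_le_cb_norm:
  assumes \<phi>: "\<phi> \<in> McbA" and v: "\<And>i j. i < n \<Longrightarrow> j < n \<Longrightarrow> v i j \<in> fourier_algebra"
    and "fourier_matrix_norm n v \<le> 1"
  shows "fourier_matrix_norm n (\<lambda>i j s. \<phi> s * v i j s) \<le> cb_norm \<phi>"
  unfolding cb_norm_def
proof (rule cSup_upper)
  obtain C where C: "\<And>n v. (\<And>i j. i < n \<Longrightarrow> j < n \<Longrightarrow> v i j \<in> fourier_algebra) \<Longrightarrow>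
        fourier_matrix_norm n (\<lambda>i j s. \<phi> s * v i j s) \<le> C * fourier_matrix_norm n v"
    using \<phi> unfolding McbA_def by blast
  show "bdd_above {fourier_matrix_norm n (\<lambda>i j s. \<phi> s * v i j s) | n v.
          (\<forall>i<n. \<forall>j<n. v i j \<in> fourier_algebra) \<and> fourier_matrix_norm n v \<le> 1}"
  proof (rule bdd_aboveI)
    fix r assume "r \<in> {fourier_matrix_norm n (\<lambda>i j s. \<phi> s * v i j s) | n v.
          (\<forall>i<n. \<forall>j<n. v i j \<in> fourier_algebra) \<and> fourier_matrix_norm n v \<le> 1}"
    then obtain n v where r: "r = fourier_matrix_norm n (\<lambda>i j s. \<phi> s * v i j s)"
      and v: "\<And>i j. i < n \<Longrightarrow> j < n \<Longrightarrow> v i j \<in> fourier_algebra" and le: "fourier_matrix_norm n v \<le> 1"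
      by blast
    have "r \<le> C * fourier_matrix_norm n v"
      unfolding r by (rule C[OF v])
    \<comment> \<open>The constant in \<open>McbA\<close> carries no sign, hence the absolute
      value.\<close>
    also have "\<dots> \<le> \<bar>C\<bar> * 1"
      using fourier_matrix_norm_nonneg[of n v] v le by (intro mult_mono) auto
    finally show "r \<le> \<bar>C\<bar>" by simp
  qed
qed (use assms in blast)

text \<open>The unit ball of M_cb A(G) is nonempty, which is what allows the supremum in
  \<open>Qcb_norm\<close> to be bounded from above.\<close>

lemma zero_in_McbA:
  shows "(\<lambda>_::'a::group_add. 0) \<in> McbA" and "cb_norm (\<lambda>_::'a. 0) \<le> 1"
proof -
  have 0: "(\<lambda>_::'a. 0) = coefficient 0 0"
    by (simp add: coefficient_def)
  have fm: "fourier_matrix_norm n (\<lambda>i j s. 0 * v i j s) \<le> 0"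
    for n and v :: "nat \<Rightarrow> nat \<Rightarrow> 'a \<Rightarrow> complex"
  proof (rule fourier_matrix_norm_le)
    fix m and X :: "nat \<Rightarrow> nat \<Rightarrow> ('a, complex) ell2 \<Rightarrow>\<^sub>L ('a, complex) ell2"
    assume X: "vN_contraction m X"
    show "matrix_opnorm ({..<n} \<times> {..<m}) (pairing_matrix (\<lambda>i j s. 0 * v i j s) X) \<le> 0"
      using pairing_matrix_opnorm_bound[of n _ "\<lambda>_ _. 0" "\<lambda>_ _. 0", OF _ X] 0 by simp
  qed
  have "\<forall>v\<in>fourier_algebra. (\<lambda>s::'a. 0 * v s) \<in> fourier_algebra"
    by (simp add: 0 coefficient_in_fourier_algebra)
  moreover have "\<exists>C. \<forall>n v. (\<forall>i<n. \<forall>j<n. v i j \<in> fourier_algebra) \<longrightarrow>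
      fourier_matrix_norm n (\<lambda>i j (s::'a). 0 * v i j s) \<le> C * fourier_matrix_norm n v"
    using fm by (intro exI[of _ 0]) auto
  ultimately show "(\<lambda>_::'a. 0) \<in> McbA"
    unfolding McbA_def by auto
  show "cb_norm (\<lambda>_::'a. 0) \<le> 1"
    unfolding cb_norm_def
  proof (rule cSup_least)
    have "fourier_matrix_norm 0 (\<lambda>_ _ (_::'a). 0) \<le> 1"
      using fm[of 0 "\<lambda>_ _ _. 0"] by simp
    thus "{fourier_matrix_norm n (\<lambda>i j (s::'a). 0 * v i j s) | n v.
          (\<forall>i<n. \<forall>j<n. v i j \<in> fourier_algebra) \<and> fourier_matrix_norm n v \<le> 1} \<noteq> {}"
      by (auto intro!: exI[of _ 0])
  qed (use fm in \<open>fastforce intro: order_trans\<close>)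
qed

section \<open>Multipliers as Schur multipliers\<close>

lemma has_sum_finite_sum:
  fixes f :: "'i \<Rightarrow> 'a \<Rightarrow> 'b::{comm_monoid_add, topological_comm_monoid_add}"
  assumes "\<And>i. i \<in> I \<Longrightarrow> (f i has_sum s i) A"
  shows "((\<lambda>x. \<Sum>i\<in>I. f i x) has_sum (\<Sum>i\<in>I. s i)) A"
  using assms by (induction I rule: infinite_finite_induct) (auto intro: has_sum_add)

text \<open>This is X tensored with the identity: the scalar inequality holds in each coordinate i,
  and the results are summed over i.\<close>

lemma scalar_matrix_contraction_ell2:
  fixes X :: "nat \<Rightarrow> nat \<Rightarrow> complex" and \<zeta> :: "nat \<Rightarrow> ('i, complex) ell2"
  assumes "\<And>x. (\<Sum>k<m. (cmod (\<Sum>l<m. X k l * x l))\<^sup>2) \<le> (\<Sum>l<m. (cmod (x l))\<^sup>2)"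
  shows "(\<Sum>k<m. (norm (\<Sum>l<m. X k l *\<^sub>C \<zeta> l))\<^sup>2) \<le> (\<Sum>l<m. (norm (\<zeta> l))\<^sup>2)"
proof -
  have hs: "((\<lambda>i. \<Sum>k<m. (norm (Rep_ell2 (z k) i))\<^sup>2) has_sum (\<Sum>k<m. (norm (z k))\<^sup>2)) UNIV"
    for z :: "nat \<Rightarrow> ('i, complex) ell2"
    unfolding norm_ell2_sq
    by (rule has_sum_finite_sum) (auto simp: Rep_ell2_summable)
  show ?thesis
    using assms
    by (intro has_sum_mono[OF hs hs])
       (simp add: Rep_sum_ell2 Rep_ell2_simps scaleC_complex_def)
qed

text \<open>An element of the commutant of \<lambda>(G) commutes with \<lambda>(s) by definition,
  and with c because the commutant consists of complex-linear operators.\<close>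

lemma scaled_left_regular_in_group_vN: "scaleC_op c o\<^sub>L left_regular s \<in> group_vN"
proof -
  have "(scaleC_op c o\<^sub>L left_regular s) o\<^sub>L S = S o\<^sub>L (scaleC_op c o\<^sub>L left_regular s)"
    if "S \<in> commutant (range left_regular)" for S :: "('a, complex) ell2 \<Rightarrow>\<^sub>L ('a, complex) ell2"
  proof (rule blinfun_eqI)
    fix x
    have "S o\<^sub>L left_regular s = left_regular s o\<^sub>L S"
      using that by (simp add: commutant_def)
    hence "S (left_regular s x) = left_regular s (S x)"
      by (metis blinfun_apply_blinfun_compose)
    thus "((scaleC_op c o\<^sub>L left_regular s) o\<^sub>L S) x = (S o\<^sub>L (scaleC_op c o\<^sub>L left_regular s)) x"
      using that by (simp add: commutant_def cblinops_scaleC)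
  qed
  moreover have "scaleC_op c o\<^sub>L left_regular s \<in> cblinops"
    by (rule cblinopsI) (simp add: cblinops_scaleC[OF left_regular_in_cblinops] scaleC_scaleC mult.commute)
  ultimately show ?thesis
    by (simp add: group_vN_def commutant_def[of "commutant _"])
qed

lemma sum_indicator_pair:
  assumes "\<And>l. l < m \<Longrightarrow> q l < (n::nat)"
  shows "(\<Sum>p\<in>{..<n} \<times> {..<m}. if fst p = q (snd p) then f p else 0) = (\<Sum>l<(m::nat). f (q l, l))"
proof -
  have "(\<Sum>p\<in>{..<n} \<times> {..<m}. if fst p = q (snd p) then f p else 0)
      = (\<Sum>j<n. \<Sum>l<m. if j = q l then f (j, l) else 0)"
    unfolding sum.cartesian_product by (intro sum.cong) auto
  also have "\<dots> = (\<Sum>l<m. \<Sum>j<n. if j = q l then f (j, l) else 0)"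
    by (rule sum.swap)
  also have "\<dots> = (\<Sum>l<m. f (q l, l))"
    by (intro sum.cong refl) (simp add: assms)
  finally show ?thesis .
qed

text \<open>Pair the matrix of point masses \<open>v i j\<close> at \<open>g\<^sub>i g\<^sub>j\<^sup>-\<^sup>1\<close>, which is the compression
  \<open>T \<mapsto> (\<langle>T \<delta>(g\<^sub>j), \<delta>(g\<^sub>i)\<rangle>)\<close>, with the unitarily twisted matrix \<open>X k l \<lambda>(s\<^sub>k s\<^sub>l\<^sup>-\<^sup>1)\<close>; the Schur
  product is a compression of the result.\<close>

lemma McbA_schur_scalar:
  fixes \<phi> :: "'g::group_add \<Rightarrow> complex" and s :: "nat \<Rightarrow> 'g"
  assumes \<phi>: "\<phi> \<in> McbA" "cb_norm \<phi> \<le> 1"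
    and X: "\<And>x. (\<Sum>k<m. (cmod (\<Sum>l<m. X k l * x l))\<^sup>2) \<le> (\<Sum>l<m. (cmod (x l))\<^sup>2)"
  shows "(\<Sum>k<m. (cmod (\<Sum>l<m. \<phi> (s k - s l) * X k l * x l))\<^sup>2) \<le> (\<Sum>l<m. (cmod (x l))\<^sup>2)"
proof -
  \<comment> \<open>The s k may repeat, whereas the point masses have to be orthonormal. So g lists
    the distinct values, and q l is the position of s l in this list.\<close>
  obtain n g where g: "bij_betw g {..<n::nat} (s ` {..<m})"
    using ex_bij_betw_nat_finite[of "s ` {..<m}"] by (auto simp: lessThan_atLeast0)
  define q where "q l = inv_into {..<n} g (s l)" for l
  have q: "q l < n" "g (q l) = s l" if "l < m" for l
  proof -
    have "s l \<in> g ` {..<n}" using g that by (auto simp: bij_betw_def)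
    thus "q l < n" "g (q l) = s l"
      unfolding q_def using inv_into_into[of "s l" g "{..<n}"] by (auto simp: f_inv_into_f)
  qed
  define \<delta> where "\<delta> j = (single (g j) 1 :: ('g, complex) ell2)" for j
  have on: "orthonormal {..<n} \<delta>"
    using g by (auto simp: orthonormal_def \<delta>_def cinner_single_right Rep_single cinner_complex_def
        bij_betw_def inj_on_def)
  define v where "v i j = coefficient (\<delta> j) (\<delta> i)" for i j
  have v: "v i j \<in> fourier_algebra" for i j
    by (simp add: v_def coefficient_in_fourier_algebra)
  \<comment> \<open>A compression to the span of the \<delta> j is completely contractive: Bessel's
    inequality estimates the output, and on the input side the column x has the same norm as the
    column of the \<zeta> l.\<close>
  have "fourier_matrix_norm n v \<le> 1"
  proof (rule fourier_matrix_norm_le, rule matrix_opnorm_le)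
    fix m and X :: "nat \<Rightarrow> nat \<Rightarrow> ('g, complex) ell2 \<Rightarrow>\<^sub>L ('g, complex) ell2"
      and x :: "nat \<times> nat \<Rightarrow> complex"
    assume X: "vN_contraction m X" and x: "(\<Sum>q\<in>{..<n} \<times> {..<m}. (norm (x q))\<^sup>2) \<le> 1"
    define \<zeta> where "\<zeta> l = (\<Sum>j<n. x (j, l) *\<^sub>C \<delta> j)" for l
    have entry: "(\<Sum>q\<in>{..<n} \<times> {..<m}. pairing_matrix v X (i, k) q (x q))
        = cinner (\<Sum>l<m. X k l (\<zeta> l)) (\<delta> i)" if "k < m" for i k
    proof -
      have "(\<Sum>q\<in>{..<n} \<times> {..<m}. pairing_matrix v X (i, k) q (x q))
          = (\<Sum>j<n. \<Sum>l<m. fourier_pairing (v i j) (X k l) * x (j, l))"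
        by (simp add: sum.cartesian_product case_prod_unfold)
      also have "\<dots> = (\<Sum>j<n. \<Sum>l<m. cinner (X k l (\<delta> j)) (\<delta> i) * x (j, l))"
        using that X by (intro sum.cong refl) (simp add: v_def fourier_pairing_coefficient)
      also have "\<dots> = (\<Sum>j<n. cinner (\<Sum>l<m. X k l (x (j, l) *\<^sub>C \<delta> j)) (\<delta> i))"
        by (intro sum.cong refl sum_cinner_matrix) (use that X in \<open>auto intro: group_vN_in_cblinops\<close>)
      also have "\<dots> = cinner (\<Sum>l<m. X k l (\<zeta> l)) (\<delta> i)"
        unfolding cinner_sum_left[symmetric] \<zeta>_def blinfun.sum_right
        by (subst sum.swap) simp
      finally show ?thesis .
    qed
    have "(\<Sum>p\<in>{..<n} \<times> {..<m}. (norm (\<Sum>q\<in>{..<n} \<times> {..<m}. pairing_matrix v X p q (x q)))\<^sup>2)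
        = (\<Sum>i<n. \<Sum>k<m. (norm (\<Sum>q\<in>{..<n} \<times> {..<m}. pairing_matrix v X (i, k) q (x q)))\<^sup>2)"
      by (simp only: sum.cartesian_product) (simp add: case_prod_unfold)
    also have "\<dots> = (\<Sum>i<n. \<Sum>k<m. (cmod (cinner (\<Sum>l<m. X k l (\<zeta> l)) (\<delta> i)))\<^sup>2)"
      by (intro sum.cong refl) (use entry in simp)
    also have "\<dots> = (\<Sum>k<m. \<Sum>i<n. (cmod (cinner (\<Sum>l<m. X k l (\<zeta> l)) (\<delta> i)))\<^sup>2)"
      by (rule sum.swap)
    also have "\<dots> \<le> (\<Sum>k<m. (norm (\<Sum>l<m. X k l (\<zeta> l)))\<^sup>2)"
      by (intro sum_mono bessel on) auto
    also have "\<dots> \<le> (\<Sum>l<m. (norm (\<zeta> l))\<^sup>2)"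
      by (rule vN_contraction_apply_le[OF X])
    also have "\<dots> = (\<Sum>l<m. \<Sum>j<n. (cmod (x (j, l)))\<^sup>2)"
      unfolding \<zeta>_def by (intro sum.cong refl orthonormal_norm_sq on) auto
    also have "\<dots> = (\<Sum>j<n. \<Sum>l<m. (cmod (x (j, l)))\<^sup>2)"
      by (rule sum.swap)
    also have "\<dots> = (\<Sum>q\<in>{..<n} \<times> {..<m}. (norm (x q))\<^sup>2)"
      by (simp add: sum.cartesian_product case_prod_unfold)
    finally show "(\<Sum>p\<in>{..<n} \<times> {..<m}. (norm (\<Sum>q\<in>{..<n} \<times> {..<m}. pairing_matrix v X p q (x q)))\<^sup>2) \<le> 1\<^sup>2"
      using x by simp
  qed simp
  hence fm: "fourier_matrix_norm n (\<lambda>i j t. \<phi> t * v i j t) \<le> 1"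
    using fourier_matrix_norm_le_cb_norm[OF \<phi>(1), of n v] v \<phi>(2) by simp
  \<comment> \<open>Y k l is X k l multiplied by \<lambda>(s k) \<lambda>(s l)^-1. So Y is X,
    tensored with the identity, conjugated by a diagonal unitary, and again a contraction.\<close>
  define Y :: "nat \<Rightarrow> nat \<Rightarrow> ('g, complex) ell2 \<Rightarrow>\<^sub>L ('g, complex) ell2"
    where "Y k l = scaleC_op (X k l) o\<^sub>L left_regular (s k - s l)" for k l
  have Y: "vN_contraction m Y"
  proof (intro conjI allI impI matrix_opnorm_le)
    show "Y k l \<in> group_vN" for k l
      unfolding Y_def by (rule scaled_left_regular_in_group_vN)
    fix \<zeta> :: "nat \<Rightarrow> ('g, complex) ell2" assume \<zeta>: "(\<Sum>l<m. (norm (\<zeta> l))\<^sup>2) \<le> 1"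
    have "(\<Sum>l<m. Y k l (\<zeta> l)) = left_regular (s k) (\<Sum>l<m. X k l *\<^sub>C left_regular (- s l) (\<zeta> l))" for k
      by (simp add: Y_def blinfun.sum_right cblinops_scaleC[OF left_regular_in_cblinops]
          left_regular_add)
    hence "(\<Sum>k<m. (norm (\<Sum>l<m. Y k l (\<zeta> l)))\<^sup>2)
        = (\<Sum>k<m. (norm (\<Sum>l<m. X k l *\<^sub>C left_regular (- s l) (\<zeta> l)))\<^sup>2)"
      by (simp add: norm_left_regular)
    also have "\<dots> \<le> (\<Sum>l<m. (norm (left_regular (- s l) (\<zeta> l)))\<^sup>2)"
      by (rule scalar_matrix_contraction_ell2[OF X])
    also have "\<dots> \<le> 1\<^sup>2"
      using \<zeta> by (simp add: norm_left_regular)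
    finally show "(\<Sum>k<m. (norm (\<Sum>l<m. Y k l (\<zeta> l)))\<^sup>2) \<le> 1\<^sup>2" .
  qed auto
  let ?v = "\<lambda>i j t. \<phi> t * v i j t"
  have "matrix_opnorm ({..<n} \<times> {..<m}) (pairing_matrix ?v Y) \<le> 1"
    using fourier_matrix_norm_ge[of n ?v m Y] McbA_mult_in_fourier_algebra[OF \<phi>(1) v] Y fm
    by (meson order_trans)
  \<comment> \<open>The column x is placed on the positions (q l, l), which does not change its
    norm. Reading off the rows (q k, k) of the result leaves precisely the Schur product.\<close>
  define x' where "x' p = (if fst p = q (snd p) then x (snd p) else 0)" for p
  have "(\<Sum>p\<in>{..<n} \<times> {..<m}. (norm (\<Sum>r\<in>{..<n} \<times> {..<m}. pairing_matrix ?v Y p r (x' r)))\<^sup>2)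
      \<le> (\<Sum>r\<in>{..<n} \<times> {..<m}. (norm (x' r))\<^sup>2)"
    by (rule matrix_opnorm_apply_le) (rule finite_cartesian_product finite_lessThan pairing_matrix_bounded_linear | fact)+
  also have "\<dots> = (\<Sum>r\<in>{..<n} \<times> {..<m}. if fst r = q (snd r) then (cmod (x (snd r)))\<^sup>2 else 0)"
    by (intro sum.cong) (auto simp: x'_def)
  also have "\<dots> = (\<Sum>l<m. (cmod (x l))\<^sup>2)"
    by (subst sum_indicator_pair) (auto simp: q)
  finally have le: "(\<Sum>p\<in>{..<n} \<times> {..<m}. (norm (\<Sum>r\<in>{..<n} \<times> {..<m}. pairing_matrix ?v Y p r (x' r)))\<^sup>2)
      \<le> (\<Sum>l<m. (cmod (x l))\<^sup>2)" .
  \<comment> \<open>v i j is the point mass at g i - g j, so multiplication by \<phi> only scales it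
    by the value of \<phi> there.\<close>
  have v_entry: "?v i j = coefficient (\<phi> (g i - g j) *\<^sub>C \<delta> j) (\<delta> i)" for i j
  proof
    fix t
    have "g i = t + g j \<longleftrightarrow> t = g i - g j" by (auto simp: eq_diff_eq)
    thus "?v i j t = coefficient (\<phi> (g i - g j) *\<^sub>C \<delta> j) (\<delta> i) t"
      by (simp add: v_def coefficient_def cblinops_scaleC[OF left_regular_in_cblinops] \<delta>_def
          left_regular_single cinner_scaleC_left cinner_single_right Rep_single cinner_complex_def
          Rep_scaleC_ell2 scaleC_complex_def)
  qed
  have pair: "fourier_pairing (?v (q k) (q l)) (Y k l) = \<phi> (s k - s l) * X k l"
    if "k < m" "l < m" for k l
  proof -
    have "Y k l \<in> group_vN" using Y that by blast
    hence "fourier_pairing (?v (q k) (q l)) (Y k l)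
        = cinner (Y k l (\<phi> (g (q k) - g (q l)) *\<^sub>C \<delta> (q l))) (\<delta> (q k))"
      unfolding v_entry by (rule fourier_pairing_coefficient)
    also have "\<dots> = \<phi> (s k - s l) * X k l"
      using that
      by (simp add: q Y_def \<delta>_def cblinops_scaleC[OF left_regular_in_cblinops] left_regular_single
          cinner_scaleC_left cinner_single_right Rep_single cinner_complex_def
          Rep_scaleC_ell2 scaleC_complex_def)
    finally show ?thesis .
  qed
  have inner: "(\<Sum>r\<in>{..<n} \<times> {..<m}. pairing_matrix ?v Y (q k, k) r (x' r))
      = (\<Sum>l<m. \<phi> (s k - s l) * X k l * x l)" if "k < m" for k
  proof -
    have "(\<Sum>r\<in>{..<n} \<times> {..<m}. pairing_matrix ?v Y (q k, k) r (x' r))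
       = (\<Sum>r\<in>{..<n} \<times> {..<m}. if fst r = q (snd r)
            then fourier_pairing (?v (q k) (fst r)) (Y k (snd r)) * x (snd r) else 0)"
      by (intro sum.cong) (auto simp: x'_def)
    also have "\<dots> = (\<Sum>l<m. fourier_pairing (?v (q k) (q l)) (Y k l) * x l)"
      by (subst sum_indicator_pair) (auto simp: q)
    also have "\<dots> = (\<Sum>l<m. \<phi> (s k - s l) * X k l * x l)"
      using that by (intro sum.cong refl) (use pair in simp)
    finally show ?thesis .
  qed
  have "(\<Sum>k<m. (cmod (\<Sum>l<m. \<phi> (s k - s l) * X k l * x l))\<^sup>2)
      = (\<Sum>k<m. (norm (\<Sum>r\<in>{..<n} \<times> {..<m}. pairing_matrix ?v Y (q k, k) r (x' r)))\<^sup>2)"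
    by (intro sum.cong refl) (use inner in simp)
  also have "\<dots> = (\<Sum>p\<in>(\<lambda>k. (q k, k)) ` {..<m}.
      (norm (\<Sum>r\<in>{..<n} \<times> {..<m}. pairing_matrix ?v Y p r (x' r)))\<^sup>2)"
    by (subst sum.reindex) (auto simp: inj_on_def)
  also have "\<dots> \<le> (\<Sum>p\<in>{..<n} \<times> {..<m}. (norm (\<Sum>r\<in>{..<n} \<times> {..<m}. pairing_matrix ?v Y p r (x' r)))\<^sup>2)"
    by (rule sum_mono2) (auto simp: q)
  finally show ?thesis using le by linarith
qed

text \<open>\<open>S\<close> is the Schur product of \<open>T\<close> with the kernel \<open>(s, t) \<mapsto> \<phi>(s t\<^sup>-\<^sup>1)\<close>.\<close>

definition schur_rel ::
    "('g::group_add \<Rightarrow> complex) \<Rightarrow> (('g, 'h::complex_inner) ell2 \<Rightarrow>\<^sub>L ('g, 'h) ell2) \<Rightarrow>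
     (('g, 'h) ell2 \<Rightarrow>\<^sub>L ('g, 'h) ell2) \<Rightarrow> bool" where
  "schur_rel \<phi> T S \<longleftrightarrow> (\<forall>s t h k.
     cinner (S (single t h)) (single s k) = \<phi> (s - t) * cinner (T (single t h)) (single s k))"

lemma schur_relD:
  "schur_rel \<phi> T S \<Longrightarrow>
    cinner (S (single t h)) (single s k) = \<phi> (s - t) * cinner (T (single t h)) (single s k)"
  by (simp add: schur_rel_def)

section \<open>Operators on l2(G, H) and their matrix entries\<close>

lemma bounded_bilinear_cinner:
  "bounded_bilinear (cinner :: 'a::complex_inner \<Rightarrow> 'a \<Rightarrow> complex)"
proof
  fix r :: real and a b :: 'a
  show "cinner (r *\<^sub>R a) b = r *\<^sub>R cinner a b"
    by (simp add: cinner_scaleC_left scaleR_conv_of_real flip: scaleC_of_real)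
  show "cinner a (r *\<^sub>R b) = r *\<^sub>R cinner a b"
    by (simp add: cinner_scaleC_right scaleR_conv_of_real flip: scaleC_of_real)
  show "\<exists>K. \<forall>a b::'a. norm (cinner a b) \<le> norm a * norm b * K"
    using cinner_Cauchy_Schwarz by (intro exI[of _ 1]) auto
qed (simp_all add: cinner_add_left cinner_add_right)

lemmas tendsto_cinner = bounded_bilinear.tendsto[OF bounded_bilinear_cinner]

text \<open>Finitely supported vectors are dense, so by continuity the bound passes to arbitrary x
  and to y = S x, where it bounds the norm of S x.\<close>

lemma norm_blinfun_ell2_le:
  fixes S :: "('i, 'h::complex_inner) ell2 \<Rightarrow>\<^sub>L ('i, 'h) ell2"
  assumes "0 \<le> C"
    and le: "\<And>x y F. finite F \<Longrightarrow> (\<And>i. i \<notin> F \<Longrightarrow> Rep_ell2 x i = 0) \<Longrightarrow>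
      (\<And>i. i \<notin> F \<Longrightarrow> Rep_ell2 y i = 0) \<Longrightarrow> cmod (cinner (S x) y) \<le> C * norm x * norm y"
  shows "norm S \<le> C"
proof (rule norm_blinfun_bound[OF assms(1)])
  fix x :: "('i, 'h) ell2"
  obtain X where X: "X \<longlonglongrightarrow> x" "\<And>n::nat. finite {i. Rep_ell2 (X n) i \<noteq> 0}"
    using ell2_finite_support_seq[of x] by blast
  obtain Y where Y: "Y \<longlonglongrightarrow> S x" "\<And>n::nat. finite {i. Rep_ell2 (Y n) i \<noteq> 0}"
    using ell2_finite_support_seq[of "S x"] by blast
  have "cmod (cinner (S x) (S x)) \<le> C * norm x * norm (S x)"
  proof (rule LIMSEQ_le)
    show "(\<lambda>n. cmod (cinner (S (X n)) (Y n))) \<longlonglongrightarrow> cmod (cinner (S x) (S x))"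
      by (intro tendsto_norm tendsto_cinner blinfun.tendsto tendsto_const X Y)
    show "(\<lambda>n. C * norm (X n) * norm (Y n)) \<longlonglongrightarrow> C * norm x * norm (S x)"
      by (intro tendsto_intros X Y)
    have "cmod (cinner (S (X n)) (Y n)) \<le> C * norm (X n) * norm (Y n)" for n
      by (rule le[of "{i. Rep_ell2 (X n) i \<noteq> 0} \<union> {i. Rep_ell2 (Y n) i \<noteq> 0}"]) (auto simp: X Y)
    thus "\<exists>N. \<forall>n\<ge>N. cmod (cinner (S (X n)) (Y n)) \<le> C * norm (X n) * norm (Y n)" by blast
  qed
  thus "norm (S x) \<le> C * norm x"
    by (rule norm_le_if_cinner_le) (use assms(1) in auto)
qed

lemma cinner_op_expand:
  fixes S :: "('i, 'h::complex_inner) ell2 \<Rightarrow>\<^sub>L ('i, 'h) ell2"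
  assumes "finite F" "\<And>i. i \<notin> F \<Longrightarrow> Rep_ell2 x i = 0" "\<And>i. i \<notin> F \<Longrightarrow> Rep_ell2 y i = 0"
  shows "cinner (S x) y =
    (\<Sum>t\<in>F. \<Sum>s\<in>F. cinner (S (single t (Rep_ell2 x t))) (single s (Rep_ell2 y s)))"
proof -
  have "cinner (S x) y = cinner (S (\<Sum>t\<in>F. single t (Rep_ell2 x t))) (\<Sum>s\<in>F. single s (Rep_ell2 y s))"
    using ell2_finite_support_sum[of F x] ell2_finite_support_sum[of F y] assms by metis
  thus ?thesis
    unfolding blinfun.sum_right cinner_sum_left by (simp add: cinner_sum_right)
qed

lemma blinfun_ell2_eqI:
  fixes S T :: "('i, 'h::complex_inner) ell2 \<Rightarrow>\<^sub>L ('i, 'h) ell2"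
  assumes "\<And>s t h k. cinner (S (single t h)) (single s k) = cinner (T (single t h)) (single s k)"
  shows "S = T"
proof -
  have "norm (S - T) \<le> 0"
    by (rule norm_blinfun_ell2_le)
       (simp_all add: cinner_op_expand blinfun.diff_left cinner_diff_left assms)
  thus ?thesis by simp
qed

lemma schur_rel_unique: "schur_rel \<phi> T S \<Longrightarrow> schur_rel \<phi> T S' \<Longrightarrow> S = S'"
  by (rule blinfun_ell2_eqI) (simp add: schur_rel_def)

lemma schur_rel_add: "schur_rel \<phi> T S \<Longrightarrow> schur_rel \<phi> T' S' \<Longrightarrow> schur_rel \<phi> (T + T') (S + S')"
  by (simp add: schur_rel_def blinfun.add_left cinner_add_left algebra_simps)

lemma schur_rel_diff: "schur_rel \<phi> T S \<Longrightarrow> schur_rel \<phi> T' S' \<Longrightarrow> schur_rel \<phi> (T - T') (S - S')"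
  by (simp add: schur_rel_def blinfun.diff_left cinner_diff_left algebra_simps)

lemma schur_rel_limit:
  assumes "T \<longlonglongrightarrow> T'" "S \<longlonglongrightarrow> S'" "\<And>n. schur_rel \<phi> (T n) (S n)"
  shows "schur_rel \<phi> T' S'"
  unfolding schur_rel_def
proof (intro allI)
  fix s t h k
  have "(\<lambda>n. cinner (S n (single t h)) (single s k)) \<longlonglongrightarrow> cinner (S' (single t h)) (single s k)"
    by (intro tendsto_cinner blinfun.tendsto tendsto_const assms)
  moreover have "(\<lambda>n. \<phi> (s - t) * cinner (T n (single t h)) (single s k))
      \<longlonglongrightarrow> \<phi> (s - t) * cinner (T' (single t h)) (single s k)"
    by (intro tendsto_mult tendsto_cinner blinfun.tendsto tendsto_const assms)
  ultimately show "cinner (S' (single t h)) (single s k) = \<phi> (s - t) * cinner (T' (single t h)) (single s k)"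
    unfolding schur_relD[OF assms(3)] by (rule LIMSEQ_unique)
qed

section \<open>Schur multiplication by completely bounded multipliers\<close>

lemma finite_orthonormal_basis:
  fixes A :: "'h::complex_inner set"
  assumes "finite A"
  shows "\<exists>B. finite B \<and> orthonormal B (\<lambda>b. b) \<and> (\<forall>h\<in>A. h = (\<Sum>b\<in>B. cinner h b *\<^sub>C b))"
  using assms
proof (induction A)
  case empty
  show ?case by (rule exI[of _ "{}"]) (auto simp: orthonormal_def)
next
  case (insert x A)
  then obtain B where B: "finite B" "orthonormal B (\<lambda>b. b)" "\<And>h. h \<in> A \<Longrightarrow> h = (\<Sum>b\<in>B. cinner h b *\<^sub>C b)"
    by blast
  define y where "y = x - (\<Sum>b\<in>B. cinner x b *\<^sub>C b)"
  have yb: "cinner y b = 0" if "b \<in> B" for b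
  proof -
    have "(\<Sum>b'\<in>B. cinner x b' * cinner b' b) = (\<Sum>b'\<in>B. if b' = b then cinner x b' else 0)"
      using B(2) that by (intro sum.cong) (auto simp: orthonormal_def)
    also have "\<dots> = cinner x b" using B(1) that by simp
    finally show ?thesis
      by (simp add: y_def cinner_diff_left cinner_sum_left cinner_scaleC_left)
  qed
  show ?case
  proof (cases "y = 0")
    case True
    thus ?thesis using B by (intro exI[of _ B]) (auto simp: y_def)
  next
    case False
    define u where "u = complex_of_real (1 / norm y) *\<^sub>C y"
    have uu: "cinner u u = 1"
      using False by (simp add: cinner_self u_def norm_scaleC_inner norm_divide)
    have ub: "cinner u b = 0" "cinner b u = 0" if "b \<in> B" for b
    proof -
      show "cinner u b = 0" using yb[OF that] by (simp add: u_def cinner_scaleC_left)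
      thus "cinner b u = 0" by (metis cinner_commute complex_cnj_zero)
    qed
    have uB: "u \<notin> B" using uu ub by force
    have x: "x = y + (\<Sum>b\<in>B. cinner x b *\<^sub>C b)" by (simp add: y_def)
    have "cinner x u = cinner y u"
      by (subst x) (simp add: cinner_add_left cinner_sum_left cinner_scaleC_left ub)
    also have "\<dots> = complex_of_real (norm y)"
      using False by (simp add: u_def cinner_scaleC_right cinner_self power2_eq_square)
    finally have xu: "cinner x u *\<^sub>C u = y"
      using False by (simp add: u_def scaleC_scaleC flip: of_real_mult)
    have hu: "cinner h u = 0" if "h \<in> A" for h
      by (subst B(3)[OF that]) (simp add: cinner_sum_left cinner_scaleC_left ub)
    show ?thesis
    proof (intro exI[of _ "insert u B"] conjI ballI)
      show "orthonormal (insert u B) (\<lambda>b. b)"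
        using B(2) uu ub uB by (auto simp: orthonormal_def)
      show "h = (\<Sum>b\<in>insert u B. cinner h b *\<^sub>C b)" if "h \<in> insert x A" for h
        using that B(1,3) uB xu hu x by auto
    qed (use B in auto)
  qed
qed

text \<open>For finitely supported x and y, a finite orthonormal set B that expands all their
  coordinates reduces the matter to a scalar matrix indexed by the vectors
  \<open>single t b\<close>. Each group element t occurs once for every b in B, which is why the
  scalar inequality must allow repetitions among the s k.\<close>

lemma McbA_schur_norm_le:
  fixes T S :: "('g::group_add, 'h::complex_inner) ell2 \<Rightarrow>\<^sub>L ('g, 'h) ell2"
  assumes \<phi>: "\<phi> \<in> McbA" "cb_norm \<phi> \<le> 1"
    and TS: "T \<in> cblinops" "S \<in> cblinops" "schur_rel \<phi> T S"
  shows "norm S \<le> norm T"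
proof (rule dense_ge)
  \<comment> \<open>A strict upper bound M is positive even if T = 0, so the matrix of T can be
    divided by it.\<close>
  fix M assume M: "norm T < M"
  have M0: "M > 0" using M norm_ge_zero[of T] by linarith
  show "norm S \<le> M"
  proof (rule norm_blinfun_ell2_le)
    fix x y :: "('g, 'h) ell2" and F
    assume F: "finite F" "\<And>i. i \<notin> F \<Longrightarrow> Rep_ell2 x i = 0" "\<And>i. i \<notin> F \<Longrightarrow> Rep_ell2 y i = 0"
    obtain B where B: "finite B" "orthonormal B (\<lambda>b. b)"
        "\<And>h. h \<in> Rep_ell2 x ` F \<union> Rep_ell2 y ` F \<Longrightarrow> h = (\<Sum>b\<in>B. cinner h b *\<^sub>C b)"
      using finite_orthonormal_basis[of "Rep_ell2 x ` F \<union> Rep_ell2 y ` F"] F(1) by blast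
    obtain m e where e: "bij_betw e {..<m::nat} (F \<times> B)"
      using ex_bij_betw_nat_finite[of "F \<times> B"] F(1) B(1) by (auto simp: lessThan_atLeast0)
    define E where "E k = single (fst (e k)) (snd (e k))" for k
    have eB: "snd (e k) \<in> B" if "k < m" for k
      using bij_betwE[OF e] that by (auto simp: mem_Times_iff)
    have on: "orthonormal {..<m} E"
      unfolding orthonormal_def
    proof (intro ballI)
      fix i j assume ij: "i \<in> {..<m}" "j \<in> {..<m}"
      have "cinner (snd (e i)) (snd (e j)) = (if snd (e i) = snd (e j) then 1 else 0)"
        using B(2) eB ij by (simp add: orthonormal_def)
      moreover have "i = j \<longleftrightarrow> fst (e i) = fst (e j) \<and> snd (e i) = snd (e j)"
        using e ij by (auto simp: bij_betw_def inj_on_def prod_eq_iff)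
      ultimately show "cinner (E i) (E j) = (if i = j then 1 else 0)"
        by (auto simp: E_def cinner_single_right Rep_single)
    qed
    have expand: "z = (\<Sum>k<m. cinner (Rep_ell2 z (fst (e k))) (snd (e k)) *\<^sub>C E k)"
      if z: "z = x \<or> z = y" for z
    proof -
      have "(\<Sum>k<m. cinner (Rep_ell2 z (fst (e k))) (snd (e k)) *\<^sub>C E k)
          = (\<Sum>p\<in>F \<times> B. cinner (Rep_ell2 z (fst p)) (snd p) *\<^sub>C single (fst p) (snd p))"
        unfolding E_def by (rule sum.reindex_bij_betw[OF e])
      also have "\<dots> = (\<Sum>t\<in>F. single t (\<Sum>b\<in>B. cinner (Rep_ell2 z t) b *\<^sub>C b))"
        by (simp add: single_sum single_scaleC sum.cartesian_product case_prod_unfold)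
      also have "\<dots> = (\<Sum>t\<in>F. single t (Rep_ell2 z t))"
        using B(3) z by (intro sum.cong refl arg_cong2[where f = single]) auto
      also have "\<dots> = z"
        by (rule ell2_finite_support_sum[symmetric]) (use F z in auto)
      finally show ?thesis ..
    qed
    define a d where "a l = cinner (Rep_ell2 x (fst (e l))) (snd (e l))"
      and "d l = cinner (Rep_ell2 y (fst (e l))) (snd (e l))" for l
    have x: "x = (\<Sum>l<m. a l *\<^sub>C E l)" and y: "y = (\<Sum>k<m. d k *\<^sub>C E k)"
      unfolding a_def d_def by (rule expand, simp)+
    have nx: "(norm x)\<^sup>2 = (\<Sum>l<m. (cmod (a l))\<^sup>2)" and ny: "(norm y)\<^sup>2 = (\<Sum>l<m. (cmod (d l))\<^sup>2)"
      by (subst x y, rule orthonormal_norm_sq[OF _ on], simp)+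
    define X where "X k l = cinner (T (E l)) (E k) / M" for k l
    have X: "(\<Sum>k<m. (cmod (\<Sum>l<m. X k l * z l))\<^sup>2) \<le> (\<Sum>l<m. (cmod (z l))\<^sup>2)" for z
    proof -
      define w where "w = (\<Sum>l<m. z l *\<^sub>C E l)"
      have "(\<Sum>l<m. X k l * z l) = cinner (T w) (E k) / M" for k
        by (simp add: w_def X_def blinfun.sum_right cblinops_scaleC[OF TS(1)] cinner_sum_left
            cinner_scaleC_left sum_divide_distrib mult.commute)
      hence "(\<Sum>k<m. (cmod (\<Sum>l<m. X k l * z l))\<^sup>2) = (\<Sum>k<m. (cmod (cinner (T w) (E k)))\<^sup>2) / M\<^sup>2"
        by (simp add: norm_divide power_divide sum_divide_distrib)
      also have "\<dots> \<le> (norm (T w))\<^sup>2 / M\<^sup>2"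
        by (intro divide_right_mono bessel on) auto
      also have "\<dots> \<le> (M * norm w)\<^sup>2 / M\<^sup>2"
      proof (intro divide_right_mono power_mono)
        show "norm (T w) \<le> M * norm w"
          using norm_blinfun[of T w] mult_right_mono[of "norm T" M "norm w"] M by simp
      qed auto
      also have "\<dots> = (norm w)\<^sup>2"
        using M0 by (simp add: power_mult_distrib)
      also have "\<dots> = (\<Sum>l<m. (cmod (z l))\<^sup>2)"
        unfolding w_def by (rule orthonormal_norm_sq[OF _ on]) simp
      finally show ?thesis .
    qed
    define w where "w k = (\<Sum>l<m. \<phi> (fst (e k) - fst (e l)) * X k l * a l)" for k
    have w: "(\<Sum>k<m. (cmod (w k))\<^sup>2) \<le> (norm x)\<^sup>2"
      unfolding w_def nx by (rule McbA_schur_scalar[OF \<phi> X])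
    have SE: "cinner (S (E l)) (E k) = complex_of_real M * (\<phi> (fst (e k) - fst (e l)) * X k l)" for k l
      using M0 schur_relD[OF TS(3)] by (simp add: E_def X_def)
    have "cinner (S x) y = (\<Sum>k<m. cnj (d k) * (\<Sum>l<m. a l * cinner (S (E l)) (E k)))"
      by (subst x, subst y) (simp add: blinfun.sum_right cblinops_scaleC[OF TS(2)] cinner_sum_left
          cinner_sum_right cinner_scaleC_left cinner_scaleC_right)
    also have "\<dots> = complex_of_real M * (\<Sum>k<m. cnj (d k) * w k)"
      unfolding SE w_def sum_distrib_left by (intro sum.cong refl) (simp add: mult_ac)
    finally have "cmod (cinner (S x) y) = M * cmod (\<Sum>k<m. cnj (d k) * w k)"
      using M0 by (simp add: norm_mult)
    also have "cmod (\<Sum>k<m. cnj (d k) * w k) \<le> norm x * norm y"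
    proof (rule power2_le_imp_le)
      have "(cmod (\<Sum>k<m. cnj (d k) * w k))\<^sup>2 \<le> (\<Sum>k<m. cmod (d k) * cmod (w k))\<^sup>2"
        by (intro power_mono sum_norm_le) (auto simp: norm_mult)
      also have "\<dots> \<le> (\<Sum>k<m. (cmod (d k))\<^sup>2) * (\<Sum>k<m. (cmod (w k))\<^sup>2)"
        by (rule Cauchy_Schwarz_ineq_sum)
      also have "\<dots> \<le> (norm y)\<^sup>2 * (norm x)\<^sup>2"
        unfolding ny[symmetric] by (intro mult_left_mono w) auto
      finally show "(cmod (\<Sum>k<m. cnj (d k) * w k))\<^sup>2 \<le> (norm x * norm y)\<^sup>2"
        by (simp add: power_mult_distrib mult.commute)
    qed simp
    finally show "cmod (cinner (S x) y) \<le> M * norm x * norm y"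
      using M0 by (simp add: mult.assoc)
  qed (use M0 in simp)
qed

section \<open>Schur multiplication by coefficient functions\<close>

lemma has_sum_Cauchy_Schwarz:
  fixes c :: "'i \<Rightarrow> complex" and f g :: "'i \<Rightarrow> real"
  assumes c: "(c has_sum s) UNIV" and f: "((\<lambda>i. (f i)\<^sup>2) has_sum A\<^sup>2) UNIV"
    and g: "((\<lambda>i. (g i)\<^sup>2) has_sum B\<^sup>2) UNIV" and le: "\<And>i. cmod (c i) \<le> f i * g i"
    and AB: "0 \<le> A" "0 \<le> B"
  shows "cmod s \<le> A * B"
proof (rule tendsto_upperbound)
  show "((\<lambda>F. cmod (\<Sum>i\<in>F. c i)) \<longlongrightarrow> cmod s) (finite_subsets_at_top UNIV)"
    using c unfolding has_sum_def by (rule tendsto_norm)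
  have "cmod (\<Sum>i\<in>F. c i) \<le> A * B" if "finite F" for F
  proof (rule power2_le_imp_le)
    have "(cmod (\<Sum>i\<in>F. c i))\<^sup>2 \<le> (\<Sum>i\<in>F. f i * g i)\<^sup>2"
      by (intro power_mono sum_norm_le le) auto
    also have "\<dots> \<le> (\<Sum>i\<in>F. (f i)\<^sup>2) * (\<Sum>i\<in>F. (g i)\<^sup>2)"
      by (rule Cauchy_Schwarz_ineq_sum)
    also have "\<dots> \<le> A\<^sup>2 * B\<^sup>2"
      using finite_sum_le_has_sum[OF f that] finite_sum_le_has_sum[OF g that]
      by (intro mult_mono) (auto simp: sum_nonneg)
    finally show "(cmod (\<Sum>i\<in>F. c i))\<^sup>2 \<le> (A * B)\<^sup>2" by (simp add: power_mult_distrib)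
  qed (use AB in simp)
  thus "\<forall>\<^sub>F F in finite_subsets_at_top UNIV. cmod (\<Sum>i\<in>F. c i) \<le> A * B"
    by (auto intro: eventually_finite_subsets_at_top_weakI)
qed simp

text \<open>Moving \<lambda>(s) to the other side turns the value at s - t into <\<lambda>(- t)
  \<xi>, \<lambda>(- s) \<eta>>. The kernel thus becomes a sum over r of products of a function of t
  and a function of s.\<close>

lemma coefficient_diff_has_sum:
  fixes \<xi> :: "('g::group_add, complex) ell2"
  shows
  "((\<lambda>r. Rep_ell2 \<xi> (t + r) * cnj (Rep_ell2 \<eta> (s + r))) has_sum coefficient \<xi> \<eta> (s - t)) UNIV"
proof -
  have "coefficient \<xi> \<eta> (s - t) = cinner (left_regular s (left_regular (- t) \<xi>)) \<eta>"
    by (simp add: coefficient_def left_regular_add)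
  also have "\<dots> = cinner (left_regular (- t) \<xi>) (left_regular (- s) \<eta>)"
    by (simp add: cinner_left_regular)
  finally show ?thesis
    using has_sum_infsum[OF ell2_cinner_summable[of "left_regular (- t) \<xi>" "left_regular (- s) \<eta>"]]
    by (simp add: cinner_ell2_def Rep_left_regular cinner_complex_def)
qed

lemma translate_has_sum_norm:
  fixes \<xi> :: "('g::group_add, 'h::complex_inner) ell2"
  shows
  "((\<lambda>r. (norm (Rep_ell2 \<xi> (t + r)))\<^sup>2) has_sum (norm \<xi>)\<^sup>2) UNIV"
  using has_sum_infsum[OF Rep_ell2_summable[of "left_regular (- t) \<xi>"]]
  by (simp add: norm_ell2_sq[symmetric] norm_left_regular) (simp add: Rep_left_regular)

lemma norm_sum_single_sq:
  assumes "finite F"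
  shows "(norm (\<Sum>t\<in>F. single t (f t)))\<^sup>2 = (\<Sum>t\<in>F. (norm (f t))\<^sup>2)"
proof -
  have R: "Rep_ell2 (\<Sum>t\<in>F. single t (f t)) i = (if i \<in> F then f i else 0)" for i
    using assms by (simp add: Rep_sum_ell2 Rep_single sum.delta')
  show ?thesis
    unfolding norm_ell2_sq by (subst infsum_finite_support[OF assms]) (auto simp: R)
qed

text \<open>Since the kernel is a sum of products, <S x, y> is the sum over r of <T z(\<xi>, x, r),
  z(\<eta>, y, r)>, where z(\<zeta>, u, r) is u multiplied pointwise by t |-> \<zeta>(t + r). The
  squared norms of z(\<zeta>, u, r) add up over r to ||\<zeta>||^2 ||u||^2, and Cauchy-Schwarz in r
  gives the constant.\<close>

lemma coefficient_schur_norm_le: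
  fixes T S :: "('g::group_add, 'h::complex_inner) ell2 \<Rightarrow>\<^sub>L ('g, 'h) ell2"
  assumes T: "T \<in> cblinops" and TS: "schur_rel (coefficient \<xi> \<eta>) T S"
  shows "norm S \<le> norm \<xi> * norm \<eta> * norm T"
proof (rule norm_blinfun_ell2_le)
  fix x y :: "('g, 'h) ell2" and F
  assume F: "finite F" "\<And>i. i \<notin> F \<Longrightarrow> Rep_ell2 x i = 0" "\<And>i. i \<notin> F \<Longrightarrow> Rep_ell2 y i = 0"
  define z where "z \<zeta> u r = (\<Sum>t\<in>F. single t (Rep_ell2 \<zeta> (t + r) *\<^sub>C Rep_ell2 u t))"
    for \<zeta> :: "('g, complex) ell2" and u :: "('g, 'h) ell2" and r
  have z: "((\<lambda>r. (norm (z \<zeta> u r))\<^sup>2) has_sum (norm \<zeta> * norm u)\<^sup>2) UNIV"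
    if "\<And>i. i \<notin> F \<Longrightarrow> Rep_ell2 u i = 0" for \<zeta> u
  proof -
    have u: "(norm u)\<^sup>2 = (\<Sum>t\<in>F. (norm (Rep_ell2 u t))\<^sup>2)"
      using ell2_finite_support_sum[OF F(1) that] norm_sum_single_sq[OF F(1), of "Rep_ell2 u"] by simp
    have "((\<lambda>r. \<Sum>t\<in>F. (norm (Rep_ell2 \<zeta> (t + r)))\<^sup>2 * (norm (Rep_ell2 u t))\<^sup>2)
        has_sum (\<Sum>t\<in>F. (norm \<zeta>)\<^sup>2 * (norm (Rep_ell2 u t))\<^sup>2)) UNIV"
      by (intro has_sum_finite_sum has_sum_cmult_left translate_has_sum_norm)
    thus ?thesis
      by (simp add: z_def norm_sum_single_sq[OF F(1)] norm_scaleC_inner power_mult_distrib u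
          sum_distrib_left)
  qed
  have eq: "cinner (T (z \<xi> x r)) (z \<eta> y r) = (\<Sum>t\<in>F. \<Sum>s\<in>F.
      Rep_ell2 \<xi> (t + r) * cnj (Rep_ell2 \<eta> (s + r)) *
      cinner (T (single t (Rep_ell2 x t))) (single s (Rep_ell2 y s)))" for r
    unfolding z_def blinfun.sum_right cinner_sum_left
    by (simp add: single_scaleC cblinops_scaleC[OF T] cinner_sum_right cinner_scaleC_left
        cinner_scaleC_right sum_distrib_left mult_ac)
  have "((\<lambda>r. \<Sum>t\<in>F. \<Sum>s\<in>F.
      Rep_ell2 \<xi> (t + r) * cnj (Rep_ell2 \<eta> (s + r)) *
      cinner (T (single t (Rep_ell2 x t))) (single s (Rep_ell2 y s))) has_sum
      (\<Sum>t\<in>F. \<Sum>s\<in>F. coefficient \<xi> \<eta> (s - t) *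
        cinner (T (single t (Rep_ell2 x t))) (single s (Rep_ell2 y s)))) UNIV"
    by (intro has_sum_finite_sum has_sum_cmult_left coefficient_diff_has_sum)
  also have "(\<Sum>t\<in>F. \<Sum>s\<in>F. coefficient \<xi> \<eta> (s - t) *
        cinner (T (single t (Rep_ell2 x t))) (single s (Rep_ell2 y s))) = cinner (S x) y"
    using F by (subst cinner_op_expand[of F]) (auto simp: schur_relD[OF TS])
  finally have hs: "((\<lambda>r. cinner (T (z \<xi> x r)) (z \<eta> y r)) has_sum cinner (S x) y) UNIV"
    by (simp only: eq)
  have "((\<lambda>r. (norm T * norm (z \<xi> x r))\<^sup>2) has_sum (norm T * (norm \<xi> * norm x))\<^sup>2) UNIV"
    using has_sum_cmult_right[OF z[of x \<xi>], of "(norm T)\<^sup>2"] F by (simp add: power_mult_distrib)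
  moreover have "cmod (cinner (T (z \<xi> x r)) (z \<eta> y r)) \<le> norm T * norm (z \<xi> x r) * norm (z \<eta> y r)" for r
    by (rule order_trans[OF cinner_Cauchy_Schwarz mult_right_mono[OF norm_blinfun]]) simp
  ultimately have "cmod (cinner (S x) y) \<le> (norm T * (norm \<xi> * norm x)) * (norm \<eta> * norm y)"
    using F by (intro has_sum_Cauchy_Schwarz[OF hs _ z[of y \<eta>]]) auto
  thus "cmod (cinner (S x) y) \<le> norm \<xi> * norm \<eta> * norm T * norm x * norm y"
    by (simp add: mult_ac)
qed simp

section \<open>Finitely supported functions in A(G)\<close>

lemma finite_support_is_coefficient:
  assumes "finite {x. v x \<noteq> 0}"
  shows "v \<in> fourier_algebra"
proof -
  define \<eta> where "\<eta> = (Abs_ell2 (\<lambda>x. cnj (v x)) :: ('a::group_add, complex) ell2)"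
  have \<eta>: "Rep_ell2 \<eta> x = cnj (v x)" for x
    unfolding \<eta>_def
    by (subst Abs_ell2_inverse) (auto intro: summable_on_finite_support[OF assms])
  \<comment> \<open>\<lambda>(s) carries the point mass at 0 to the point mass at s, so the
    coefficient function reads off the conjugates of the values of \<eta>.\<close>
  have "v = coefficient (single 0 1) \<eta>"
    by (simp add: fun_eq_iff coefficient_def left_regular_single cinner_single_left \<eta> cinner_complex_def)
  thus ?thesis by (simp add: coefficient_in_fourier_algebra)
qed

text \<open>If the value at s is nonzero, some r in the support of \<eta> has - s + r in the support
  of \<xi>; so s is a difference of elements of two finite sets.\<close>

lemma coefficient_finite_support:
  assumes "finite {x. Rep_ell2 \<xi> x \<noteq> 0}" "finite {x. Rep_ell2 \<eta> x \<noteq> 0}"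
  shows "finite {s. coefficient \<xi> \<eta> s \<noteq> 0}"
proof (rule finite_subset)
  let ?A = "{x. Rep_ell2 \<xi> x \<noteq> 0}" and ?B = "{x. Rep_ell2 \<eta> x \<noteq> 0}"
  show "finite ((\<lambda>(b, a). b - a) ` (?B \<times> ?A))"
    using assms by (intro finite_imageI finite_cartesian_product)
  show "{s. coefficient \<xi> \<eta> s \<noteq> 0} \<subseteq> (\<lambda>(b, a). b - a) ` (?B \<times> ?A)"
  proof
    fix s assume s: "s \<in> {s. coefficient \<xi> \<eta> s \<noteq> 0}"
    have "\<exists>r. Rep_ell2 \<xi> (- s + r) * cnj (Rep_ell2 \<eta> r) \<noteq> 0"
    proof (rule ccontr)
      assume "\<not> ?thesis"
      hence "coefficient \<xi> \<eta> s = 0"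
        unfolding coefficient_def cinner_ell2_def Rep_left_regular cinner_complex_def
        by (intro infsum_0) auto
      thus False using s by simp
    qed
    then obtain r where r: "Rep_ell2 \<xi> (- s + r) \<noteq> 0" "Rep_ell2 \<eta> r \<noteq> 0" by auto
    have "s = r - (- s + r)"
      by (simp only: diff_conv_add_uminus minus_add minus_minus) (simp flip: add.assoc)
    thus "s \<in> (\<lambda>(b, a). b - a) ` (?B \<times> ?A)"
      using r by (intro image_eqI[of _ _ "(r, - s + r)"]) auto
  qed
qed

section \<open>Representations of C*-algebras are contractive\<close>

lemma star_norm_le: "norm x \<le> norm (star x)" for x :: "'a::cstar_algebra"
proof (cases "x = 0")
  case False
  have "norm x * norm x \<le> norm (star x) * norm x"
    using norm_mult_ineq[of "star x" x] by (simp add: cstar_identity power2_eq_square)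
  thus ?thesis using False by simp
qed simp

lemma norm_star: "norm (star x) = norm x" for x :: "'a::cstar_algebra"
  using star_norm_le[of x] star_norm_le[of "star x"] by (simp add: star_star)

lemma star_scaleR: "star (r *\<^sub>R x) = r *\<^sub>R star x" for x :: "'a::cstar_algebra"
  by (metis star_scaleC complex_cnj_complex_of_real scaleC_of_real)

definition star_rep :: "('a::cstar_algebra \<Rightarrow> 'h::complex_inner \<Rightarrow>\<^sub>L 'h) \<Rightarrow> bool" where
  "star_rep \<pi> \<longleftrightarrow>
     (\<forall>a b. \<pi> (a + b) = \<pi> a + \<pi> b) \<and>
     (\<forall>c a x. \<pi> (c *\<^sub>C a) x = c *\<^sub>C \<pi> a x) \<and>
     (\<forall>a b. \<pi> (a * b) = \<pi> a o\<^sub>L \<pi> b) \<and>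
     (\<forall>a x y. cinner (\<pi> (star a) x) y = cinner x (\<pi> a y))"

context
  fixes \<pi> :: "'a::cstar_algebra \<Rightarrow> 'h::complex_inner \<Rightarrow>\<^sub>L 'h"
  assumes \<pi>: "star_rep \<pi>"
begin

lemma star_rep_scaleR: "\<pi> (r *\<^sub>R a) x = r *\<^sub>R \<pi> a x"
  using \<pi> unfolding star_rep_def by (metis scaleC_of_real)

text \<open>\<open>k = (h\<^sup>2 + k\<^sup>2) / 2\<close> says \<open>(1 - k)\<^sup>2 = 1 - h\<^sup>2\<close>, hence
  \<open>\<parallel>x\<parallel>\<^sup>2 - \<parallel>\<pi> h x\<parallel>\<^sup>2 = \<parallel>x - \<pi> k x\<parallel>\<^sup>2\<close>. The fixed point exists by contraction on a ball.\<close>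

lemma star_rep_selfadjoint_lt1:
  assumes h: "star h = h" "norm h < 1"
  shows "norm (\<pi> h x) \<le> norm x"
proof -
  define r where "r = norm (h * h)"
  have r: "0 \<le> r" "r < 1"
  proof -
    have "r \<le> norm h * norm h" unfolding r_def by (rule norm_mult_ineq)
    also have "\<dots> < 1 * 1" using h(2) by (intro mult_strict_mono') auto
    finally show "r < 1" by simp
  qed (simp add: r_def)
  \<comment> \<open>\<rho> is the smaller root of \<rho>^2 - 2 \<rho> + r = 0. Hence (r + \<rho>^2)
    / 2 = \<rho>, so the map f below sends the ball of radius \<rho> into itself; \<rho> is also a
    Lipschitz constant of f there.\<close>
  define \<rho> where "\<rho> = 1 - sqrt (1 - r)"
  have \<rho>: "0 \<le> \<rho>" "\<rho> < 1" using r by (auto simp: \<rho>_def)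
  have \<rho>2: "\<rho> * \<rho> = 2 * \<rho> - r"
    using r by (simp add: \<rho>_def algebra_simps)
  \<comment> \<open>The fixed point plays the role of 1 - sqrt(1 - h^2), in a form that makes sense
    in an algebra without unit.\<close>
  define f where "f k = (1/2) *\<^sub>R (h * h + k * k)" for k
  have "\<exists>!k. k \<in> cball 0 \<rho> \<and> f k = k"
  proof (rule Banach_fix[of _ \<rho>])
    show "complete (cball (0::'a) \<rho>)" by (simp add: complete_eq_closed)
    show "cball (0::'a) \<rho> \<noteq> {}" using \<rho> by simp
    have "f k \<in> cball 0 \<rho>" if "k \<in> cball 0 \<rho>" for k
    proof -
      have "norm (h * h + k * k) \<le> r + norm k * norm k"
        unfolding r_def by (rule order_trans[OF norm_triangle_ineq]) (simp add: norm_mult_ineq)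
      also have "norm k * norm k \<le> \<rho> * \<rho>"
        using that \<rho> by (intro mult_mono) auto
      finally show ?thesis by (simp add: f_def \<rho>2)
    qed
    thus "f ` cball 0 \<rho> \<subseteq> cball 0 \<rho>" by blast
    show "dist (f k) (f l) \<le> \<rho> * dist k l" if "k \<in> cball 0 \<rho>" "l \<in> cball 0 \<rho>" for k l
    proof -
      have "f k - f l = (1/2) *\<^sub>R (k * (k - l) + (k - l) * l)"
        by (simp add: f_def algebra_simps)
      hence "norm (f k - f l) \<le> (1/2) * (norm k * norm (k - l) + norm (k - l) * norm l)"
        by (simp add: order_trans[OF norm_triangle_ineq add_mono[OF norm_mult_ineq norm_mult_ineq]])
      also have "\<dots> \<le> (1/2) * (\<rho> * norm (k - l) + norm (k - l) * \<rho>)"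
        using that \<rho> by (intro mult_left_mono add_mono mult_right_mono) auto
      finally show ?thesis by (simp add: dist_norm mult.commute)
    qed
  qed (use \<rho> in auto)
  then obtain k where k: "k \<in> cball 0 \<rho>" "f k = k" and uniq: "\<And>l. l \<in> cball 0 \<rho> \<Longrightarrow> f l = l \<Longrightarrow> l = k"
    by blast
  \<comment> \<open>As h is self-adjoint, f commutes with \<open>star\<close>. So
    \<open>star k\<close> is a fixed point in the same ball, and uniqueness makes k
    self-adjoint.\<close>
  have "f (star k) = star k"
    using arg_cong[OF k(2), of star] by (simp add: f_def star_scaleR star_add star_mult h)
  hence sk: "star k = k"
    using uniq[of "star k"] k(1) by (simp add: norm_star)
  have H: "inner (\<pi> h x) y = inner x (\<pi> h y)" for x y
    using \<pi> h(1) unfolding star_rep_def inner_eq_Re_cinner by metis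
  have K: "inner (\<pi> k x) y = inner x (\<pi> k y)" for x y
    using \<pi> sk unfolding star_rep_def inner_eq_Re_cinner by metis
  have "\<pi> k x = \<pi> ((1/2) *\<^sub>R (h * h + k * k)) x"
    using k(2) by (simp add: f_def)
  also have "\<dots> = (1/2) *\<^sub>R (\<pi> h (\<pi> h x) + \<pi> k (\<pi> k x))"
    unfolding star_rep_scaleR using \<pi> by (simp add: star_rep_def blinfun.add_left)
  finally have "2 *\<^sub>R \<pi> k x = 2 *\<^sub>R ((1/2) *\<^sub>R (\<pi> h (\<pi> h x) + \<pi> k (\<pi> k x)))"
    by (rule arg_cong)
  also have "\<dots> = \<pi> h (\<pi> h x) + \<pi> k (\<pi> k x)" by simp
  finally have "inner x (2 *\<^sub>R \<pi> k x) = inner x (\<pi> h (\<pi> h x) + \<pi> k (\<pi> k x))"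
    by (rule arg_cong)
  hence "2 * inner x (\<pi> k x) = inner x (\<pi> h (\<pi> h x)) + inner x (\<pi> k (\<pi> k x))"
    by (simp only: inner_scaleR_right inner_add_right)
  hence "inner (x - \<pi> k x) (x - \<pi> k x) = inner x x - inner (\<pi> h x) (\<pi> h x)"
    by (simp add: inner_diff_left inner_diff_right K H)
  hence "(norm (\<pi> h x))\<^sup>2 \<le> (norm x)\<^sup>2"
    unfolding power2_norm_eq_inner by (metis diff_ge_0_iff_ge inner_ge_zero)
  thus ?thesis by (rule power2_le_imp_le) simp
qed

lemma star_rep_selfadjoint_le:
  assumes h: "star h = h"
  shows "norm (\<pi> h x) \<le> norm h * norm x"
proof (cases "x = 0")
  case False
  have "norm (\<pi> h x) / norm x \<le> norm h"
  proof (rule dense_ge)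
    fix M assume M: "norm h < M"
    have M0: "M > 0" using M norm_ge_zero[of h] by linarith
    have "norm (\<pi> ((1/M) *\<^sub>R h) x) \<le> norm x"
      by (rule star_rep_selfadjoint_lt1) (use M M0 h in \<open>auto simp: star_scaleR\<close>)
    thus "norm (\<pi> h x) / norm x \<le> M"
      using M0 False by (simp add: star_rep_scaleR field_simps)
  qed
  thus ?thesis using False by (simp add: field_simps)
qed (simp add: blinfun.zero_right)

text \<open>||\<pi>(a) x||^2 is the inner product of \<pi>(\<open>star a * a\<close>) x with x. This
  reduces the estimate to a self-adjoint element, whose norm is ||a||^2 by the C*-identity.\<close>

lemma star_rep_norm_le: "norm (\<pi> a) \<le> norm a"
proof (rule norm_blinfun_bound)
  fix x
  have "complex_of_real ((norm (\<pi> a x))\<^sup>2) = cinner (\<pi> (star a * a) x) x"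
    using \<pi> unfolding star_rep_def cinner_self[symmetric] by simp
  hence "(norm (\<pi> a x))\<^sup>2 = cmod (cinner (\<pi> (star a * a) x) x)"
    by (metis abs_of_nonneg norm_of_real zero_le_power2)
  also have "\<dots> \<le> norm (\<pi> (star a * a) x) * norm x"
    by (rule cinner_Cauchy_Schwarz)
  also have "\<dots> \<le> norm (star a * a) * norm x * norm x"
    by (intro mult_right_mono star_rep_selfadjoint_le) (auto simp: star_mult star_star)
  also have "\<dots> = (norm a * norm x)\<^sup>2"
    by (simp add: cstar_identity power2_eq_square mult_ac)
  finally show "norm (\<pi> a x) \<le> norm a * norm x"
    by (rule power2_le_imp_le) simp
qed simp

end

section \<open>The reduced crossed product\<close>

lemma cblinops_0: "0 \<in> cblinops"
  by (rule cblinopsI) simp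

lemma cblinops_plus: "S \<in> cblinops \<Longrightarrow> T \<in> cblinops \<Longrightarrow> S + T \<in> cblinops"
  by (rule cblinopsI) (simp add: blinfun.add_left cblinops_scaleC scaleC_add_right)

lemma cblinops_minus: "S \<in> cblinops \<Longrightarrow> T \<in> cblinops \<Longrightarrow> S - T \<in> cblinops"
  by (rule cblinopsI) (simp add: blinfun.diff_left cblinops_scaleC scaleC_diff_right)

lemma cblinops_sum: "(\<And>i. i \<in> I \<Longrightarrow> T i \<in> cblinops) \<Longrightarrow> (\<Sum>i\<in>I. T i) \<in> cblinops"
  by (induction I rule: infinite_finite_induct) (auto intro: cblinops_0 cblinops_plus)

lemma cblinops_compose: "S \<in> cblinops \<Longrightarrow> T \<in> cblinops \<Longrightarrow> S o\<^sub>L T \<in> cblinops"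
  by (rule cblinopsI) (simp add: cblinops_scaleC)

locale represented_system =
  fixes \<alpha> :: "'g::group_add \<Rightarrow> 'a::cstar_algebra \<Rightarrow> 'a"
    and \<sigma> :: "'a \<Rightarrow> 'h::chilbert_space \<Rightarrow>\<^sub>L 'h"
  assumes system: "cstar_dynamical_system \<alpha>"
    and rep: "faithful_representation \<sigma>"
begin

lemma star_rep_twisted: "star_rep (\<lambda>a. \<sigma> (\<alpha> s a))"
  using system rep
  unfolding star_rep_def cstar_dynamical_system_def star_automorphism_def clinear_map_def
    faithful_representation_def by metis

lemma twisted_scaleC: "\<sigma> (\<alpha> s (c *\<^sub>C a)) x = c *\<^sub>C \<sigma> (\<alpha> s a) x"
  and twisted_add: "\<sigma> (\<alpha> s (a + b)) = \<sigma> (\<alpha> s a) + \<sigma> (\<alpha> s b)"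
  using star_rep_twisted unfolding star_rep_def by blast+

lemma twisted_0 [simp]: "\<sigma> (\<alpha> s 0) = 0"
  using twisted_add[of s 0 0] by simp

lemma norm_twisted_le: "norm (\<sigma> (\<alpha> s a)) \<le> norm a"
  by (rule star_rep_norm_le[OF star_rep_twisted])

lemma twisted_in_cblinops: "\<sigma> a \<in> cblinops"
  using rep unfolding faithful_representation_def by blast

text \<open>Contractivity of the representations \<sigma> \<circ> \<alpha>(- t) makes the family
  square-summable and the map bounded by the norm of a; only then do \<open>Abs_ell2\<close> and
  \<open>Blinfun\<close> represent what they are given.\<close>

lemma Rep_crossed_embed:
  "Rep_ell2 (crossed_embed \<sigma> \<alpha> a \<xi>) t = \<sigma> (\<alpha> (- t) a) (Rep_ell2 \<xi> t)"
proof -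
  let ?D = "\<lambda>\<xi> t. \<sigma> (\<alpha> (- t) a) (Rep_ell2 \<xi> t)"
  have le: "(norm (?D \<xi> t))\<^sup>2 \<le> (norm a)\<^sup>2 * (norm (Rep_ell2 \<xi> t))\<^sup>2" for \<xi> :: "('g, 'h) ell2" and t
  proof -
    have "norm (?D \<xi> t) \<le> norm a * norm (Rep_ell2 \<xi> t)"
      by (rule order_trans[OF norm_blinfun mult_right_mono[OF norm_twisted_le]]) simp
    thus ?thesis by (simp add: power_mono flip: power_mult_distrib)
  qed
  have "(\<lambda>t. (norm (?D \<xi> t))\<^sup>2) summable_on UNIV" for \<xi> :: "('g, 'h) ell2"
    by (rule summable_on_comparison_test[OF summable_on_cmult_right[OF Rep_ell2_summable[of \<xi>]]])
       (auto intro: le)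
  hence R: "Rep_ell2 (Abs_ell2 (?D \<xi>)) = ?D \<xi>" for \<xi> :: "('g, 'h) ell2"
    by (simp add: Abs_ell2_inverse)
  have "bounded_linear (\<lambda>\<xi> :: ('g, 'h) ell2. Abs_ell2 (?D \<xi>))"
  proof (rule bounded_linear_intro[where K = "norm a"])
    show "norm (Abs_ell2 (?D \<xi>)) \<le> norm \<xi> * norm a" for \<xi> :: "('g, 'h) ell2"
    proof (rule power2_le_imp_le)
      have "(norm (Abs_ell2 (?D \<xi>)))\<^sup>2 \<le> (\<Sum>\<^sub>\<infinity>t. (norm a)\<^sup>2 * (norm (Rep_ell2 \<xi> t))\<^sup>2)"
        unfolding norm_ell2_sq
        by (intro infsum_mono Rep_ell2_summable summable_on_cmult_right) (simp only: R le)
      also have "\<dots> = (norm \<xi> * norm a)\<^sup>2"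
        by (simp add: infsum_cmult_right' power_mult_distrib norm_ell2_sq)
      finally show "(norm (Abs_ell2 (?D \<xi>)))\<^sup>2 \<le> (norm \<xi> * norm a)\<^sup>2" .
    qed simp
    show "Abs_ell2 (?D (x + y)) = Abs_ell2 (?D x) + Abs_ell2 (?D y)" for x y :: "('g, 'h) ell2"
    proof (rule ell2_eqI)
      show "Rep_ell2 (Abs_ell2 (?D (x + y))) t = Rep_ell2 (Abs_ell2 (?D x) + Abs_ell2 (?D y)) t" for t
        unfolding R[of "x + y"] unfolding Rep_plus_ell2 R by (rule blinfun.add_right)
    qed
    show "Abs_ell2 (?D (r *\<^sub>R x)) = r *\<^sub>R Abs_ell2 (?D x)" for r and x :: "('g, 'h) ell2"
    proof (rule ell2_eqI)
      show "Rep_ell2 (Abs_ell2 (?D (r *\<^sub>R x))) t = Rep_ell2 (r *\<^sub>R Abs_ell2 (?D x)) t" for t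
        unfolding R[of "r *\<^sub>R x"] unfolding Rep_scaleR_ell2 R by (rule blinfun.scaleR_right)
    qed
  qed
  thus ?thesis
    unfolding crossed_embed_def by (simp add: bounded_linear_Blinfun_apply R)
qed

lemma crossed_embed_single: "crossed_embed \<sigma> \<alpha> a (single t h) = single t (\<sigma> (\<alpha> (- t) a) h)"
  by (rule ell2_eqI) (auto simp: Rep_crossed_embed Rep_single blinfun.zero_right)

lemma crossed_embed_in_cblinops: "crossed_embed \<sigma> \<alpha> a \<in> cblinops"
  by (intro cblinopsI ell2_eqI)
     (simp add: Rep_crossed_embed Rep_ell2_simps cblinops_scaleC[OF twisted_in_cblinops])

lemma crossed_sum_in_cblinops: "crossed_sum \<sigma> \<alpha> a \<in> cblinops"
  unfolding crossed_sum_def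
  by (intro cblinops_sum cblinops_compose crossed_embed_in_cblinops left_regular_in_cblinops)

text \<open>Only the summand x = s - t carries the t-th coordinate to the s-th. Each entry involves
  the single coefficient a (s - t), which turns multiplication of the coefficients by \<phi> into
  Schur multiplication.\<close>

lemma crossed_sum_entry:
  assumes "finite {x. a x \<noteq> 0}"
  shows "cinner (crossed_sum \<sigma> \<alpha> a (single t h)) (single s k) = cinner (\<sigma> (\<alpha> (- s) (a (s - t))) h) k"
proof -
  have "cinner (crossed_sum \<sigma> \<alpha> a (single t h)) (single s k)
      = (\<Sum>x | a x \<noteq> 0. cinner (single (x + t) (\<sigma> (\<alpha> (- (x + t)) (a x)) h)) (single s k))"
    by (simp add: crossed_sum_def blinfun.sum_left cinner_sum_left left_regular_single
        crossed_embed_single)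
  also have "\<dots> = (\<Sum>x | a x \<noteq> 0. if x = s - t then cinner (\<sigma> (\<alpha> (- s) (a x)) h) k else 0)"
    by (intro sum.cong refl) (auto simp: cinner_single_right Rep_single eq_diff_eq)
  also have "\<dots> = cinner (\<sigma> (\<alpha> (- s) (a (s - t))) h) k"
    using assms by (simp add: sum.delta)
  finally show ?thesis .
qed

lemma crossed_sum_schur_rel:
  assumes "finite {x. a x \<noteq> 0}"
  shows "schur_rel \<phi> (crossed_sum \<sigma> \<alpha> a) (crossed_sum \<sigma> \<alpha> (\<lambda>x. \<phi> x *\<^sub>C a x))"
proof -
  have "finite {x. \<phi> x *\<^sub>C a x \<noteq> 0}"
    by (rule finite_subset[OF _ assms]) auto
  thus ?thesis
    by (simp add: schur_rel_def crossed_sum_entry assms twisted_scaleC cinner_scaleC_left)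
qed

lemma finite_support_add:
  assumes "finite {x. a x \<noteq> 0}" "finite {x. b x \<noteq> 0}"
  shows "finite {x. a x + b x \<noteq> (0::'b::group_add)}"
  by (rule finite_subset[OF _ finite_UnI[OF assms]]) auto

text \<open>Cancellation can make the support of the sum smaller than the union of the supports, so
  the two sides are compared entry by entry.\<close>

lemma crossed_sum_add:
  assumes "finite {x. a x \<noteq> 0}" "finite {x. b x \<noteq> 0}"
  shows "crossed_sum \<sigma> \<alpha> (\<lambda>x. a x + b x) = crossed_sum \<sigma> \<alpha> a + crossed_sum \<sigma> \<alpha> b"
  by (rule blinfun_ell2_eqI)
     (simp add: crossed_sum_entry[OF finite_support_add[OF assms]] crossed_sum_entry assms blinfun.add_left cinner_add_left
       twisted_add)

lemma crossed_sum_scaleC: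
  assumes "finite {x. a x \<noteq> 0}"
  shows "crossed_sum \<sigma> \<alpha> (\<lambda>x. c *\<^sub>C a x) = scaleC_op c o\<^sub>L crossed_sum \<sigma> \<alpha> a"
proof -
  have "finite {x. c *\<^sub>C a x \<noteq> 0}"
    by (rule finite_subset[OF _ assms]) auto
  thus ?thesis
    by (intro blinfun_ell2_eqI)
       (simp add: crossed_sum_entry assms twisted_scaleC cinner_scaleC_left)
qed

lemma subspace_crossed_sums: "subspace {crossed_sum \<sigma> \<alpha> a | a. finite {x. a x \<noteq> 0}}"
proof (rule subspaceI)
  show "0 \<in> {crossed_sum \<sigma> \<alpha> a | a. finite {x. a x \<noteq> 0}}"
    by (auto intro!: exI[of _ "\<lambda>_. 0"] simp: crossed_sum_def)
next
  fix S T assume "S \<in> {crossed_sum \<sigma> \<alpha> a | a. finite {x. a x \<noteq> 0}}"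
    "T \<in> {crossed_sum \<sigma> \<alpha> a | a. finite {x. a x \<noteq> 0}}"
  then obtain a b where ab: "S = crossed_sum \<sigma> \<alpha> a" "finite {x. a x \<noteq> 0}"
      "T = crossed_sum \<sigma> \<alpha> b" "finite {x. b x \<noteq> 0}" by blast
  show "S + T \<in> {crossed_sum \<sigma> \<alpha> a | a. finite {x. a x \<noteq> 0}}"
    using ab finite_support_add[of a b]
    by (auto intro!: exI[of _ "\<lambda>x. a x + b x"] simp: crossed_sum_add)
next
  fix r :: real and T assume "T \<in> {crossed_sum \<sigma> \<alpha> a | a. finite {x. a x \<noteq> 0}}"
  then obtain a where a: "T = crossed_sum \<sigma> \<alpha> a" "finite {x. a x \<noteq> 0}" by blast
  have "r *\<^sub>R T = crossed_sum \<sigma> \<alpha> (\<lambda>x. complex_of_real r *\<^sub>C a x)"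
    unfolding crossed_sum_scaleC[OF a(2)] a(1)
    by (rule blinfun_eqI) (simp add: blinfun.scaleR_left scaleC_of_real)
  moreover have "finite {x. complex_of_real r *\<^sub>C a x \<noteq> 0}"
    by (rule finite_subset[OF _ a(2)]) auto
  ultimately show "r *\<^sub>R T \<in> {crossed_sum \<sigma> \<alpha> a | a. finite {x. a x \<noteq> 0}}" by blast
qed

lemma subspace_reduced_crossed_product: "subspace (reduced_crossed_product \<sigma> \<alpha>)"
  unfolding reduced_crossed_product_def by (intro subspace_closure subspace_crossed_sums)

lemma reduced_crossed_product_in_cblinops: "T \<in> reduced_crossed_product \<sigma> \<alpha> \<Longrightarrow> T \<in> cblinops"
proof -
  have "reduced_crossed_product \<sigma> \<alpha> \<subseteq> cblinops"
    unfolding reduced_crossed_product_def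
    by (rule closure_minimal[OF _ closed_cblinops]) (auto simp: crossed_sum_in_cblinops)
  thus "T \<in> reduced_crossed_product \<sigma> \<alpha> \<Longrightarrow> T \<in> cblinops" by blast
qed

lemma crossed_sum_in_reduced:
  "finite {x. a x \<noteq> 0} \<Longrightarrow> crossed_sum \<sigma> \<alpha> a \<in> reduced_crossed_product \<sigma> \<alpha>"
  unfolding reduced_crossed_product_def by (rule closure_subset[THEN subsetD]) blast

lemma reduced_crossed_product_seq:
  assumes "T \<in> reduced_crossed_product \<sigma> \<alpha>"
  obtains a where "\<And>n::nat. finite {x. a n x \<noteq> 0}" "(\<lambda>n. crossed_sum \<sigma> \<alpha> (a n)) \<longlonglongrightarrow> T"
proof -
  obtain f where f: "\<And>n::nat. f n \<in> {crossed_sum \<sigma> \<alpha> a | a. finite {x. a x \<noteq> 0}}" "f \<longlonglongrightarrow> T"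
    using assms unfolding reduced_crossed_product_def closure_sequential by blast
  have "\<forall>n. \<exists>a. f n = crossed_sum \<sigma> \<alpha> a \<and> finite {x. a x \<noteq> 0}"
    using f(1) by blast
  then obtain a where "\<And>n. f n = crossed_sum \<sigma> \<alpha> (a n)" "\<And>n. finite {x. a n x \<noteq> 0}"
    unfolding choice_iff by blast
  moreover from this have "f = (\<lambda>n. crossed_sum \<sigma> \<alpha> (a n))" by blast
  ultimately show ?thesis using f(2) that by blast
qed

text \<open>The bound for coefficient functions makes the multiplied finite sums Cauchy, and their
  limit is the Schur product of T with v. So Schur multiplication by v acts on the whole crossed
  product and preserves it.\<close>

lemma schur_tendsto:
  assumes v: "v \<in> fourier_algebra" and a: "\<And>n::nat. finite {x. a n x \<noteq> 0}"
    and T: "(\<lambda>n. crossed_sum \<sigma> \<alpha> (a n)) \<longlonglongrightarrow> T"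
  obtains S where "(\<lambda>n. crossed_sum \<sigma> \<alpha> (\<lambda>x. v x *\<^sub>C a n x)) \<longlonglongrightarrow> S"
    "S \<in> reduced_crossed_product \<sigma> \<alpha>" "schur_rel v T S"
proof -
  obtain \<xi> \<eta> where v: "v = coefficient \<xi> \<eta>"
    using v by (auto simp: fourier_algebra_def)
  let ?T = "\<lambda>n. crossed_sum \<sigma> \<alpha> (a n)"
  let ?S = "\<lambda>n. crossed_sum \<sigma> \<alpha> (\<lambda>x. v x *\<^sub>C a n x)"
  have rel: "schur_rel v (?T n) (?S n)" for n
    by (rule crossed_sum_schur_rel[OF a])
  have le: "norm (?S m - ?S n) \<le> norm \<xi> * norm \<eta> * norm (?T m - ?T n)" for m n
    by (rule coefficient_schur_norm_le)
       (auto intro!: cblinops_minus crossed_sum_in_cblinops schur_rel_diff rel simp flip: v)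
  have "Cauchy ?S"
  proof (rule metric_CauchyI)
    fix e :: real assume e: "e > 0"
    \<comment> \<open>Adding 1 keeps C positive when \<xi> or \<eta> is 0.\<close>
    define C where "C = norm \<xi> * norm \<eta> + 1"
    have C: "C > 0" by (simp add: C_def add_nonneg_pos)
    obtain M where M: "\<And>m n. m \<ge> M \<Longrightarrow> n \<ge> M \<Longrightarrow> norm (?T m - ?T n) < e / C"
      using metric_CauchyD[OF LIMSEQ_imp_Cauchy[OF T], of "e / C"] e C unfolding dist_norm by auto
    have "dist (?S m) (?S n) < e" if "m \<ge> M" "n \<ge> M" for m n
    proof -
      have "norm (?S m - ?S n) \<le> C * norm (?T m - ?T n)"
        using le[of m n] norm_ge_zero[of "?T m - ?T n"] unfolding C_def distrib_right by linarith
      also have "\<dots> < C * (e / C)"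
        using M[OF that] C by (intro mult_strict_left_mono)
      finally show ?thesis using C by (simp add: dist_norm)
    qed
    thus "\<exists>M. \<forall>m\<ge>M. \<forall>n\<ge>M. dist (?S m) (?S n) < e" by blast
  qed
  then obtain S where S: "?S \<longlonglongrightarrow> S"
    by (auto simp: Cauchy_convergent_iff convergent_def)
  have "finite {x. v x *\<^sub>C a n x \<noteq> 0}" for n
    by (rule finite_subset[OF _ a[of n]]) auto
  hence "?S n \<in> reduced_crossed_product \<sigma> \<alpha>" for n
    by (rule crossed_sum_in_reduced)
  hence "S \<in> reduced_crossed_product \<sigma> \<alpha>"
    using S closed_sequentially[of "reduced_crossed_product \<sigma> \<alpha>" ?S S]
    unfolding reduced_crossed_product_def by simp
  thus ?thesis
    using that S schur_rel_limit[OF T S rel] by blast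
qed

lemma schur_exists:
  assumes "v \<in> fourier_algebra" "T \<in> reduced_crossed_product \<sigma> \<alpha>"
  obtains S where "S \<in> reduced_crossed_product \<sigma> \<alpha>" "schur_rel v T S"
proof -
  obtain a where "\<And>n::nat. finite {x. a n x \<noteq> 0}" "(\<lambda>n. crossed_sum \<sigma> \<alpha> (a n)) \<longlonglongrightarrow> T"
    using reduced_crossed_product_seq[OF assms(2)] by blast
  from schur_tendsto[OF assms(1) this] that show ?thesis by blast
qed

end

section \<open>Separation of a point from a subspace\<close>

definition sublinear :: "('a::real_vector \<Rightarrow> real) \<Rightarrow> bool" where
  "sublinear q \<longleftrightarrow> (\<forall>x y. q (x + y) \<le> q x + q y) \<and> (\<forall>r>0. \<forall>x. q (r *\<^sub>R x) = r * q x)"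

lemma sublinearI:
  assumes "\<And>x y. q (x + y) \<le> q x + q y" "\<And>r x. r > 0 \<Longrightarrow> q (r *\<^sub>R x) \<le> r * q x"
  shows "sublinear q"
  unfolding sublinear_def
proof (intro conjI allI impI antisym assms)
  fix r :: real and x assume r: "r > 0"
  have "r * q x = r * q (inverse r *\<^sub>R (r *\<^sub>R x))" using r by simp
  also have "\<dots> \<le> r * (inverse r * q (r *\<^sub>R x))"
    by (intro mult_left_mono assms(2)) (use r in auto)
  also have "\<dots> = q (r *\<^sub>R x)" using r by simp
  finally show "r * q x \<le> q (r *\<^sub>R x)" .
qed

lemma sublinear_0: "sublinear q \<Longrightarrow> q 0 = 0"
  unfolding sublinear_def by (metis less_numeral_extra(1) mult_cancel_right1 scaleR_zero_right
      zero_less_numeral mult_cancel_right numeral_eq_one_iff semiring_norm(85))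

lemma sublinear_scale: "sublinear q \<Longrightarrow> 0 \<le> r \<Longrightarrow> q (r *\<^sub>R x) = r * q x"
  using sublinear_0[of q] by (cases "r = 0") (auto simp: sublinear_def)

lemma sublinear_add: "sublinear q \<Longrightarrow> q (x + y) \<le> q x + q y"
  by (simp add: sublinear_def)

lemma sublinear_lower: "sublinear q \<Longrightarrow> - q (- x) \<le> q x"
  using sublinear_add[of q x "- x"] by (simp add: sublinear_0)

text \<open>q' is the infimum of q(x + t y) - t q(y) over t >= 0. The choice t = 0 gives q' <= q,
  and t = 1 at the point - y gives the last inequality. It serves twice: a minimal sublinear
  functional coincides with its q' and is therefore odd; and in the separation of a point it forces
  the linear functional to be nonzero there.\<close>

lemma sublinear_directional:
  assumes q: "sublinear q"
  obtains q' where "sublinear q'" "\<And>x. q' x \<le> q x" "q' (- y) \<le> - q y"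
proof
  let ?g = "\<lambda>x t. q (x + t *\<^sub>R y) - t * q y"
  define q' where "q' x = (INF t\<in>{0..}. ?g x t)" for x
  have "- q (- x) \<le> ?g x t" if "t \<ge> 0" for x t
    using sublinear_add[OF q, of "x + t *\<^sub>R y" "- x"] sublinear_scale[OF q that, of y] by simp
  hence bdd: "bdd_below (?g x ` {0..})" for x
    by (intro bdd_belowI2) auto
  have le: "q' x \<le> ?g x t" if "t \<ge> 0" for x t
    unfolding q'_def by (rule cINF_lower[OF bdd]) (use that in simp)
  have ge: "C \<le> q' x" if "\<And>t. t \<ge> 0 \<Longrightarrow> C \<le> ?g x t" for C x
    unfolding q'_def by (rule cINF_greatest) (use that in auto)
  show "q' x \<le> q x" for x
    using le[of 0 x] by simp
  show "q' (- y) \<le> - q y"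
    using le[of 1 "- y"] by (simp add: sublinear_0[OF q])
  show "sublinear q'"
  proof (rule sublinearI)
    fix x z
    have step: "q' (x + z) \<le> ?g x t + ?g z s" if "t \<ge> 0" "s \<ge> 0" for t s
    proof -
      have "q' (x + z) \<le> ?g (x + z) (t + s)" using that by (intro le) simp
      also have "x + z + (t + s) *\<^sub>R y = (x + t *\<^sub>R y) + (z + s *\<^sub>R y)" by (simp add: algebra_simps)
      finally show ?thesis
        using sublinear_add[OF q, of "x + t *\<^sub>R y" "z + s *\<^sub>R y"] by (simp add: algebra_simps)
    qed
    have "q' (x + z) - ?g z s \<le> q' x" if "s \<ge> 0" for s
      by (rule ge) (use step that in \<open>smt (verit)\<close>)
    hence "q' (x + z) - q' x \<le> ?g z s" if "s \<ge> 0" for s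
      using that by (smt (verit))
    hence "q' (x + z) - q' x \<le> q' z" by (rule ge)
    thus "q' (x + z) \<le> q' x + q' z" by simp
  next
    fix r :: real and x assume r: "r > 0"
    have "q' (r *\<^sub>R x) / r \<le> q' x"
    proof (rule ge)
      fix t :: real assume t: "t \<ge> 0"
      have "q' (r *\<^sub>R x) \<le> ?g (r *\<^sub>R x) (r * t)" using r t by (intro le) simp
      also have "r *\<^sub>R x + (r * t) *\<^sub>R y = r *\<^sub>R (x + t *\<^sub>R y)" by (simp add: scaleR_add_right)
      also have "q (r *\<^sub>R (x + t *\<^sub>R y)) = r * q (x + t *\<^sub>R y)" using r by (simp add: sublinear_scale[OF q])
      finally show "q' (r *\<^sub>R x) / r \<le> ?g x t" using r by (simp add: field_simps)
    qed
    thus "q' (r *\<^sub>R x) \<le> r * q' x" using r by (simp add: field_simps)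
  qed
qed

text \<open>Hahn--Banach: a minimal sublinear functional is linear.\<close>

lemma sublinear_dominates_linear:
  fixes p :: "'a::real_vector \<Rightarrow> real"
  assumes p: "sublinear p"
  obtains f where "linear f" "\<And>x. f x \<le> p x"
proof -
  define A where "A = {q. sublinear q \<and> (\<forall>x. q x \<le> p x)}"
  \<comment> \<open>The order is reversed, so the maximal element of Zorn's lemma is a minimal
    sublinear functional below p.\<close>
  have "\<exists>m\<in>A. \<forall>a\<in>A. a \<le> m \<longrightarrow> a = m"
  proof (rule predicate_Zorn)
    show "partial_order_on A (relation_of (\<lambda>m a. a \<le> m) A)"
      by (rule partial_order_on_relation_ofI) auto
    fix C assume "C \<in> Chains (relation_of (\<lambda>m a. a \<le> m) A)"
    hence C: "\<And>a. a \<in> C \<Longrightarrow> a \<in> A" "\<And>a b. a \<in> C \<Longrightarrow> b \<in> C \<Longrightarrow> a \<le> b \<or> b \<le> a"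
      unfolding Chains_def relation_of_def by auto
    show "\<exists>u\<in>A. \<forall>a\<in>C. u \<le> a"
    proof (cases "C = {}")
      case True
      thus ?thesis using p unfolding A_def by auto
    next
      case False
      \<comment> \<open>The pointwise infimum is finite because each q in the chain satisfies - p (-
        x) <= q x. For subadditivity, two members of the chain are comparable, and the smaller one
        can be used in both terms.\<close>
      define u where "u x = (INF q\<in>C. q x)" for x
      have "- p (- x) \<le> q x" if "q \<in> C" for q x
        using C(1)[OF that] sublinear_lower[of q x] unfolding A_def by (smt (verit) mem_Collect_eq)
      hence bdd: "bdd_below ((\<lambda>q. q x) ` C)" for x by (intro bdd_belowI2) auto
      have le: "u x \<le> q x" if "q \<in> C" for q x
        unfolding u_def by (rule cINF_lower[OF bdd that])
      have ge: "c \<le> u x" if "\<And>q. q \<in> C \<Longrightarrow> c \<le> q x" for c x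
        unfolding u_def by (rule cINF_greatest[OF False]) (use that in auto)
      have sub: "sublinear q" if "q \<in> C" for q using C(1)[OF that] by (simp add: A_def)
      have "sublinear u"
      proof (rule sublinearI)
        fix x y
        have step: "u (x + y) \<le> q1 x + q2 y" if "q1 \<in> C" "q2 \<in> C" for q1 q2
          using C(2)[OF that]
        proof
          assume "q1 \<le> q2"
          thus ?thesis
            using le[OF that(1), of "x + y"] sublinear_add[OF sub[OF that(1)], of x y] le_funD[of q1 q2 y]
            by linarith
        next
          assume "q2 \<le> q1"
          thus ?thesis
            using le[OF that(2), of "x + y"] sublinear_add[OF sub[OF that(2)], of x y] le_funD[of q2 q1 x]
            by linarith
        qed
        have "u (x + y) - q2 y \<le> u x" if "q2 \<in> C" for q2
          by (rule ge) (use step that in \<open>simp add: diff_le_eq\<close>)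
        hence "u (x + y) - u x \<le> u y" by (intro ge) (simp add: diff_le_eq add.commute)
        thus "u (x + y) \<le> u x + u y" by simp
      next
        fix r :: real and x assume r: "r > 0"
        have "u (r *\<^sub>R x) / r \<le> u x"
        proof (rule ge)
          fix q assume "q \<in> C"
          thus "u (r *\<^sub>R x) / r \<le> q x"
            using le[of q "r *\<^sub>R x"] sublinear_scale[OF sub, of q r x] r by (simp add: field_simps)
        qed
        thus "u (r *\<^sub>R x) \<le> r * u x" using r by (simp add: field_simps)
      qed
      moreover have "u x \<le> p x" for x
        using False le C(1) unfolding A_def by (metis (mono_tags, lifting) ex_in_conv mem_Collect_eq order_trans)
      ultimately show ?thesis
        using le unfolding A_def by (auto intro!: bexI[of _ u] le_funI)
    qed
  qed
  then obtain q where q: "sublinear q" "\<And>x. q x \<le> p x" and min: "\<And>a. a \<in> A \<Longrightarrow> a \<le> q \<Longrightarrow> a = q"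
    unfolding A_def by blast
  have neg: "q (- y) = - q y" for y
  proof -
    obtain q' where q': "sublinear q'" "\<And>x. q' x \<le> q x" "q' (- y) \<le> - q y"
      using sublinear_directional[OF q(1)] by blast
    have "q' = q"
      using q' q(2) by (intro min) (auto simp: A_def intro: le_funI order_trans)
    thus ?thesis using q'(3) sublinear_lower[OF q(1), of y] by simp
  qed
  have "linear q"
  proof (rule linearI)
    show "q (x + y) = q x + q y" for x y
      using sublinear_add[OF q(1), of x y] sublinear_add[OF q(1), of "x + y" "- y"] by (simp add: neg)
    show "q (r *\<^sub>R x) = r *\<^sub>R q x" for r x
      using sublinear_scale[OF q(1), of r x] sublinear_scale[OF q(1), of "- r" x] neg[of "r *\<^sub>R x"]
      by (cases "r \<ge> 0") auto
  qed
  thus ?thesis using that q(2) by blast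
qed

text \<open>The distance p to S is sublinear, vanishes on S, is at most the norm and is positive at
  z. A linear f below p is bounded and zero on S; first lowering p in the direction z forces f z >=
  p z > 0.\<close>

lemma subspace_separation:
  fixes S :: "'a::real_normed_vector set"
  assumes S: "subspace S" and z: "z \<notin> closure S"
  shows "\<exists>f :: 'a \<Rightarrow> real. bounded_linear f \<and> (\<forall>x\<in>S. f x = 0) \<and> f z \<noteq> 0"
proof -
  have ne: "S \<noteq> {}" and S0: "0 \<in> S" using S subspace_0 by auto
  define p where "p x = infdist x S" for x
  have le: "p x \<le> norm (x - s)" if "s \<in> S" for x s
    unfolding p_def using infdist_le[OF that, of x] by (simp add: dist_norm)
  have ge: "c \<le> p x" if "\<And>s. s \<in> S \<Longrightarrow> c \<le> norm (x - s)" for c x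
    unfolding p_def infdist_def using ne that by (auto intro!: cINF_greatest simp: dist_norm)
  have p: "sublinear p"
  proof (rule sublinearI)
    fix x y
    have step: "p (x + y) \<le> norm (x - s) + norm (y - t)" if "s \<in> S" "t \<in> S" for s t
    proof -
      have "p (x + y) \<le> norm (x + y - (s + t))" by (intro le subspace_add S that)
      also have "\<dots> \<le> norm (x - s) + norm (y - t)" by (metis add_diff_add norm_triangle_ineq)
      finally show ?thesis .
    qed
    have "p (x + y) - norm (y - t) \<le> p x" if "t \<in> S" for t
      by (rule ge) (use step that in \<open>simp add: diff_le_eq\<close>)
    hence "p (x + y) - p x \<le> p y" by (intro ge) (simp add: diff_le_eq add.commute)
    thus "p (x + y) \<le> p x + p y" by simp
  next
    fix r :: real and x assume r: "r > 0"
    have "p (r *\<^sub>R x) / r \<le> p x"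
    proof (rule ge)
      fix s assume "s \<in> S"
      hence "p (r *\<^sub>R x) \<le> norm (r *\<^sub>R x - r *\<^sub>R s)" by (intro le subspace_scale S)
      also have "\<dots> = r * norm (x - s)" using r by (simp flip: scaleR_diff_right)
      finally show "p (r *\<^sub>R x) / r \<le> norm (x - s)" using r by (simp add: field_simps)
    qed
    thus "p (r *\<^sub>R x) \<le> r * p x" using r by (simp add: field_simps)
  qed
  have pz: "p z > 0"
    using z ne in_closure_iff_infdist_zero[of S z] infdist_nonneg[of z S] unfolding p_def by linarith
  obtain p' where p': "sublinear p'" "\<And>x. p' x \<le> p x" "p' (- z) \<le> - p z"
    using sublinear_directional[OF p] by blast
  obtain f where f: "linear f" "\<And>x. f x \<le> p' x"
    using sublinear_dominates_linear[OF p'(1)] by blast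
  have fp: "f x \<le> p x" for x using f(2) p'(2) order_trans by blast
  have neg: "f (- x) = - f x" for x using linear_neg[OF f(1)] .
  have pn: "p x \<le> norm x" for x using le[OF S0, of x] by simp
  show ?thesis
  proof (intro exI[of _ f] conjI ballI)
    have "\<bar>f x\<bar> \<le> norm x" for x
      using fp[of x] fp[of "- x"] pn[of x] pn[of "- x"] by (simp add: neg abs_le_iff)
    thus "bounded_linear f"
      using f(1) by (intro bounded_linear.intro bounded_linear_axioms.intro) (auto intro: exI[of _ 1])
    show "f x = 0" if "x \<in> S" for x
    proof -
      have "p x \<le> 0" "p (- x) \<le> 0"
        using le[OF that, of x] le[OF subspace_neg[OF S that], of "- x"] by auto
      thus ?thesis using fp[of x] fp[of "- x"] by (simp add: neg)
    qed
    show "f z \<noteq> 0"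
      using f(2)[of "- z"] p'(3) pz by (auto simp: neg)
  qed
qed

section \<open>Finite tuples of operators\<close>

lemma LIMSEQ_norm_bound:
  fixes g :: "nat \<Rightarrow> 'b::real_normed_vector"
  assumes "b \<longlonglongrightarrow> 0" "\<And>k. norm (g k - l) \<le> b k"
  shows "g \<longlonglongrightarrow> l"
proof -
  have "(\<lambda>k. g k - l) \<longlonglongrightarrow> 0"
    by (rule Lim_null_comparison[OF always_eventually assms(1)]) (use assms(2) in blast)
  thus ?thesis by (simp add: Lim_null[symmetric])
qed

text \<open>Tuples of every length n live in one normed space, the bounded functions on the discrete
  space of natural numbers with the supremum norm; they are extended by 0 from n on.\<close>

definition tuple :: "nat \<Rightarrow> (nat \<Rightarrow> 'b::real_normed_vector) \<Rightarrow> nat \<Rightarrow>\<^sub>C 'b" where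
  "tuple n g = Bcontfun (\<lambda>j. if j < n then g j else 0)"

lemma apply_tuple: "apply_bcontfun (tuple n g) j = (if j < n then g j else 0)"
proof -
  have "norm (if j < n then g j else 0) \<le> (\<Sum>j<n. norm (g j))" for j
    by (auto intro: member_le_sum sum_nonneg)
  hence "(\<lambda>j. if j < n then g j else 0) \<in> bcontfun"
    by (intro bcontfun_normI[where b = "\<Sum>j<n. norm (g j)"]) auto
  thus ?thesis by (simp add: tuple_def Bcontfun_inverse)
qed

lemma norm_tuple_le: "norm (tuple n g) \<le> (\<Sum>j<n. norm (g j))"
  by (rule norm_bound) (auto simp: apply_tuple intro: member_le_sum sum_nonneg)

lemma tuple_add: "tuple n (\<lambda>j. g j + h j) = tuple n g + tuple n h"
  and tuple_scaleR: "tuple n (\<lambda>j. r *\<^sub>R g j) = r *\<^sub>R tuple n g"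
  by (auto intro!: bcontfun_eqI simp: apply_tuple)

lemma tuple_cong: "(\<And>j. j < n \<Longrightarrow> g j = h j) \<Longrightarrow> tuple n g = tuple n h"
  by (auto intro!: bcontfun_eqI simp: apply_tuple)

text \<open>The complex-linear functional with real part \<open>f\<close>.\<close>

definition complex_functional ::
    "((nat \<Rightarrow>\<^sub>C ('h::complex_inner \<Rightarrow>\<^sub>L 'h)) \<Rightarrow> real) \<Rightarrow> nat \<Rightarrow> (nat \<Rightarrow> 'h \<Rightarrow>\<^sub>L 'h) \<Rightarrow> complex" where
  "complex_functional f n g =
     Complex (f (tuple n g)) (- f (tuple n (\<lambda>j. scaleC_op \<i> o\<^sub>L g j)))"

context
  fixes f :: "(nat \<Rightarrow>\<^sub>C ('h::complex_inner \<Rightarrow>\<^sub>L 'h)) \<Rightarrow> real" and n :: nat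
  assumes f: "bounded_linear f"
begin

lemma complex_functional_cong:
  "(\<And>j. j < n \<Longrightarrow> g j = h j) \<Longrightarrow> complex_functional f n g = complex_functional f n h"
  by (simp add: complex_functional_def cong: tuple_cong)

lemma complex_functional_add:
  "complex_functional f n (\<lambda>j. g j + h j) = complex_functional f n g + complex_functional f n h"
proof -
  have "scaleC_op \<i> o\<^sub>L (g j + h j) = (scaleC_op \<i> o\<^sub>L g j) + (scaleC_op \<i> o\<^sub>L h j)" for j
    by (rule blinfun_eqI) (simp add: blinfun.add_left scaleC_add_right)
  thus ?thesis
    by (simp add: complex_functional_def tuple_add linear_add[OF bounded_linear.linear[OF f]]
        complex_eq_iff)
qed

lemma complex_functional_scaleC:
  "complex_functional f n (\<lambda>j. scaleC_op c o\<^sub>L g j) = c * complex_functional f n g"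
proof -
  have 1: "scaleC_op c o\<^sub>L g j = Re c *\<^sub>R g j + Im c *\<^sub>R (scaleC_op \<i> o\<^sub>L g j)" for j
  proof (rule blinfun_eqI)
    fix x
    have "c *\<^sub>C y = Re c *\<^sub>R y + Im c *\<^sub>R (\<i> *\<^sub>C y)" for y :: 'h
      by (subst complex_eq[of c])
         (simp add: scaleC_add_left scaleC_of_real mult.commute[of \<i>] flip: scaleC_scaleC)
    thus "(scaleC_op c o\<^sub>L g j) x = (Re c *\<^sub>R g j + Im c *\<^sub>R (scaleC_op \<i> o\<^sub>L g j)) x"
      by (simp add: blinfun.add_left blinfun.scaleR_left)
  qed
  have 2: "scaleC_op \<i> o\<^sub>L (scaleC_op c o\<^sub>L g j) = Re c *\<^sub>R (scaleC_op \<i> o\<^sub>L g j) + (- Im c) *\<^sub>R g j" for j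
  proof (rule blinfun_eqI)
    fix x
    have m1: "(- 1) *\<^sub>C y = - y" for y :: 'h using scaleC_of_real[of "-1" y] by simp
    show "(scaleC_op \<i> o\<^sub>L (scaleC_op c o\<^sub>L g j)) x = (Re c *\<^sub>R (scaleC_op \<i> o\<^sub>L g j) + (- Im c) *\<^sub>R g j) x"
      unfolding 1
      by (simp add: blinfun.add_left blinfun.scaleR_left scaleC_add_right scaleC_scaleR scaleC_scaleC m1
           blinfun.minus_left blinfun.diff_left)
  qed
  have lin: "linear f" by (rule bounded_linear.linear[OF f])
  show ?thesis
    unfolding complex_functional_def 2
    by (subst 1) (simp add: tuple_add tuple_scaleR linear_add[OF lin] linear_scale[OF lin]
        linear_diff[OF lin] linear_neg[OF lin] complex_eq_iff algebra_simps flip: scaleR_minus_left)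
qed

lemma complex_functional_0: "complex_functional f n (\<lambda>_. 0) = 0"
  using complex_functional_add[of "\<lambda>_. 0" "\<lambda>_. 0"] by simp

lemma complex_functional_sum:
  "complex_functional f n (\<lambda>j. \<Sum>x\<in>F. g x j) = (\<Sum>x\<in>F. complex_functional f n (g x))"
  by (induction F rule: infinite_finite_induct)
     (auto simp: complex_functional_0 complex_functional_add)

lemma complex_functional_diff:
  "complex_functional f n (\<lambda>j. g j - h j) = complex_functional f n g - complex_functional f n h"
  using complex_functional_add[of "\<lambda>j. g j - h j" h] by simp

lemma complex_functional_bound:
  obtains C where "0 \<le> C" "\<And>g. cmod (complex_functional f n g) \<le> C * (\<Sum>j<n. norm (g j))"
proof -
  obtain K where K: "0 \<le> K" "\<And>x. norm (f x) \<le> norm x * K"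
    using bounded_linear.nonneg_bounded[OF f] by blast
  have fg: "\<bar>f (tuple n g)\<bar> \<le> K * (\<Sum>j<n. norm (g j))" for g
    using K(2)[of "tuple n g"] mult_right_mono[OF norm_tuple_le[of n g] K(1)] by (simp add: mult.commute)
  have "cmod (complex_functional f n g) \<le> (2 * K) * (\<Sum>j<n. norm (g j))" for g
  proof -
    have "(\<Sum>j<n. norm (scaleC_op \<i> o\<^sub>L g j)) \<le> (\<Sum>j<n. norm (g j))"
      by (rule sum_mono) (use norm_scaleC_op_comp[of \<i>] in auto)
    hence "\<bar>f (tuple n (\<lambda>j. scaleC_op \<i> o\<^sub>L g j))\<bar> \<le> K * (\<Sum>j<n. norm (g j))"
      using fg[of "\<lambda>j. scaleC_op \<i> o\<^sub>L g j"] K(1) by (meson mult_left_mono order_trans)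
    moreover have "cmod (complex_functional f n g)
        \<le> \<bar>f (tuple n g)\<bar> + \<bar>f (tuple n (\<lambda>j. scaleC_op \<i> o\<^sub>L g j))\<bar>"
      using cmod_le[of "complex_functional f n g"] by (simp add: complex_functional_def)
    ultimately show ?thesis using fg[of g] by simp
  qed
  thus ?thesis using that[of "2 * K"] K(1) by simp
qed

lemma complex_functional_tendsto:
  assumes "\<And>j. j < n \<Longrightarrow> (\<lambda>k::nat. g k j) \<longlonglongrightarrow> h j"
  shows "(\<lambda>k. complex_functional f n (g k)) \<longlonglongrightarrow> complex_functional f n h"
proof -
  obtain C where C: "0 \<le> C" "\<And>g. cmod (complex_functional f n g) \<le> C * (\<Sum>j<n. norm (g j))"
    using complex_functional_bound by blast
  have "(\<lambda>k. C * (\<Sum>j<n. norm (g k j - h j))) \<longlonglongrightarrow> C * (\<Sum>j<n. norm (h j - h j))"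
    by (intro tendsto_intros assms) auto
  hence "(\<lambda>k. C * (\<Sum>j<n. norm (g k j - h j))) \<longlonglongrightarrow> 0" by simp
  thus ?thesis
    by (rule LIMSEQ_norm_bound) (simp add: C(2) flip: complex_functional_diff)
qed

end

section \<open>Approximation by finitely supported multipliers\<close>

lemma schur_rel_mult_add:
  "schur_rel \<phi> T S \<Longrightarrow> schur_rel \<psi> T S' \<Longrightarrow> schur_rel (\<lambda>s. \<phi> s + \<psi> s) T (S + S')"
  by (simp add: schur_rel_def blinfun.add_left cinner_add_left algebra_simps)

lemma schur_rel_mult_scaleC:
  "schur_rel \<phi> T S \<Longrightarrow> schur_rel (\<lambda>s. c * \<phi> s) T (scaleC_op c o\<^sub>L S)"
  by (simp add: schur_rel_def cinner_scaleC_left)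

lemma schur_rel_scaleC:
  "schur_rel \<phi> T S \<Longrightarrow> schur_rel \<phi> (scaleC_op c o\<^sub>L T) (scaleC_op c o\<^sub>L S)"
  by (simp add: schur_rel_def cinner_scaleC_left)

text \<open>An arbitrary operator if no Schur product of \<open>T\<close> with \<open>\<phi>\<close> exists.\<close>

definition schur ::
    "('g::group_add \<Rightarrow> complex) \<Rightarrow> (('g, 'h::complex_inner) ell2 \<Rightarrow>\<^sub>L ('g, 'h) ell2) \<Rightarrow>
     ('g, 'h) ell2 \<Rightarrow>\<^sub>L ('g, 'h) ell2" where
  "schur \<phi> T = (SOME S. schur_rel \<phi> T S)"

lemma schur_eqI: "schur_rel \<phi> T S \<Longrightarrow> schur \<phi> T = S"
  unfolding schur_def by (metis schur_rel_unique someI)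

context represented_system
begin

abbreviation P where "P \<equiv> reduced_crossed_product \<sigma> \<alpha>"

lemma
  assumes "v \<in> fourier_algebra" "T \<in> P"
  shows schur_rel_schur: "schur_rel v T (schur v T)" and schur_in_P: "schur v T \<in> P"
  using schur_exists[OF assms] schur_eqI by metis+

lemma schur_crossed_sum:
  "finite {x. a x \<noteq> 0} \<Longrightarrow> schur v (crossed_sum \<sigma> \<alpha> a) = crossed_sum \<sigma> \<alpha> (\<lambda>x. v x *\<^sub>C a x)"
  by (rule schur_eqI) (rule crossed_sum_schur_rel)

text \<open>Coefficient functions are sesquilinear in (\<xi>, \<eta>), so the difference splits into
  the terms for (X m - \<xi>, \<eta>) and (X m, Y m - \<eta>), each controlled by the norm bound.
  This carries statements from finitely supported functions over to A(G).\<close>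

lemma schur_coefficient_tendsto:
  fixes X Y :: "nat \<Rightarrow> ('g, complex) ell2"
  assumes T: "T \<in> P" and X: "X \<longlonglongrightarrow> \<xi>" and Y: "Y \<longlonglongrightarrow> \<eta>"
  shows "(\<lambda>m. schur (coefficient (X m) (Y m)) T) \<longlonglongrightarrow> schur (coefficient \<xi> \<eta>) T"
proof -
  have rel: "schur_rel (coefficient \<xi> \<eta>) T (schur (coefficient \<xi> \<eta>) T)" for \<xi> \<eta>
    by (intro schur_rel_schur coefficient_in_fourier_algebra T)
  have bound: "norm (schur (coefficient \<xi> \<eta>) T) \<le> norm \<xi> * norm \<eta> * norm T" for \<xi> \<eta>
    by (intro coefficient_schur_norm_le rel reduced_crossed_product_in_cblinops T)
  have diff: "schur (coefficient (X m) (Y m)) T - schur (coefficient \<xi> \<eta>) T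
      = schur (coefficient (X m - \<xi>) \<eta>) T + schur (coefficient (X m) (Y m - \<eta>)) T" for m
  proof -
    have "coefficient (X m) (Y m) = (\<lambda>s. coefficient \<xi> \<eta> s +
        (coefficient (X m - \<xi>) \<eta> s + coefficient (X m) (Y m - \<eta>) s))"
      by (simp add: coefficient_def fun_eq_iff blinfun.diff_right cinner_diff_left cinner_diff_right)
    hence "schur (coefficient (X m) (Y m)) T = schur (coefficient \<xi> \<eta>) T +
        (schur (coefficient (X m - \<xi>) \<eta>) T + schur (coefficient (X m) (Y m - \<eta>)) T)"
      by (intro schur_eqI) (simp only: schur_rel_mult_add rel)
    thus ?thesis by simp
  qed
  have le: "norm (schur (coefficient (X m) (Y m)) T - schur (coefficient \<xi> \<eta>) T)
      \<le> norm (X m - \<xi>) * norm \<eta> * norm T + norm (X m) * norm (Y m - \<eta>) * norm T" for m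
    unfolding diff by (intro norm_triangle_le add_mono bound)
  have "(\<lambda>m. norm (X m - \<xi>) * norm \<eta> * norm T + norm (X m) * norm (Y m - \<eta>) * norm T)
      \<longlonglongrightarrow> norm (\<xi> - \<xi>) * norm \<eta> * norm T + norm \<xi> * norm (\<eta> - \<eta>) * norm T"
    by (intro tendsto_intros X Y)
  hence "(\<lambda>m. norm (X m - \<xi>) * norm \<eta> * norm T + norm (X m) * norm (Y m - \<eta>) * norm T)
      \<longlonglongrightarrow> 0" by simp
  thus ?thesis
    by (rule LIMSEQ_norm_bound) (rule le)
qed

lemma crossed_embed_scaleC: "crossed_embed \<sigma> \<alpha> (c *\<^sub>C a) = scaleC_op c o\<^sub>L crossed_embed \<sigma> \<alpha> a"
  by (intro blinfun_eqI ell2_eqI) (simp add: Rep_crossed_embed Rep_ell2_simps twisted_scaleC)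

lemma crossed_sum_superset:
  assumes "finite F" "{x. a x \<noteq> 0} \<subseteq> F"
  shows "crossed_sum \<sigma> \<alpha> a = (\<Sum>x\<in>F. crossed_embed \<sigma> \<alpha> (a x) o\<^sub>L left_regular x)"
proof -
  have "crossed_embed \<sigma> \<alpha> 0 = 0"
    by (intro blinfun_eqI ell2_eqI) (simp add: Rep_crossed_embed Rep_ell2_simps)
  thus ?thesis
    unfolding crossed_sum_def using assms
    by (intro sum.mono_neutral_left) (auto intro!: blinfun_eqI)
qed

lemma tuple_in_closure:
  assumes AP: "approximation_property TYPE('g)" and T: "\<And>j. j < n \<Longrightarrow> T j \<in> P"
  shows "tuple n T \<in> closure {tuple n (\<lambda>j. schur v (T j)) | v. finite {x. v x \<noteq> 0}}"
proof (rule ccontr)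
  let ?W = "{tuple n (\<lambda>j. schur v (T j)) | v. finite {x. v x \<noteq> 0}}"
  assume notin: "tuple n T \<notin> closure ?W"
  have rel: "schur_rel v (T j) (schur v (T j))" if "v \<in> fourier_algebra" "j < n" for v j
    by (intro schur_rel_schur that T)
  \<comment> \<open>Stability under complex scalars is more than \<open>subspace\<close> expresses;
    the case of the scalar i makes the imaginary part of the complex functional vanish.\<close>
  have scal: "tuple n (\<lambda>j. scaleC_op c o\<^sub>L schur v (T j)) \<in> ?W" if v: "finite {x. v x \<noteq> 0}" for v c
  proof -
    have "schur (\<lambda>x. c * v x) (T j) = scaleC_op c o\<^sub>L schur v (T j)" if "j < n" for j
      by (intro schur_eqI schur_rel_mult_scaleC rel finite_support_is_coefficient v that)
    moreover have "finite {x. c * v x \<noteq> 0}" by (rule finite_subset[OF _ v]) auto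
    ultimately show ?thesis
      by (auto intro!: exI[of _ "\<lambda>x. c * v x"] tuple_cong simp del: mult_eq_0_iff)
  qed
  have sub: "subspace ?W"
  proof (rule subspaceI)
    have "tuple n (\<lambda>j. schur (\<lambda>_. 0) (T j)) = 0"
      by (rule bcontfun_eqI) (auto simp: apply_tuple schur_rel_def intro!: schur_eqI)
    thus "0 \<in> ?W" by (auto intro!: exI[of _ "\<lambda>_. 0"])
  next
    fix x y assume "x \<in> ?W" "y \<in> ?W"
    then obtain v w where v: "x = tuple n (\<lambda>j. schur v (T j))" "finite {x. v x \<noteq> 0}"
      and w: "y = tuple n (\<lambda>j. schur w (T j))" "finite {x. w x \<noteq> 0}" by blast
    have "schur (\<lambda>x. v x + w x) (T j) = schur v (T j) + schur w (T j)" if "j < n" for j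
      by (intro schur_eqI schur_rel_mult_add rel finite_support_is_coefficient v w that)
    hence "x + y = tuple n (\<lambda>j. schur (\<lambda>x. v x + w x) (T j))"
      unfolding v w tuple_add[symmetric] by (intro tuple_cong) simp
    moreover have "finite {x. v x + w x \<noteq> 0}" by (rule finite_support_add[OF v(2) w(2)])
    ultimately show "x + y \<in> ?W" by blast
  next
    fix r :: real and x assume "x \<in> ?W"
    then obtain v where v: "x = tuple n (\<lambda>j. schur v (T j))" "finite {x. v x \<noteq> 0}" by blast
    have "r *\<^sub>R x = tuple n (\<lambda>j. scaleC_op (complex_of_real r) o\<^sub>L schur v (T j))"
      unfolding v tuple_scaleR[symmetric]
      by (intro tuple_cong blinfun_eqI) (simp add: blinfun.scaleR_left scaleC_of_real)
    thus "r *\<^sub>R x \<in> ?W" using scal[OF v(2)] by simp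
  qed
  obtain f :: "_ \<Rightarrow> real" where f: "bounded_linear f" "\<forall>x\<in>?W. f x = 0" "f (tuple n T) \<noteq> 0"
    using subspace_separation[OF sub notin] by blast
  \<comment> \<open>The separating f is only real-linear; \<omega> is complex-linear with real part
    f, so that complex values of \<phi> can be taken out of it.\<close>
  define \<omega> where "\<omega> = complex_functional f n"
  obtain C where C: "0 \<le> C" "\<And>g. cmod (\<omega> g) \<le> C * (\<Sum>j<n. norm (g j))"
    unfolding \<omega>_def using complex_functional_bound[OF f(1)] by blast
  have \<omega>_finite: "\<omega> (\<lambda>j. schur v (T j)) = 0" if "finite {x. v x \<noteq> 0}" for v
  proof -
    have "tuple n (\<lambda>j. schur v (T j)) \<in> ?W" using that by blast
    with f(2) have "f (tuple n (\<lambda>j. schur v (T j))) = 0" by (rule bspec)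
    moreover have "f (tuple n (\<lambda>j. scaleC_op \<i> o\<^sub>L schur v (T j))) = 0"
      using f(2) scal[OF that] by (rule bspec)
    ultimately show ?thesis
      by (simp add: \<omega>_def complex_functional_def complex_eq_iff)
  qed
  have \<omega>_zero: "\<omega> (\<lambda>j. schur v (T j)) = 0" if "v \<in> fourier_algebra" for v
  proof -
    obtain \<xi> \<eta> where v: "v = coefficient \<xi> \<eta>" using \<open>v \<in> fourier_algebra\<close> by (auto simp: fourier_algebra_def)
    obtain X where X: "X \<longlonglongrightarrow> \<xi>" "\<And>m::nat. finite {i. Rep_ell2 (X m) i \<noteq> 0}"
      using ell2_finite_support_seq[of \<xi>] by blast
    obtain Y where Y: "Y \<longlonglongrightarrow> \<eta>" "\<And>m::nat. finite {i. Rep_ell2 (Y m) i \<noteq> 0}"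
      using ell2_finite_support_seq[of \<eta>] by blast
    have "(\<lambda>m. \<omega> (\<lambda>j. schur (coefficient (X m) (Y m)) (T j))) \<longlonglongrightarrow> \<omega> (\<lambda>j. schur v (T j))"
      unfolding \<omega>_def v
      by (rule complex_functional_tendsto[OF f(1)]) (intro schur_coefficient_tendsto T X Y)
    thus ?thesis
      using \<omega>_finite[OF coefficient_finite_support[OF X(2) Y(2)]] by (simp add: LIMSEQ_const_iff)
  qed
  have "\<forall>j. \<exists>a. j < n \<longrightarrow> (\<forall>k::nat. finite {x. a k x \<noteq> 0}) \<and> (\<lambda>k. crossed_sum \<sigma> \<alpha> (a k)) \<longlonglongrightarrow> T j"
    using reduced_crossed_product_seq[OF T] by metis
  then obtain a where a: "\<And>j k. j < n \<Longrightarrow> finite {x. a j k x \<noteq> 0}"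
      "\<And>j. j < n \<Longrightarrow> (\<lambda>k::nat. crossed_sum \<sigma> \<alpha> (a j k)) \<longlonglongrightarrow> T j"
    unfolding choice_iff by blast
  \<comment> \<open>q k x is the value of \<omega> on the x-component of the k-th approximating
    tuple. Pairing the finitely supported q k with any function \<phi> then gives \<omega> of that
    tuple multiplied by \<phi>.\<close>
  define q where "q k x = \<omega> (\<lambda>j. crossed_embed \<sigma> \<alpha> (a j k x) o\<^sub>L left_regular x)" for k x
  define F where "F k = (\<Union>j<n. {x. a j k x \<noteq> 0})" for k
  have F: "finite (F k)" for k using a(1) by (auto simp: F_def)
  have emb0: "crossed_embed \<sigma> \<alpha> 0 o\<^sub>L left_regular x = 0" for x :: 'g
    by (intro blinfun_eqI ell2_eqI) (simp add: Rep_crossed_embed Rep_ell2_simps)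
  have q0: "q k x = 0" if "x \<notin> F k" for k x
  proof -
    have "q k x = \<omega> (\<lambda>_. 0)"
      unfolding q_def \<omega>_def
      by (rule complex_functional_cong[OF f(1)]) (use that emb0 in \<open>auto simp: F_def\<close>)
    thus ?thesis by (simp add: \<omega>_def complex_functional_0[OF f(1)])
  qed
  have pair: "(\<Sum>\<^sub>\<infinity>x. q k x * \<phi> x) = \<omega> (\<lambda>j. crossed_sum \<sigma> \<alpha> (\<lambda>x. \<phi> x *\<^sub>C a j k x))" for k \<phi>
  proof -
    have "(\<Sum>\<^sub>\<infinity>x. q k x * \<phi> x) = (\<Sum>x\<in>F k. \<phi> x * q k x)"
      using q0 by (subst infsum_finite_support[OF F[of k]]) (auto simp: mult.commute)
    also have "\<dots> = \<omega> (\<lambda>j. \<Sum>x\<in>F k. scaleC_op (\<phi> x) o\<^sub>L (crossed_embed \<sigma> \<alpha> (a j k x) o\<^sub>L left_regular x))"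
      unfolding q_def \<omega>_def complex_functional_sum[OF f(1)] complex_functional_scaleC[OF f(1)] ..
    also have "\<dots> = \<omega> (\<lambda>j. crossed_sum \<sigma> \<alpha> (\<lambda>x. \<phi> x *\<^sub>C a j k x))"
      unfolding \<omega>_def
    proof (rule complex_functional_cong[OF f(1)])
      fix j assume j: "j < n"
      have "{x. \<phi> x *\<^sub>C a j k x \<noteq> 0} \<subseteq> F k" using j by (auto simp: F_def)
      thus "(\<Sum>x\<in>F k. scaleC_op (\<phi> x) o\<^sub>L (crossed_embed \<sigma> \<alpha> (a j k x) o\<^sub>L left_regular x))
          = crossed_sum \<sigma> \<alpha> (\<lambda>x. \<phi> x *\<^sub>C a j k x)"
        by (subst crossed_sum_superset[OF F]) (auto simp: crossed_embed_scaleC blinfun.sum_left intro!: blinfun_eqI)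
    qed
    finally show ?thesis .
  qed
  \<comment> \<open>The supremum runs over the unit ball of M_cb A(G), whose members act
    contractively on differences of finite sums; the constant C is the bound of \<omega>.\<close>
  have Qcb_le: "Qcb_norm (\<lambda>x. q m x - q k x)
      \<le> C * (\<Sum>j<n. norm (crossed_sum \<sigma> \<alpha> (a j m) - crossed_sum \<sigma> \<alpha> (a j k)))" for m k
    unfolding Qcb_norm_def
  proof (rule cSup_least)
    show "{cmod (\<Sum>\<^sub>\<infinity>x. (q m x - q k x) * \<phi> x) | \<phi>. \<phi> \<in> McbA \<and> cb_norm \<phi> \<le> 1} \<noteq> {}"
      using zero_in_McbA by blast
    fix r assume "r \<in> {cmod (\<Sum>\<^sub>\<infinity>x. (q m x - q k x) * \<phi> x) | \<phi>. \<phi> \<in> McbA \<and> cb_norm \<phi> \<le> 1}"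
    then obtain \<phi> where r: "r = cmod (\<Sum>\<^sub>\<infinity>x. (q m x - q k x) * \<phi> x)" and \<phi>: "\<phi> \<in> McbA" "cb_norm \<phi> \<le> 1"
      by blast
    let ?S = "\<lambda>j k. crossed_sum \<sigma> \<alpha> (\<lambda>x. \<phi> x *\<^sub>C a j k x)"
    have fin: "(\<Sum>\<^sub>\<infinity>x. g x) = (\<Sum>x\<in>F m \<union> F k. g x)"
      if "\<And>x. x \<notin> F m \<union> F k \<Longrightarrow> g x = 0" for g :: "'g \<Rightarrow> complex"
      by (rule infsum_finite_support) (use F that in auto)
    have "(\<Sum>\<^sub>\<infinity>x. (q m x - q k x) * \<phi> x) = (\<Sum>\<^sub>\<infinity>x. q m x * \<phi> x) - (\<Sum>\<^sub>\<infinity>x. q k x * \<phi> x)"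
      by (subst (1 2 3) fin) (auto simp: q0 left_diff_distrib sum_subtractf)
    also have "\<dots> = \<omega> (\<lambda>j. ?S j m - ?S j k)"
      unfolding pair \<omega>_def complex_functional_diff[OF f(1)] ..
    finally have "r \<le> C * (\<Sum>j<n. norm (?S j m - ?S j k))"
      unfolding r by (simp add: C(2))
    also have "\<dots> \<le> C * (\<Sum>j<n. norm (crossed_sum \<sigma> \<alpha> (a j m) - crossed_sum \<sigma> \<alpha> (a j k)))"
      by (intro mult_left_mono sum_mono C(1) McbA_schur_norm_le[OF \<phi>] cblinops_minus
           crossed_sum_in_cblinops schur_rel_diff crossed_sum_schur_rel a(1)) auto
    finally show "r \<le> \<dots>" .
  qed
  have "q \<in> Qcb"
    unfolding Qcb_def
  proof (intro CollectI conjI allI impI)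
    show "(\<lambda>x. cmod (q k x)) summable_on UNIV" for k
      by (rule summable_on_finite_support[OF F[of k]]) (simp add: q0)
    fix e :: real assume e: "e > 0"
    \<comment> \<open>There are n coordinates, and \<omega> contributes the factor C; adding 1
      avoids division by zero when C or n is 0.\<close>
    define \<delta> where "\<delta> = e / (C * n + 1)"
    have Cn: "C * n + 1 > 0" using C(1) by (simp add: add_nonneg_pos)
    have \<delta>: "\<delta> > 0" using e Cn by (simp add: \<delta>_def)
    have "\<forall>j. \<exists>N. j < n \<longrightarrow> (\<forall>m\<ge>N. \<forall>k\<ge>N. norm (crossed_sum \<sigma> \<alpha> (a j m) - crossed_sum \<sigma> \<alpha> (a j k)) < \<delta>)"
      using metric_CauchyD[OF LIMSEQ_imp_Cauchy[OF a(2)] \<delta>] unfolding dist_norm by blast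
    then obtain N where N: "\<And>j m k. j < n \<Longrightarrow> m \<ge> N j \<Longrightarrow> k \<ge> N j \<Longrightarrow>
        norm (crossed_sum \<sigma> \<alpha> (a j m) - crossed_sum \<sigma> \<alpha> (a j k)) < \<delta>"
      unfolding choice_iff by blast
    \<comment> \<open>The sum of the N j is a common index beyond each of them.\<close>
    have "Qcb_norm (\<lambda>x. q m x - q k x) < e" if mk: "m \<ge> (\<Sum>j<n. N j)" "k \<ge> (\<Sum>j<n. N j)" for m k
    proof -
      have NN: "N j \<le> (\<Sum>j<n. N j)" if "j < n" for j
        using that by (intro member_le_sum) auto
      have "norm (crossed_sum \<sigma> \<alpha> (a j m) - crossed_sum \<sigma> \<alpha> (a j k)) \<le> \<delta>" if "j < n" for j
        using N[OF that, of m k] NN[OF that] mk by simp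
      hence "(\<Sum>j<n. norm (crossed_sum \<sigma> \<alpha> (a j m) - crossed_sum \<sigma> \<alpha> (a j k))) \<le> n * \<delta>"
        using sum_bounded_above[of "{..<n}" _ \<delta>] by simp
      hence "Qcb_norm (\<lambda>x. q m x - q k x) \<le> C * (n * \<delta>)"
        using Qcb_le[of m k] C(1) by (meson mult_left_mono order_trans)
      also have "\<dots> < (C * n + 1) * \<delta>" using \<delta> by (simp add: algebra_simps)
      also have "\<dots> = e" using Cn by (simp add: \<delta>_def)
      finally show ?thesis .
    qed
    thus "\<exists>N. \<forall>m\<ge>N. \<forall>k\<ge>N. Qcb_norm (\<lambda>x. q m x - q k x) < e" by blast
  qed
  \<comment> \<open>For v in A(G) the multiplied approximants converge to
    \<open>schur v (T j)\<close>, which identifies the limit in \<open>Qcb_pairing\<close> as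
    \<omega> of the multiplied tuple.\<close>
  have pairing_zero: "Qcb_pairing v q = 0" if v: "v \<in> fourier_algebra" for v
  proof -
    have "(\<lambda>k. crossed_sum \<sigma> \<alpha> (\<lambda>x. v x *\<^sub>C a j k x)) \<longlonglongrightarrow> schur v (T j)" if j: "j < n" for j
      using schur_tendsto[OF v a(1)[OF j] a(2)[OF j]] schur_eqI by metis
    hence "(\<lambda>k. \<omega> (\<lambda>j. crossed_sum \<sigma> \<alpha> (\<lambda>x. v x *\<^sub>C a j k x))) \<longlonglongrightarrow> \<omega> (\<lambda>j. schur v (T j))"
      unfolding \<omega>_def by (rule complex_functional_tendsto[OF f(1)])
    thus ?thesis
      unfolding Qcb_pairing_def pair using \<omega>_zero[OF v] by (simp add: limI)
  qed
  \<comment> \<open>The constant function 1 leaves the approximants unchanged, so its pairing with q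
    is the limit \<omega> T.\<close>
  have "(\<lambda>k. \<omega> (\<lambda>j. crossed_sum \<sigma> \<alpha> (a j k))) \<longlonglongrightarrow> \<omega> T"
    unfolding \<omega>_def by (rule complex_functional_tendsto[OF f(1)]) (rule a(2))
  hence "Qcb_pairing (\<lambda>_. 1) q = \<omega> T"
    unfolding Qcb_pairing_def pair by (simp add: limI)
  obtain \<F> :: "('g \<Rightarrow> complex) filter" where \<F>: "\<F> \<noteq> bot" "\<forall>\<^sub>F v in \<F>. v \<in> fourier_algebra"
      "((\<lambda>v. Qcb_pairing v q) \<longlongrightarrow> Qcb_pairing (\<lambda>_. 1) q) \<F>"
    using AP \<open>q \<in> Qcb\<close> unfolding approximation_property_def by blast
  have "((\<lambda>v. Qcb_pairing v q) \<longlongrightarrow> 0) \<F>"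
    by (rule tendsto_eventually) (use \<F>(2) pairing_zero in \<open>auto elim: eventually_mono\<close>)
  hence "\<omega> T = 0"
    using tendsto_unique[OF \<F>(1,3)] \<open>Qcb_pairing (\<lambda>_. 1) q = \<omega> T\<close> by simp
  hence "f (tuple n T) = 0"
    by (simp add: \<omega>_def complex_functional_def complex_eq_iff)
  with f(3) show False by simp
qed

text \<open>The supremum norm on tuples dominates every coordinate, so approximating the tuple gives
  one v for all operators in A.\<close>

lemma finite_support_approximation:
  assumes AP: "approximation_property TYPE('g)" and "finite A" "A \<subseteq> P" "e > 0"
  obtains v where "finite {x. v x \<noteq> 0}" "\<And>T. T \<in> A \<Longrightarrow> norm (schur v T - T) < e"
proof -
  obtain n :: nat and T where A: "A = T ` {j. j < n}"
    using finite_imp_nat_seg_image_inj_on[OF assms(2)] by blast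
  hence "tuple n T \<in> closure {tuple n (\<lambda>j. schur v (T j)) | v. finite {x. v x \<noteq> 0}}"
    using assms(3) by (intro tuple_in_closure[OF AP]) auto
  then obtain v where v: "finite {x. v x \<noteq> 0}" "dist (tuple n (\<lambda>j. schur v (T j))) (tuple n T) < e"
    using \<open>e > 0\<close> unfolding closure_approachable by blast
  have "norm (schur v (T j) - T j) < e" if "j < n" for j
    using dist_fun_lt_imp_dist_val_lt[OF v(2), of j] that by (simp add: apply_tuple dist_norm)
  thus ?thesis using that v(1) A by blast
qed

section \<open>The Fejer property\<close>

lemma schur_extends_multiplier:
  assumes v: "finite {x. v x \<noteq> 0}"
  shows "extends_multiplier \<sigma> \<alpha> (\<lambda>x a. v x *\<^sub>C a) (schur v)"
proof -
  have vA: "v \<in> fourier_algebra" by (rule finite_support_is_coefficient[OF v])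
  then obtain \<xi> \<eta> where c: "v = coefficient \<xi> \<eta>" by (auto simp: fourier_algebra_def)
  note rel = schur_rel_schur[OF vA]
  show ?thesis
    unfolding extends_multiplier_def Let_def
  proof (intro conjI ballI allI impI)
    show "schur v T \<in> P" if "T \<in> P" for T by (rule schur_in_P[OF vA that])
    show "schur v (S + T) = schur v S + schur v T" if "S \<in> P" "T \<in> P" for S T
      by (intro schur_eqI schur_rel_add rel that)
    show "schur v S \<xi> = c *\<^sub>C schur v T \<xi>"
      if "S \<in> P" "T \<in> P" "\<forall>\<xi>. S \<xi> = c *\<^sub>C T \<xi>" for c S T \<xi>
    proof -
      have "S = scaleC_op c o\<^sub>L T" using that(3) by (intro blinfun_eqI) simp
      hence "schur v S = scaleC_op c o\<^sub>L schur v T"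
        using schur_eqI[OF schur_rel_scaleC[OF rel[OF that(2)]]] by simp
      thus ?thesis by simp
    qed
    have "norm (schur v T) \<le> norm \<xi> * norm \<eta> * norm T" if "T \<in> P" for T
      by (rule coefficient_schur_norm_le[OF reduced_crossed_product_in_cblinops[OF that] rel[OF that, unfolded c], folded c])
    thus "\<exists>K. \<forall>T\<in>P. norm (schur v T) \<le> K * norm T" by blast
    show "schur v (crossed_sum \<sigma> \<alpha> a) = crossed_sum \<sigma> \<alpha> (\<lambda>x. v x *\<^sub>C a x)"
      if "finite {x. a x \<noteq> 0}" for a by (rule schur_crossed_sum[OF that])
  qed
qed

text \<open>\<open>multiplier_map\<close> selects some extension. Bounded extensions agree on the
  dense finite sums and hence on the crossed product; outside it their values are
  unconstrained.\<close>

lemma multiplier_map_eq_schur: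
  assumes v: "finite {x. v x \<noteq> 0}" and T: "T \<in> P"
  shows "multiplier_map \<sigma> \<alpha> (\<lambda>x a. v x *\<^sub>C a) T = schur v T"
proof -
  define M where "M = multiplier_map \<sigma> \<alpha> (\<lambda>x a. v x *\<^sub>C a)"
  have M: "extends_multiplier \<sigma> \<alpha> (\<lambda>x a. v x *\<^sub>C a) M"
    unfolding M_def multiplier_map_def by (rule someI[of _ "schur v"]) (rule schur_extends_multiplier[OF v])
  obtain a where a: "\<And>k::nat. finite {x. a k x \<noteq> 0}" "(\<lambda>k. crossed_sum \<sigma> \<alpha> (a k)) \<longlonglongrightarrow> T"
    using reduced_crossed_product_seq[OF T] by blast
  obtain K where K: "\<And>T. T \<in> P \<Longrightarrow> norm (M T) \<le> K * norm T"
    using M unfolding extends_multiplier_def Let_def by blast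
  have add: "M (S + T) = M S + M T" if "S \<in> P" "T \<in> P" for S T
    using M that unfolding extends_multiplier_def Let_def by blast
  have sum: "M (crossed_sum \<sigma> \<alpha> a) = crossed_sum \<sigma> \<alpha> (\<lambda>x. v x *\<^sub>C a x)" if "finite {x. a x \<noteq> 0}" for a
    using M that unfolding extends_multiplier_def Let_def by blast
  have le: "norm (M S - M T) \<le> K * norm (S - T)" if "S \<in> P" "T \<in> P" for S T
  proof -
    \<comment> \<open>M is additive and bounded on the crossed product only, so the difference must
      lie there before continuity of M can be deduced.\<close>
    have ST: "S - T \<in> P" by (rule subspace_diff[OF subspace_reduced_crossed_product that])
    have "M S = M (S - T) + M T" using add[OF ST that(2)] by simp
    thus ?thesis using K[OF ST] by simp
  qed
  have "(\<lambda>k. K * norm (crossed_sum \<sigma> \<alpha> (a k) - T)) \<longlonglongrightarrow> K * norm (T - T)"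
    by (intro tendsto_intros a(2))
  hence "(\<lambda>k. K * norm (crossed_sum \<sigma> \<alpha> (a k) - T)) \<longlonglongrightarrow> 0" by simp
  hence "(\<lambda>k. M (crossed_sum \<sigma> \<alpha> (a k))) \<longlonglongrightarrow> M T"
    by (rule LIMSEQ_norm_bound) (rule le[OF crossed_sum_in_reduced[OF a(1)] T])
  hence 1: "(\<lambda>k. crossed_sum \<sigma> \<alpha> (\<lambda>x. v x *\<^sub>C a k x)) \<longlonglongrightarrow> M T"
    by (simp add: sum[OF a(1)])
  have 2: "(\<lambda>k. crossed_sum \<sigma> \<alpha> (\<lambda>x. v x *\<^sub>C a k x)) \<longlonglongrightarrow> schur v T"
    using schur_tendsto[OF finite_support_is_coefficient[OF v] a] schur_eqI by metis
  show ?thesis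
    unfolding M_def[symmetric] by (rule LIMSEQ_unique[OF 1 2])
qed

text \<open>The filter is generated by the sets of multipliers that approximate T up to e. Its
  properness is the simultaneous approximation of finitely many operators, applied with the smallest
  of the finitely many tolerances.\<close>

lemma fejer_property_if_AP:
  assumes AP: "approximation_property TYPE('g)"
  shows "fejer_property \<sigma> \<alpha>"
proof -
  define U :: "(('g, 'h) ell2 \<Rightarrow>\<^sub>L ('g, 'h) ell2) \<times> real \<Rightarrow> ('g \<Rightarrow> 'a \<Rightarrow> 'a) set"
    where "U = (\<lambda>(T, e). {\<lambda>x a. v x *\<^sub>C a | v. finite {x. v x \<noteq> 0} \<and> norm (schur v T - T) < e})"
  define \<F> where "\<F> = (INF b\<in>P \<times> {0<..}. principal (U b))"
  have "\<F> \<noteq> bot"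
    unfolding \<F>_def
  proof (rule INF_filter_not_bot)
    fix X :: "((('g, 'h) ell2 \<Rightarrow>\<^sub>L ('g, 'h) ell2) \<times> real) set"
    assume X: "X \<subseteq> P \<times> {0<..}" "finite X"
    \<comment> \<open>The inserted 1 keeps \<open>Min\<close> meaningful when X is empty.\<close>
    define e where "e = Min (insert 1 (snd ` X))"
    have e: "e > 0" unfolding e_def using X by (subst Min_gr_iff) auto
    have le: "e \<le> snd b" if "b \<in> X" for b
      unfolding e_def using that X(2) by (intro Min_le) auto
    have "finite (fst ` X)" "fst ` X \<subseteq> P" using X by auto
    then obtain v where v: "finite {x. v x \<noteq> 0}" "\<And>T. T \<in> fst ` X \<Longrightarrow> norm (schur v T - T) < e"
      using finite_support_approximation[OF AP _ _ e] by blast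
    have "(\<lambda>x a. v x *\<^sub>C a) \<in> U b" if "b \<in> X" for b
      using v(1) v(2)[of "fst b"] le[OF that] that by (cases b) (force simp: U_def)
    hence "(\<Inter>b\<in>X. U b) \<noteq> {}" by blast
    thus "(INF b\<in>X. principal (U b)) \<noteq> bot"
      using X(2) by (simp add: INF_principal_finite principal_eq_bot_iff)
  qed
  moreover have "\<forall>\<^sub>F F in \<F>. bounded_multiplier \<sigma> \<alpha> F \<and> finite_G_support F"
    unfolding \<F>_def
  proof (rule eventually_INF1)
    \<comment> \<open>Every generating set consists of multipliers by finitely supported functions,
      so the choice of (0, 1) is arbitrary.\<close>
    show "(0, 1::real) \<in> P \<times> {0<..}"
      using subspace_0[OF subspace_reduced_crossed_product] by simp
    show "\<forall>\<^sub>F F in principal (U (0, 1)). bounded_multiplier \<sigma> \<alpha> F \<and> finite_G_support F"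
      unfolding eventually_principal
    proof
      fix F assume "F \<in> U (0, 1)"
      then obtain v where F: "F = (\<lambda>x a. v x *\<^sub>C a)" and v: "finite {x. v x \<noteq> 0}"
        by (auto simp: U_def)
      have "clinear_map (F x)" for x
        by (simp add: F clinear_map_def scaleC_add_right scaleC_scaleC mult.commute)
      moreover have "finite {x. F x \<noteq> (\<lambda>_. 0)}"
        by (rule finite_subset[OF _ v]) (auto simp: F)
      ultimately show "bounded_multiplier \<sigma> \<alpha> F \<and> finite_G_support F"
        unfolding bounded_multiplier_def finite_G_support_def
        using schur_extends_multiplier[OF v] F by blast
    qed
  qed
  moreover have "((\<lambda>F. multiplier_map \<sigma> \<alpha> F T) \<longlongrightarrow> T) \<F>" if T: "T \<in> P" for T
  proof (rule tendstoI)
    fix e :: real assume "e > 0"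
    show "\<forall>\<^sub>F F in \<F>. dist (multiplier_map \<sigma> \<alpha> F T) T < e"
      unfolding \<F>_def
    proof (rule eventually_INF1)
      show "(T, e) \<in> P \<times> {0<..}" using T \<open>e > 0\<close> by simp
      show "\<forall>\<^sub>F F in principal (U (T, e)). dist (multiplier_map \<sigma> \<alpha> F T) T < e"
        unfolding eventually_principal
        by (auto simp: U_def multiplier_map_eq_schur T dist_norm)
    qed
  qed
  ultimately show ?thesis
    unfolding fejer_property_def by blast
qed

end

theorem theorem5p4:
  fixes \<alpha> :: "'g::group_add \<Rightarrow> 'a::cstar_algebra \<Rightarrow> 'a"
    and \<sigma> :: "'a \<Rightarrow> 'h::chilbert_space \<Rightarrow>\<^sub>L 'h"
  assumes "approximation_property TYPE('g)"
    and "cstar_dynamical_system \<alpha>"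
    and "faithful_representation \<sigma>"
  shows "fejer_property \<sigma> \<alpha>"
proof -
  interpret represented_system \<alpha> \<sigma>
    by standard (rule assms)+
  show ?thesis
    by (rule fejer_property_if_AP) (rule assms)
qed

end
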